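(* Let $\epsilon$ be an integer, let $W$ be a vector space over $\mathbb{C}$ and let $U$ be any local subset of $\mathcal{E}(W)=\mathrm{Hom}(W,W((x)))$. Then $\langle U\rangle_{\phi_\epsilon}$ (with vertex operator map $Y_{\mathcal{E}}^{\epsilon}$ and vacuum vector $1_W$) is a vertex algebra, and $W$ is a $\phi_\epsilon$-coordinated $\langle U\rangle_{\phi_\epsilon}$-module with the canonical map $Y_W(\alpha(x),z)=\alpha(z)$ for $\alpha(x)\in\langle U\rangle_{\phi_\epsilon}$.
   Context: All vector spaces are over $\mathbb{C}$; $x,z,x_0,x_1,x_2$ are formal variables; $W((x_1,x_2))=W[[x_1,x_2]][x_1^{-1},x_2^{-1}]$. Fix an integer $\epsilon$ and set $\phi_\epsilon(x,z)=e^{z(x^\epsilon d/dx)}x=\sum_{n\ge0}\frac{z^n}{n!}\left(x^\epsilon\frac{d}{dx}\right)^n x\in\mathbb{C}((x))[[z]]$. For $F(x_1,x_2)\in\mathrm{Hom}(W,W((x_1,x_2)))$, the substitution $F|_{x_1=\phi_\epsilon(x_2,x_0)}$ is obtained by replacing each $x_1^m$ ($m\in\mathbb{Z}$) by $\phi_\epsilon(x_2,x_0)^m=e^{x_0x_2^\epsilon\partial/\partial x_2}x_2^m\in\mathbb{C}((x_2))[[x_0]]$. One has $\phi_\epsilon(x,z)-x=z\,h(x,z)$ with $h$ a unit in $\mathbb{C}((x))[[z]]$, so negative powers of $\phi_\epsilon(x,z)-x$ are elements of $\mathbb{C}((x))((z))$. Vertex algebra: a vector space $V$ with a linear map $Y(\cdot,x):V\to\mathrm{Hom}(V,V((x)))$,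 $Y(v,x)=\sum_{n\in\mathbb{Z}}v_nx^{-n-1}$, and a vector $\mathbf 1\in V$ such that $Y(\mathbf 1,x)=1$, $Y(v,x)\mathbf 1\in V[[x]]$ with $\lim_{x\to0}Y(v,x)\mathbf 1=v$; for all $u,v,w\in V$ there is $l\ge0$ with $(x_0+x_2)^lY(u,x_0+x_2)Y(v,x_2)w=(x_0+x_2)^lY(Y(u,x_0)v,x_2)w$; and for all $u,v\in V$ there is $k\ge 0$ with $(x_1-x_2)^kY(u,x_1)Y(v,x_2)=(x_1-x_2)^kY(v,x_2)Y(u,x_1)$. (Without the last condition, $V$ is called a nonlocal vertex algebra.) $\phi_\epsilon$-coordinated $V$-module: a vector space $W$ with a linear map $Y_W(\cdot,x):V\to\mathrm{Hom}(W,W((x)))$ such that $Y_W(\mathbf 1,x)=1_W$ and for all $u,v\in V$ there is an integer $k\ge0$ with $(x_1-x_2)^kY_W(u,x_1)Y_W(v,x_2)\in\mathrm{Hom}(W,W((x_1,x_2)))$ and $(\phi_\epsilon(x_2,x_0)-x_2)^kY_W(Y(u,x_0)v,x_2)=\left((x_1-x_2)^kY_W(u,x_1)Y_W(v,x_2)\right)|_{x_1=\phi_\epsilon(x_2,x_0)}$. A subset $U$ of $\mathcal{E}(W)$ is local if for any $a(x),b(x)\in U$ there is $k\ge0$ with $(x_1-x_2)^ka(x_1)b(x_2)=(x_1-x_2)^kb(x_2)a(x_1)$. A pair $(a(x),b(x))$ in $\mathcal{E}(W)$ is compatible if $(x_1-x_2)^ka(x_1)b(x_2)\in\mathrm{Hom}(W,W((x_1,x_2)))$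 for some $k\ge0$; every pair in a local subset is compatible. For a compatible pair, with such a $k$, define $a(x)^\epsilon_nb(x)\in\mathcal{E}(W)$ for $n\in\mathbb{Z}$ by $$Y_{\mathcal{E}}^\epsilon(a(x),z)b(x)=\sum_{n\in\mathbb{Z}}a(x)^\epsilon_nb(x)z^{-n-1}=(\phi_\epsilon(x,z)-x)^{-k}\left((x_1-x)^ka(x_1)b(x)\right)|_{x_1=\phi_\epsilon(x,z)}$$ (independent of the choice of $k$). A local subspace $V$ of $\mathcal{E}(W)$ is $Y_{\mathcal{E}}^\epsilon$-closed if $u(x)^\epsilon_nv(x)\in V$ for all $u(x),v(x)\in V$, $n\in\mathbb{Z}$. For a local subset $U$, $\langle U\rangle_{\phi_\epsilon}$ denotes the smallest $Y_{\mathcal{E}}^\epsilon$-closed local subspace of $\mathcal{E}(W)$ containing $U$ and the identity operator $1_W$ (it is known that it exists). *)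

theory Defs
  imports
    "HOL-Computational_Algebra.Formal_Laurent_Series"
    "HOL-Library.Function_Algebras"
    "HOL-Library.Groups_Big_Fun"
begin

unbundle fps_syntax

section \<open>Formal series with coefficients in a vector space\<close>

text \<open>
  A doubly infinite series in one variable is the function \<open>f :: int \<Rightarrow> 'a\<close> whose value \<open>f n\<close> is the
  coefficient of \<open>x\<^sup>n\<close>; in two variables \<open>F m n\<close> is the coefficient of the monomial with exponent \<open>m\<close>
  in the first and \<open>n\<close> in the second variable. Note that this is not the mode convention:
  \<open>v\<^sub>n\<close> is the coefficient of \<open>x\<close> to the power \<open>- n - 1\<close>.

  Addition of series is the pointwise one of \<^theory>\<open>HOL-Library.Function_Algebras\<close>.
\<close>

definition scale_series :: "('k \<Rightarrow> 'a \<Rightarrow> 'a) \<Rightarrow> 'k \<Rightarrow> (int \<Rightarrow> 'a) \<Rightarrow> int \<Rightarrow> 'a"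
  where "scale_series scale c f = (\<lambda>n. scale c (f n))"

definition laurent :: "'a::zero set \<Rightarrow> (int \<Rightarrow> 'a) set"
  where "laurent V = {f. (\<forall>n. f n \<in> V) \<and> (\<exists>N. \<forall>n<N. f n = 0)}"

text \<open>\<open>W((x\<^sub>1, x\<^sub>2))\<close>: both exponents are bounded below, uniformly.\<close>

definition laurent2 :: "(int \<Rightarrow> int \<Rightarrow> 'a::zero) set"
  where "laurent2 = {F. \<exists>N. \<forall>m n. m < N \<or> n < N \<longrightarrow> F m n = 0}"

definition monomial0 :: "'a::zero \<Rightarrow> int \<Rightarrow> 'a"
  where "monomial0 v = (\<lambda>n. if n = 0 then v else 0)"

definition linear_on ::
    "'a::plus set \<Rightarrow> ('k \<Rightarrow> 'a \<Rightarrow> 'a) \<Rightarrow> ('k \<Rightarrow> 'b::plus \<Rightarrow> 'b) \<Rightarrow> ('a \<Rightarrow> 'b) \<Rightarrow> bool"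
  where "linear_on V s t f \<longleftrightarrow>
    (\<forall>u\<in>V. \<forall>v\<in>V. f (u + v) = f u + f v) \<and> (\<forall>c. \<forall>u\<in>V. f (s c u) = t c (f u))"

text \<open>\<open>Hom(V, V((x)))\<close> for a subspace \<open>V\<close> of the ambient space. Values outside \<open>V\<close> are unconstrained.\<close>

definition Hom_laurent ::
    "('k \<Rightarrow> 'a::{plus,zero} \<Rightarrow> 'a) \<Rightarrow> 'a set \<Rightarrow> ('a \<Rightarrow> int \<Rightarrow> 'a) set"
  where "Hom_laurent scale V =
    {a. linear_on V scale (scale_series scale) a \<and> (\<forall>v\<in>V. a v \<in> laurent V)}"

text \<open>\<open>Hom(W, W((x\<^sub>1, x\<^sub>2)))\<close>\<close>

definition Hom_laurent2 ::
    "('k \<Rightarrow> 'w::{plus,zero} \<Rightarrow> 'w) \<Rightarrow> ('w \<Rightarrow> int \<Rightarrow> int \<Rightarrow> 'w) set"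
  where "Hom_laurent2 scale =
    {F. linear_on UNIV scale (scale_series (scale_series scale)) F \<and> (\<forall>w. F w \<in> laurent2)}"

text \<open>The product \<open>a(x\<^sub>1) b(x\<^sub>2)\<close> applied to \<open>w\<close>, as a series in \<open>x\<^sub>1\<close> and \<open>x\<^sub>2\<close>.\<close>

definition field_prod ::
    "('a \<Rightarrow> int \<Rightarrow> 'b) \<Rightarrow> ('c \<Rightarrow> int \<Rightarrow> 'a) \<Rightarrow> 'c \<Rightarrow> int \<Rightarrow> int \<Rightarrow> 'b"
  where "field_prod a b w = (\<lambda>m n. a (b w n) m)"

text \<open>Multiplication by \<open>x\<^sub>1 - x\<^sub>2\<close> and by \<open>x\<^sub>1 + x\<^sub>2\<close>; powers are obtained by iteration.\<close>

definition mult_diff :: "(int \<Rightarrow> int \<Rightarrow> 'a::minus) \<Rightarrow> int \<Rightarrow> int \<Rightarrow> 'a"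
  where "mult_diff F = (\<lambda>m n. F (m - 1) n - F m (n - 1))"

definition mult_sum :: "(int \<Rightarrow> int \<Rightarrow> 'a::plus) \<Rightarrow> int \<Rightarrow> int \<Rightarrow> 'a"
  where "mult_sum F = (\<lambda>m n. F (m - 1) n + F m (n - 1))"

text \<open>
  \<open>F(x\<^sub>0 + x\<^sub>2, x\<^sub>2)\<close>, where powers of \<open>x\<^sub>0 + x\<^sub>2\<close> are expanded in nonnegative powers of \<open>x\<^sub>2\<close>.
  The sum is finite if the exponents of the second variable of \<open>F\<close> are bounded below.
\<close>

definition subst_sum ::
    "(complex \<Rightarrow> 'a \<Rightarrow> 'a) \<Rightarrow> (int \<Rightarrow> int \<Rightarrow> 'a::comm_monoid_add) \<Rightarrow> int \<Rightarrow> int \<Rightarrow> 'a"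
  where "subst_sum scale F =
    (\<lambda>p q. Sum_any (\<lambda>i::nat.
       scale ((of_int (p + int i)) gchoose i) (F (p + int i) (q - int i))))"

text \<open>
  \<open>a(x\<^sub>1) b(x\<^sub>2) = b(x\<^sub>2) a(x\<^sub>1)\<close> up to a power of \<open>x\<^sub>1 - x\<^sub>2\<close>, as maps on \<open>V\<close>. On the right-hand side
  the variables of \<^const>\<open>field_prod\<close> are swapped, so that \<open>a\<close> again takes \<open>x\<^sub>1\<close>.
\<close>

definition mutually_local ::
    "'a::minus set \<Rightarrow> ('a \<Rightarrow> int \<Rightarrow> 'a) \<Rightarrow> ('a \<Rightarrow> int \<Rightarrow> 'a) \<Rightarrow> bool"
  where "mutually_local V a b \<longleftrightarrow>
    (\<exists>k::nat. \<forall>w\<in>V.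
       (mult_diff ^^ k) (field_prod a b w) = (mult_diff ^^ k) (\<lambda>m n. field_prod b a w n m))"


section \<open>The series \<open>\<phi>\<^sub>\<epsilon>\<close>\<close>

text \<open>
  \<open>\<complex>((x))((z))\<close> is rendered as \<^typ>\<open>complex fls fls\<close>: the outer variable is \<open>z\<close>, so that
  \<open>p $$ i $$ j\<close> is the coefficient of \<open>z\<^sup>i x\<^sup>j\<close>. This is a field, in which integer powers of
  \<open>\<phi>\<^sub>\<epsilon>(x, z)\<close> and of \<open>\<phi>\<^sub>\<epsilon>(x, z) - x\<close> are taken.
\<close>

definition x_deriv :: "int \<Rightarrow> complex fls \<Rightarrow> complex fls"
  where "x_deriv \<epsilon> f = fls_X_intpow \<epsilon> * fls_deriv f"

definition phi :: "int \<Rightarrow> complex fls fls"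
  where "phi \<epsilon> = fps_to_fls (Abs_fps (\<lambda>n. fls_const (1 / fact n) * (x_deriv \<epsilon> ^^ n) fls_X))"

definition phi_minus_x :: "int \<Rightarrow> complex fls fls"
  where "phi_minus_x \<epsilon> = phi \<epsilon> - fls_const fls_X"

text \<open>
  Product of \<open>p(x, z) \<in> \<complex>((x))((z))\<close> with a vector-valued series in which \<open>z\<close> is the first and \<open>x\<close> the
  second variable; the sum is finite for series in \<open>W((x))((z))\<close>.
\<close>

definition smult_series ::
    "(complex \<Rightarrow> 'a \<Rightarrow> 'a) \<Rightarrow> complex fls fls \<Rightarrow> (int \<Rightarrow> int \<Rightarrow> 'a::comm_monoid_add) \<Rightarrow>
     int \<Rightarrow> int \<Rightarrow> 'a"
  where "smult_series scale p F =
    (\<lambda>i j. Sum_any (\<lambda>(m, n). scale (p $$ m $$ n) (F (i - m) (j - n))))"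

text \<open>
  \<open>F(x\<^sub>1, x\<^sub>2)\<close> at \<open>x\<^sub>1 = \<phi>\<^sub>\<epsilon>(x\<^sub>2, x\<^sub>0)\<close>, as a series in \<open>x\<^sub>0\<close> (first variable) and \<open>x\<^sub>2\<close> (second variable).
  The sum is finite for \<open>F\<close> in \<^const>\<open>laurent2\<close>.
\<close>

definition subst_phi ::
    "(complex \<Rightarrow> 'a \<Rightarrow> 'a) \<Rightarrow> int \<Rightarrow> (int \<Rightarrow> int \<Rightarrow> 'a::comm_monoid_add) \<Rightarrow> int \<Rightarrow> int \<Rightarrow> 'a"
  where "subst_phi scale \<epsilon> F =
    (\<lambda>i j. Sum_any (\<lambda>(m, n). scale ((phi \<epsilon> powi m) $$ i $$ (j - n)) (F m n)))"


section \<open>Vertex algebras and \<open>\<phi>\<^sub>\<epsilon>\<close>-coordinated modules\<close>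

text \<open>
  The underlying space is a subspace \<open>V\<close> of the ambient space; \<open>Y u v n\<close> is the coefficient of \<open>x\<^sup>n\<close>
  in \<open>Y(u, x)v\<close>.
\<close>

locale nonlocal_vertex_algebra = vector_space scale
  for scale :: "complex \<Rightarrow> 'v::ab_group_add \<Rightarrow> 'v" +
  fixes V :: "'v set"
    and Y :: "'v \<Rightarrow> 'v \<Rightarrow> int \<Rightarrow> 'v"
    and vac :: 'v
  assumes subspace_carrier: "subspace V"
    and Y_Hom: "\<And>u. u \<in> V \<Longrightarrow> Y u \<in> Hom_laurent scale V"
    and Y_linear: "\<And>v. v \<in> V \<Longrightarrow> linear_on V scale (scale_series scale) (\<lambda>u. Y u v)"
    and vac_in_carrier: "vac \<in> V"
    and vacuum: "\<And>v. v \<in> V \<Longrightarrow> Y vac v = monomial0 v"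
    and creation_regular: "\<And>v n. v \<in> V \<Longrightarrow> n < 0 \<Longrightarrow> Y v vac n = 0"
    and creation_limit: "\<And>v. v \<in> V \<Longrightarrow> Y v vac 0 = v"
    and weak_associativity:
      "\<And>u v w. u \<in> V \<Longrightarrow> v \<in> V \<Longrightarrow> w \<in> V \<Longrightarrow>
         \<exists>l::nat. (mult_sum ^^ l) (subst_sum scale (field_prod (Y u) (Y v) w)) =
                  (mult_sum ^^ l) (\<lambda>p q. Y (Y u v p) w q)"

locale vertex_algebra = nonlocal_vertex_algebra +
  assumes weak_commutativity: "\<And>u v. u \<in> V \<Longrightarrow> v \<in> V \<Longrightarrow> mutually_local V (Y u) (Y v)"

locale phi_coordinated_module =
  V: vertex_algebra scaleV V Y vac + W: vector_space scaleW
  for \<epsilon> :: int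
    and scaleV :: "complex \<Rightarrow> 'v::ab_group_add \<Rightarrow> 'v"
    and V :: "'v set"
    and Y :: "'v \<Rightarrow> 'v \<Rightarrow> int \<Rightarrow> 'v"
    and vac :: 'v
    and scaleW :: "complex \<Rightarrow> 'w::ab_group_add \<Rightarrow> 'w" +
  fixes Y\<^sub>W :: "'v \<Rightarrow> 'w \<Rightarrow> int \<Rightarrow> 'w"
  assumes module_Hom: "\<And>v. v \<in> V \<Longrightarrow> Y\<^sub>W v \<in> Hom_laurent scaleW UNIV"
    and module_linear: "\<And>w. linear_on V scaleV (scale_series scaleW) (\<lambda>v. Y\<^sub>W v w)"
    and module_vacuum: "Y\<^sub>W vac = monomial0"
    and module_associativity:
      "\<And>u v. u \<in> V \<Longrightarrow> v \<in> V \<Longrightarrow>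
         \<exists>k::nat. (\<lambda>w. (mult_diff ^^ k) (field_prod (Y\<^sub>W u) (Y\<^sub>W v) w)) \<in> Hom_laurent2 scaleW \<and>
           (\<forall>w. smult_series scaleW (phi_minus_x \<epsilon> ^ k) (\<lambda>i j. Y\<^sub>W (Y u v i) w j) =
                subst_phi scaleW \<epsilon> ((mult_diff ^^ k) (field_prod (Y\<^sub>W u) (Y\<^sub>W v) w)))"


section \<open>The space \<open>\<E>(W)\<close> and its local subsets\<close>

abbreviation fields :: "(complex \<Rightarrow> 'w::ab_group_add \<Rightarrow> 'w) \<Rightarrow> ('w \<Rightarrow> int \<Rightarrow> 'w) set"
  where "fields scale \<equiv> Hom_laurent scale UNIV"

definition scale_field ::
    "(complex \<Rightarrow> 'w \<Rightarrow> 'w) \<Rightarrow> complex \<Rightarrow> ('w \<Rightarrow> int \<Rightarrow> 'w) \<Rightarrow> 'w \<Rightarrow> int \<Rightarrow> 'w"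
  where "scale_field scale c a = (\<lambda>w. scale_series scale c (a w))"

definition id_field :: "'w::zero \<Rightarrow> int \<Rightarrow> 'w"
  where "id_field = monomial0"

definition local_subset ::
    "(complex \<Rightarrow> 'w::ab_group_add \<Rightarrow> 'w) \<Rightarrow> ('w \<Rightarrow> int \<Rightarrow> 'w) set \<Rightarrow> bool"
  where "local_subset scale U \<longleftrightarrow>
    U \<subseteq> fields scale \<and> (\<forall>a\<in>U. \<forall>b\<in>U. mutually_local UNIV a b)"

definition compatible_order ::
    "(complex \<Rightarrow> 'w::ab_group_add \<Rightarrow> 'w) \<Rightarrow> ('w \<Rightarrow> int \<Rightarrow> 'w) \<Rightarrow> ('w \<Rightarrow> int \<Rightarrow> 'w) \<Rightarrow> nat \<Rightarrow> bool"
  where "compatible_order scale a b k \<longleftrightarrow>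
    (\<lambda>w. (mult_diff ^^ k) (field_prod a b w)) \<in> Hom_laurent2 scale"

text \<open>
  \<open>Y_E scale \<epsilon> a b n\<close> is the coefficient of \<open>z\<^sup>n\<close> in \<open>Y\<^sub>\<E>\<^sup>\<epsilon>(a(x), z)b(x)\<close>. It is meaningful for
  compatible pairs only, and then independent of the choice of \<open>k\<close>.
\<close>

definition Y_E ::
    "(complex \<Rightarrow> 'w::ab_group_add \<Rightarrow> 'w) \<Rightarrow> int \<Rightarrow> ('w \<Rightarrow> int \<Rightarrow> 'w) \<Rightarrow> ('w \<Rightarrow> int \<Rightarrow> 'w) \<Rightarrow>
     int \<Rightarrow> 'w \<Rightarrow> int \<Rightarrow> 'w"
  where "Y_E scale \<epsilon> a b =
    (let k = (SOME k. compatible_order scale a b k)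
     in (\<lambda>n w j. smult_series scale (phi_minus_x \<epsilon> powi (- int k))
          (subst_phi scale \<epsilon> ((mult_diff ^^ k) (field_prod a b w))) n j))"

definition nth_product ::
    "(complex \<Rightarrow> 'w::ab_group_add \<Rightarrow> 'w) \<Rightarrow> int \<Rightarrow> ('w \<Rightarrow> int \<Rightarrow> 'w) \<Rightarrow> int \<Rightarrow> ('w \<Rightarrow> int \<Rightarrow> 'w) \<Rightarrow>
     'w \<Rightarrow> int \<Rightarrow> 'w"
  where "nth_product scale \<epsilon> a n b = Y_E scale \<epsilon> a b (- n - 1)"

definition closed_local_subspace ::
    "(complex \<Rightarrow> 'w::ab_group_add \<Rightarrow> 'w) \<Rightarrow> int \<Rightarrow> ('w \<Rightarrow> int \<Rightarrow> 'w) set \<Rightarrow> bool"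
  where "closed_local_subspace scale \<epsilon> V \<longleftrightarrow>
    local_subset scale V \<and> module.subspace (scale_field scale) V \<and>
    (\<forall>u\<in>V. \<forall>v\<in>V. \<forall>n. nth_product scale \<epsilon> u n v \<in> V)"

text \<open>\<open>\<langle>U\<rangle>\<close>: the smallest closed local subspace, with respect to inclusion, containing \<open>U\<close> and \<open>1\<^sub>W\<close>.\<close>

definition generated ::
    "(complex \<Rightarrow> 'w::ab_group_add \<Rightarrow> 'w) \<Rightarrow> int \<Rightarrow> ('w \<Rightarrow> int \<Rightarrow> 'w) set \<Rightarrow> ('w \<Rightarrow> int \<Rightarrow> 'w) set"
  where "generated scale \<epsilon> U =
    (LEAST V. closed_local_subspace scale \<epsilon> V \<and> U \<subseteq> V \<and> id_field \<in> V)"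

end

theory Submission
  imports Defs
begin

text \<open>
  Under \<open>x\<^sub>1 = \<phi>(x, z)\<close> multiplication by \<open>x\<^sub>1 - x\<close> becomes multiplication by \<open>\<phi>(x, z) - x\<close>, which is
  \<open>z\<close> times a unit. So \<open>Y(a(x), z)b(x)\<close> is the unique series \<open>X\<close> such that \<open>(\<phi> - x)\<^sup>k X\<close> is the value
  of \<open>(x\<^sub>1 - x)\<^sup>k a(x\<^sub>1)b(x)\<close> for some \<open>k\<close>. This relation is compatible with linear maps, with
  multiplication by \<open>x\<^sub>1\<close> and \<open>x\<close>, and with \<open>D = x\<^sup>\<epsilon> d/dx\<close>, because \<open>d/dz - x\<^sup>\<epsilon> d/dx\<close> annihilates \<open>\<phi>\<close>.

  Locality is inherited by the products: if \<open>c\<close> is local with \<open>a\<close> and \<open>b\<close>, then a power of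
  \<open>(x\<^sub>1 - x)(x\<^sub>1 - \<phi>)\<close> annihilates \<open>[c(x\<^sub>1), Y(a(x), z)b(x)]\<close>, and \<open>x\<^sub>1 - x = (x\<^sub>1 - \<phi>) + (\<phi> - x)\<close> with \<open>\<phi> - x\<close>
  divisible by \<open>z\<close>. Hence a maximal local set containing \<open>U\<close> and \<open>1\<close> is closed.

  After multiplication by powers of \<open>\<phi>(x, z\<^sub>1) - \<phi>(x, z\<^sub>2)\<close>, \<open>\<phi>(x, z\<^sub>1) - x\<close> and \<open>\<phi>(x, z\<^sub>2) - x\<close>, the two
  products \<open>Y(a, z\<^sub>1)Y(b, z\<^sub>2)c\<close> and \<open>Y(b, z\<^sub>2)Y(a, z\<^sub>1)c\<close> are values of one element of
  \<open>W((x\<^sub>1, x\<^sub>2, x))\<close>. These factors are \<open>z\<^sub>1 - z\<^sub>2\<close>, \<open>z\<^sub>1\<close> and \<open>z\<^sub>2\<close> times units, which gives weak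
  commutativity. Weak associativity follows from it and from \<open>[D, Y(a, z)] = d/dz Y(a, z)\<close> by skew
  symmetry \<open>Y(a, z)b = e\<^sup>z\<^sup>D Y(b, -z)a\<close>.
\<close>

section \<open>Laurent series with coefficients in a vector space\<close>

text \<open>The obstacle is that the two orders of a product of three fields are expanded in
  different domains: Y(a, z_1)Y(b, z_2)c has, for each power of z_2, finitely many negative powers
  of z_1, and the opposite order has the reverse. Nested Laurent types cannot compare them. Hence a
  single variable z is handled over the field C((x))((z)), where cancelling \<phi> - x is division,
  while z_1 and z_2 together are handled on plain coefficient arrays satisfying
  \<open>quadrant_finite\<close>, which contain both expansions. On these, a power series with
  nonzero constant term acts injectively, and so do z_1 and z_2, but z_1 - z_2 does not: it
  annihilates the formal delta series. This is why the conclusion retains the power of z_1 - z_2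
  that comes from the locality of a and b. That exponent is taken even, so that exchanging the
  variables costs no sign.\<close>

definition fls_act :: "('k::zero \<Rightarrow> 'w::ab_group_add \<Rightarrow> 'w) \<Rightarrow> 'k fls \<Rightarrow> 'w fls \<Rightarrow> 'w fls"
  where "fls_act scale p f =
    Abs_fls (\<lambda>n. \<Sum>i=fls_subdegree p..n - fls_subdegree f. scale (p $$ i) (f $$ (n - i)))"

lemma fls_bounded: "\<exists>N. \<forall>n<N. (f::'a::zero fls) $$ n = 0"
  by (metis fls_eq0_below_subdegree)

context vector_space
begin

text \<open>Any lower bounds may replace the subdegrees of the definition, so that sums coming from
  different series can be brought to a common range.\<close>

lemma fls_act_nth:
  assumes "\<And>i. i < M \<Longrightarrow> p $$ i = 0" "\<And>i. i < N \<Longrightarrow> f $$ i = 0"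
  shows "fls_act scale p f $$ n = (\<Sum>i=M..n - N. scale (p $$ i) (f $$ (n - i)))"
proof -
  have "fls_act scale p f $$ n = (\<Sum>i=fls_subdegree p..n - fls_subdegree f. scale (p $$ i) (f $$ (n - i)))"
    unfolding fls_act_def
    by (subst nth_Abs_fls_lower_bound[where N = "fls_subdegree p + fls_subdegree f"]) auto
  also have "\<dots> = (\<Sum>i=M..n - N. scale (p $$ i) (f $$ (n - i)))"
    by (rule sum.mono_neutral_cong) (use assms in \<open>auto simp: not_le\<close>)
  finally show ?thesis .
qed

text \<open>The scalars become the field of Laurent series over the old scalars, so the construction
  can be iterated: applied twice it makes W((x))((z)) a vector space over C((x))((z)).\<close>

lemma vector_space_fls_act: "vector_space (fls_act scale)"
proof
  fix p q :: "'a fls" and f g :: "'b fls"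
  obtain a where a: "\<And>i. i < a \<Longrightarrow> p $$ i = 0" using fls_bounded by blast
  obtain a' where a': "\<And>i. i < a' \<Longrightarrow> q $$ i = 0" using fls_bounded by blast
  obtain b where b: "\<And>i. i < b \<Longrightarrow> f $$ i = 0" using fls_bounded by blast
  obtain b' where b': "\<And>i. i < b' \<Longrightarrow> g $$ i = 0" using fls_bounded by blast
  show "fls_act scale p (f + g) = fls_act scale p f + fls_act scale p g"
  proof (rule fls_eqI)
    fix n
    show "fls_act scale p (f + g) $$ n = (fls_act scale p f + fls_act scale p g) $$ n"
      using a b b'
      by (simp add: fls_act_nth[of a p "min b b'"] sum.distrib scale_right_distrib)
  qed
  show "fls_act scale (p + q) f = fls_act scale p f + fls_act scale q f"
  proof (rule fls_eqI)
    fix n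
    show "fls_act scale (p + q) f $$ n = (fls_act scale p f + fls_act scale q f) $$ n"
      using a a' b
      by (simp add: fls_act_nth[of "min a a'" _ b] sum.distrib scale_left_distrib)
  qed
  show "fls_act scale 1 f = f"
  proof (rule fls_eqI)
    fix n
    have "fls_act scale 1 f $$ n = (\<Sum>i=0..n - min b n. scale (1 $$ i) (f $$ (n - i)))"
      using b by (intro fls_act_nth) auto
    also have "\<dots> = (\<Sum>i=0..n - min b n. if i = 0 then f $$ n else 0)"
      by (intro sum.cong) auto
    finally show "fls_act scale 1 f $$ n = f $$ n" by simp
  qed
  show "fls_act scale p (fls_act scale q f) = fls_act scale (p * q) f"
  proof (rule fls_eqI)
    fix n
    have qf: "fls_act scale q f $$ i = 0" if "i < a' + b" for i
      using that a' b by (simp add: fls_act_nth[of a' q b])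
    have pq: "(p * q) $$ m = (\<Sum>i=a..m - a'. p $$ i * q $$ (m - i))" for m
      unfolding fls_times_nth(2)
      by (rule sum.mono_neutral_cong) (use a a' in \<open>auto simp: not_le\<close>)
    have pq0: "(p * q) $$ m = 0" if "m < a + a'" for m
      using that by (simp add: pq)
    have "fls_act scale p (fls_act scale q f) $$ n =
        (\<Sum>i=a..n - (a' + b). \<Sum>j=a'..n - i - b. scale (p $$ i * q $$ j) (f $$ (n - i - j)))"
      using a a' b qf by (simp add: fls_act_nth[of a p "a' + b"] fls_act_nth[of a' q b] scale_sum_right)
    also have "\<dots> = (\<Sum>(i,j)\<in>(SIGMA i:{a..n - (a' + b)}. {a'..n - i - b}). scale (p $$ i * q $$ j) (f $$ (n - i - j)))"
      by (simp add: sum.Sigma)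
    also have "\<dots> = (\<Sum>(m,i)\<in>(SIGMA m:{a + a'..n - b}. {a..m - a'}). scale (p $$ i * q $$ (m - i)) (f $$ (n - m)))"
      by (rule sum.reindex_bij_witness[of _ "\<lambda>(m,i). (i, m - i)" "\<lambda>(i,j). (i + j, i)"])
         (auto simp: algebra_simps)
    also have "\<dots> = (\<Sum>m=a + a'..n - b. \<Sum>i=a..m - a'. scale (p $$ i * q $$ (m - i)) (f $$ (n - m)))"
      by (simp add: sum.Sigma)
    also have "\<dots> = fls_act scale (p * q) f $$ n"
      using b pq0 by (simp add: fls_act_nth[of "a + a'" _ b] pq scale_sum_left)
    finally show "fls_act scale p (fls_act scale q f) $$ n = fls_act scale (p * q) f $$ n" .
  qed
qed

end

definition fls_monom :: "'a::semiring_1 \<Rightarrow> int \<Rightarrow> 'a fls"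
  where "fls_monom c r = fls_const c * fls_X_intpow r"

lemma fls_monom_nth: "fls_monom c r $$ n = (if n = r then c else 0)"
  by (simp add: fls_monom_def)

lemma fls_act_monom_nth:
  assumes "vector_space scale"
  shows "fls_act scale (fls_monom c r) f $$ n = scale c (f $$ (n - r))"
proof -
  interpret vector_space scale by fact
  obtain b where b: "\<And>i. i < b \<Longrightarrow> f $$ i = 0" using fls_bounded by blast
  have "fls_act scale (fls_monom c r) f $$ n =
      (\<Sum>i=r..n - min b (n - r). scale ((fls_monom c r) $$ i) (f $$ (n - i)))"
    using b by (intro fls_act_nth) (auto simp: fls_monom_nth)
  also have "\<dots> = (\<Sum>i=r..n - min b (n - r). if i = r then scale c (f $$ (n - r)) else 0)"
    by (intro sum.cong) (auto simp: fls_monom_nth)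
  finally show ?thesis by (simp add: min_def)
qed

lemma fls_act_const_nth:
  assumes "vector_space scale"
  shows "fls_act scale (fls_const c) f $$ n = scale c (f $$ n)"
  using fls_act_monom_nth[OF assms, of c 0 f n] by (simp add: fls_monom_def)

section \<open>The flow of \<open>x\<^sup>\<epsilon> d/dx\<close>\<close>

text \<open>\<open>\<phi>\<^sub>\<epsilon>(x, z)\<^sup>p = \<Sum>\<^sub>i c\<^sub>p\<^sub>,\<^sub>i z\<^sup>i x\<close> to the power \<open>p + i(\<epsilon> - 1)\<close>\<close>

definition flow_coeff :: "int \<Rightarrow> int \<Rightarrow> nat \<Rightarrow> complex"
  where "flow_coeff \<epsilon> p i = (\<Prod>l<i. of_int (p + int l * (\<epsilon> - 1))) / fact i"

lemma flow_coeff_0 [simp]: "flow_coeff \<epsilon> p 0 = 1"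
  by (simp add: flow_coeff_def)

text \<open>In coefficients, the flow equation d/dz \<phi>^p = x^\<epsilon> d/dx \<phi>^p.\<close>

lemma flow_coeff_Suc:
  "of_nat (Suc i) * flow_coeff \<epsilon> p (Suc i) = of_int (p + int i * (\<epsilon> - 1)) * flow_coeff \<epsilon> p i"
  by (simp add: flow_coeff_def divide_simps del: of_nat_Suc of_int_add)

lemma flow_coeff_zero: "flow_coeff \<epsilon> 0 i = (if i = 0 then 1 else 0)"
proof (cases i)
  case (Suc j)
  have "(\<Prod>l<Suc j. of_int (0 + int l * (\<epsilon> - 1)) :: complex) = 0"
    by (rule prod_zero) auto
  then show ?thesis using Suc by (simp add: flow_coeff_def)
qed simp

text \<open>This is \<phi>^(p+q) = \<phi>^p \<phi>^q. Both sides satisfy the recurrence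
  \<open>flow_coeff_Suc\<close>; for the convolution, n + 1 is split as i + (n + 1 - i), the product
  rule.\<close>

lemma flow_coeff_add:
  "flow_coeff \<epsilon> (p + q) n = (\<Sum>i\<le>n. flow_coeff \<epsilon> p i * flow_coeff \<epsilon> q (n - i))"
proof (induction n)
  case 0
  show ?case by simp
next
  case (Suc n)
  let ?c = "flow_coeff \<epsilon>"
  have "of_nat (Suc n) * (\<Sum>i\<le>Suc n. ?c p i * ?c q (Suc n - i)) =
     (\<Sum>i\<le>Suc n. (of_nat i * ?c p i) * ?c q (Suc n - i)) + (\<Sum>i\<le>Suc n. ?c p i * (of_nat (Suc n - i) * ?c q (Suc n - i)))"
    unfolding sum.distrib[symmetric] sum_distrib_left
    by (intro sum.cong refl) (simp add: of_nat_diff algebra_simps)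
  also have "(\<Sum>i\<le>Suc n. (of_nat i * ?c p i) * ?c q (Suc n - i)) =
     (\<Sum>i\<le>n. (of_nat (Suc i) * ?c p (Suc i)) * ?c q (n - i))"
    by (subst sum.atMost_Suc_shift) (simp del: of_nat_Suc)
  also have "(\<Sum>i\<le>Suc n. ?c p i * (of_nat (Suc n - i) * ?c q (Suc n - i))) =
     (\<Sum>i\<le>n. ?c p i * (of_nat (Suc (n - i)) * ?c q (Suc (n - i))))"
    by (subst sum.atMost_Suc, simp del: of_nat_Suc of_nat_diff, intro sum.cong refl) (simp add: Suc_diff_le del: of_nat_Suc of_nat_diff)
  also have "(\<Sum>i\<le>n. (of_nat (Suc i) * ?c p (Suc i)) * ?c q (n - i)) + \<dots> =
     (\<Sum>i\<le>n. of_int (p + q + int n * (\<epsilon> - 1)) * (?c p i * ?c q (n - i)))"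
    unfolding sum.distrib[symmetric] flow_coeff_Suc
    by (intro sum.cong refl) (simp add: of_nat_diff algebra_simps)
  also have "\<dots> = of_int (p + q + int n * (\<epsilon> - 1)) * ?c (p + q) n"
    by (simp only: Suc.IH sum_distrib_left)
  also have "\<dots> = of_nat (Suc n) * ?c (p + q) (Suc n)"
    by (rule flow_coeff_Suc[symmetric])
  finally show ?case by (simp del: of_nat_Suc sum.atMost_Suc)
qed

abbreviation flow_mon :: "int \<Rightarrow> int \<Rightarrow> nat \<Rightarrow> complex fls"
  where "flow_mon \<epsilon> p i \<equiv> fls_const (flow_coeff \<epsilon> p i) * fls_X_intpow (p + int i * (\<epsilon> - 1))"

lemma x_deriv_monomial:
  "x_deriv \<epsilon> (fls_const c * fls_X_intpow r) = fls_const (of_int r * c) * fls_X_intpow (r + \<epsilon> - 1)"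
proof (rule fls_eqI)
  fix n
  have "(n - \<epsilon> + 1 = r) = (n = r + \<epsilon> - 1)" by auto
  then show "x_deriv \<epsilon> (fls_const c * fls_X_intpow r) $$ n =
      (fls_const (of_int r * c) * fls_X_intpow (r + \<epsilon> - 1)) $$ n"
    by (auto simp: x_deriv_def fls_X_intpow_times_conv_shift)
qed

lemma x_deriv_funpow_X_intpow:
  "(x_deriv \<epsilon> ^^ i) (fls_X_intpow p) = fls_const (fact i) * flow_mon \<epsilon> p i"
proof (induction i)
  case 0
  show ?case by simp
next
  case (Suc i)
  have "(x_deriv \<epsilon> ^^ Suc i) (fls_X_intpow p) =
      x_deriv \<epsilon> (fls_const (fact i * flow_coeff \<epsilon> p i) * fls_X_intpow (p + int i * (\<epsilon> - 1)))"
    by (simp add: Suc.IH mult.assoc[symmetric])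
  also have "\<dots> = fls_const (fact i * (of_nat (Suc i) * flow_coeff \<epsilon> p (Suc i))) * fls_X_intpow (p + int i * (\<epsilon> - 1) + \<epsilon> - 1)"
    unfolding x_deriv_monomial flow_coeff_Suc by (simp only: mult_ac)
  also have "p + int i * (\<epsilon> - 1) + \<epsilon> - 1 = p + int (Suc i) * (\<epsilon> - 1)"
    by (simp add: algebra_simps)
  also have "fact i * (of_nat (Suc i) * flow_coeff \<epsilon> p (Suc i)) = fact (Suc i) * flow_coeff \<epsilon> p (Suc i)"
    by (simp add: algebra_simps)
  finally show ?case by (simp only: fls_const_mult_const[symmetric] mult.assoc)
qed

text \<open>As a function of p, the right-hand side turns addition into multiplication and takes the
  value \<phi> at 1, which forces it to give all integer powers, the negative ones included.\<close>

lemma phi_powi: "phi \<epsilon> powi p = fps_to_fls (Abs_fps (flow_mon \<epsilon> p))"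
proof -
  define E where "E p = fps_to_fls (Abs_fps (flow_mon \<epsilon> p))" for p
  have E_add: "E (p + q) = E p * E q" for p q
  proof -
    have "Abs_fps (flow_mon \<epsilon> (p + q)) = Abs_fps (flow_mon \<epsilon> p) * Abs_fps (flow_mon \<epsilon> q)"
    proof (rule fps_ext)
      fix n
      have "(Abs_fps (flow_mon \<epsilon> p) * Abs_fps (flow_mon \<epsilon> q)) $ n = (\<Sum>i\<le>n. flow_mon \<epsilon> p i * flow_mon \<epsilon> q (n - i))"
        by (simp add: fps_mult_nth atLeast0AtMost)
      also have "\<dots> = (\<Sum>i\<le>n. fls_const (flow_coeff \<epsilon> p i * flow_coeff \<epsilon> q (n - i)) * fls_X_intpow (p + q + int n * (\<epsilon> - 1)))"
      proof (intro sum.cong refl)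
        fix i assume i: "i \<in> {..n}"
        have "flow_mon \<epsilon> p i * flow_mon \<epsilon> q (n - i) = (fls_const (flow_coeff \<epsilon> p i) * fls_const (flow_coeff \<epsilon> q (n - i))) *
          (fls_X_intpow (p + int i * (\<epsilon> - 1)) * fls_X_intpow (q + int (n - i) * (\<epsilon> - 1)))"
          by (simp only: mult_ac)
        also have "fls_X_intpow (p + int i * (\<epsilon> - 1)) * fls_X_intpow (q + int (n - i) * (\<epsilon> - 1)) = (fls_X_intpow (p + q + int n * (\<epsilon> - 1)) :: complex fls)"
          using i unfolding fls_X_intpow_times_fls_X_intpow
          by (intro arg_cong[where f = fls_X_intpow]) (simp add: of_nat_diff algebra_simps)
        finally show "flow_mon \<epsilon> p i * flow_mon \<epsilon> q (n - i) =
          fls_const (flow_coeff \<epsilon> p i * flow_coeff \<epsilon> q (n - i)) * fls_X_intpow (p + q + int n * (\<epsilon> - 1))"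
          by simp
      qed
      also have "\<dots> = flow_mon \<epsilon> (p + q) n"
        unfolding sum_distrib_right[symmetric] flow_coeff_add
        by (intro arg_cong2[where f = "(*)"] refl fls_eqI) (simp add: fls_nth_sum)
      finally show "Abs_fps (flow_mon \<epsilon> (p + q)) $ n = (Abs_fps (flow_mon \<epsilon> p) * Abs_fps (flow_mon \<epsilon> q)) $ n"
        by simp
    qed
    then show ?thesis unfolding E_def by (simp add: fls_times_fps_to_fls)
  qed
  have E0: "E 0 = 1"
    unfolding E_def fps_to_fls_eq_1_iff
    by (rule fps_ext) (simp add: flow_coeff_zero)
  have E1: "E 1 = phi \<epsilon>"
  proof -
    have X: "(fls_X :: complex fls) = fls_X_intpow 1" by (simp add: fls_X_conv_shift_1)
    show ?thesis
      unfolding E_def phi_def fps_to_fls_eq_iff X x_deriv_funpow_X_intpow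
      by (intro fps_ext) (simp add: mult.assoc[symmetric])
  qed
  have nat: "E (int n) = phi \<epsilon> ^ n" for n
    by (induction n) (simp_all add: E0 E1 E_add)
  have "E p = phi \<epsilon> powi p"
  proof (cases "p \<ge> 0")
    case True
    then show ?thesis using nat[of "nat p"] by (simp add: power_int_def)
  next
    case False
    have "E (int (nat (-p))) * E p = 1"
      using False E0 by (simp flip: E_add)
    then have "phi \<epsilon> ^ nat (-p) * E p = 1" by (simp only: nat)
    then have "E p = inverse (phi \<epsilon> ^ nat (-p))"
      by (metis inverse_unique)
    then show ?thesis using False by (simp add: power_int_def power_inverse)
  qed
  then show ?thesis by (simp add: E_def)
qed

lemma phi_powi_nth:
  "phi \<epsilon> powi p $$ n =
    (if n < 0 then 0 else fls_monom (flow_coeff \<epsilon> p (nat n)) (p + n * (\<epsilon> - 1)))"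
  by (simp add: phi_powi fls_monom_def)

lemma phi_nth:
  "phi \<epsilon> $$ n = (if n < 0 then 0 else fls_monom (flow_coeff \<epsilon> 1 (nat n)) (1 + n * (\<epsilon> - 1)))"
  using phi_powi_nth[of \<epsilon> 1 n] by simp

lemma phi_minus_x_neq_0: "phi_minus_x \<epsilon> \<noteq> 0"
proof
  assume "phi_minus_x \<epsilon> = 0"
  \<comment> \<open>The coefficient of z in \<phi> - x is x^\<epsilon>.\<close>
  then have "phi_minus_x \<epsilon> $$ 1 $$ \<epsilon> = 0" by simp
  then show False by (simp add: phi_minus_x_def phi_nth flow_coeff_def fls_monom_def)
qed

section \<open>The substitution \<open>x\<^sub>1 = \<phi>(x, z)\<close>\<close>

text \<open>
  Series in \<open>x\<^sub>1, x\<close> are functions \<^typ>\<open>int \<Rightarrow> 'w fls\<close>, with the exponent of \<open>x\<^sub>1\<close> as argument; elements of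
  \<open>W((x))((z))\<close> have type \<^typ>\<open>'w fls fls\<close>, with \<open>z\<close> as the outer variable.
\<close>

locale flow_space = W: vector_space scale
  for scale :: "complex \<Rightarrow> 'w::ab_group_add \<Rightarrow> 'w" +
  fixes \<epsilon> :: int
begin

sublocale X: vector_space "fls_act scale"
  by (rule W.vector_space_fls_act)

sublocale Z: vector_space "fls_act (fls_act scale)"
  by (rule X.vector_space_fls_act)

abbreviation xact (infixr "\<bullet>x" 74) where "xact \<equiv> fls_act scale"
abbreviation zact (infixr "\<bullet>z" 74) where "zact \<equiv> fls_act (fls_act scale)"

lemma xact_monom_nth [simp]: "(fls_monom c r \<bullet>x f) $$ j = scale c (f $$ (j - r))"
  by (rule fls_act_monom_nth) (rule W.vector_space_axioms)

lemma zact_const_nth [simp]: "(fls_const g \<bullet>z X) $$ n = g \<bullet>x X $$ n"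
  by (rule fls_act_const_nth) (rule X.vector_space_axioms)

text \<open>Membership in W((x_1, x)), with one bound N for both exponents as in
  \<open>laurent2\<close>. The bound on the exponent of x must be uniform in p, which the type of F
  does not provide.\<close>

definition bounded_from :: "int \<Rightarrow> (int \<Rightarrow> 'w fls) \<Rightarrow> bool"
  where "bounded_from N F \<longleftrightarrow> (\<forall>p<N. F p = 0) \<and> (\<forall>p j. j < N \<longrightarrow> F p $$ j = 0)"

definition bounded :: "(int \<Rightarrow> 'w fls) \<Rightarrow> bool"
  where "bounded F \<longleftrightarrow> (\<exists>N. bounded_from N F)"

lemma bounded_fromD:
  assumes "bounded_from N F"
  shows "p < N \<Longrightarrow> F p = 0" "j < N \<Longrightarrow> F p $$ j = 0"
  using assms by (auto simp: bounded_from_def)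

lemma bounded_from_mono: "bounded_from N F \<Longrightarrow> M \<le> N \<Longrightarrow> bounded_from M F"
  by (auto simp: bounded_from_def)

lemma bounded2E:
  assumes "bounded F" "bounded G"
  obtains N where "bounded_from N F" "bounded_from N G"
proof -
  obtain N M where "bounded_from N F" "bounded_from M G" using assms by (auto simp: bounded_def)
  then show ?thesis using that[of "min N M"] bounded_from_mono by (metis min.cobounded1 min.cobounded2)
qed

definition Sub :: "(int \<Rightarrow> 'w fls) \<Rightarrow> 'w fls fls"
  where "Sub F = Abs_fls (\<lambda>i. Abs_fls (subst_phi scale \<epsilon> (\<lambda>m n. F m $$ n) i))"

text \<open>In \<phi>^p the coefficient of z^i is a single monomial in x, so i, j and p determine n
  and the double sum collapses. The free upper limit B, like N, allows several such sums to be
  compared over one range.\<close>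

lemma subst_phi_eq:
  assumes N: "bounded_from N F" and B: "j - i * (\<epsilon> - 1) - N \<le> B"
  shows "subst_phi scale \<epsilon> (\<lambda>m n. F m $$ n) i j =
    (if i < 0 then 0 else \<Sum>p=N..B. scale (flow_coeff \<epsilon> p (nat i)) (F p $$ (j - p - i * (\<epsilon> - 1))))"
proof (cases "i < 0")
  case True
  then have "(\<lambda>(m, n). scale (phi \<epsilon> powi m $$ i $$ (j - n)) (F m $$ n)) = (\<lambda>_. 0)"
    by (auto simp: phi_powi_nth)
  then show ?thesis using True by (simp add: subst_phi_def)
next
  case False
  define g where "g = (\<lambda>(m, n). scale (phi \<epsilon> powi m $$ i $$ (j - n)) (F m $$ n))"
  define h where "h = (\<lambda>p. (p, j - p - i * (\<epsilon> - 1)))"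
  have g: "g (m, n) = (if n = j - m - i * (\<epsilon> - 1) then scale (flow_coeff \<epsilon> m (nat i)) (F m $$ n) else 0)" for m n
    using False by (auto simp: g_def phi_powi_nth fls_monom_nth)
  have supp: "{a. g a \<noteq> 0} \<subseteq> h ` {N..B}"
  proof clarify
    fix m n assume "g (m, n) \<noteq> 0"
    then have n: "n = j - m - i * (\<epsilon> - 1)" and F: "F m $$ n \<noteq> 0" by (auto simp: g split: if_splits)
    from F have "m \<ge> N" "n \<ge> N" using bounded_fromD[OF N] by (force simp: not_less[symmetric])+
    then have "m \<in> {N..B}" using n B by auto
    then show "(m, n) \<in> h ` {N..B}" using n by (auto simp: h_def)
  qed
  have "subst_phi scale \<epsilon> (\<lambda>m n. F m $$ n) i j = Sum_any g"
    by (simp add: subst_phi_def g_def)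
  also have "\<dots> = sum g (h ` {N..B})"
    by (rule Sum_any.expand_superset) (use supp in auto)
  also have "\<dots> = (\<Sum>p=N..B. g (h p))"
    by (subst sum.reindex) (auto simp: inj_on_def h_def)
  finally show ?thesis using False by (simp add: h_def g)
qed

lemma Sub_nth_nth_subst_phi:
  assumes "bounded F"
  shows "Sub F $$ i $$ j = subst_phi scale \<epsilon> (\<lambda>m n. F m $$ n) i j"
proof -
  obtain N where N: "bounded_from N F" using assms by (auto simp: bounded_def)
  have neg: "subst_phi scale \<epsilon> (\<lambda>m n. F m $$ n) i = (\<lambda>_. 0)" if "i < 0" for i
    using subst_phi_eq[OF N order_refl, where i = i] that by auto
  \<comment> \<open>The bound depends on i: the value lies in W((x))[[z]], where the bound in x may
    vary with the power of z.\<close>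
  have low: "subst_phi scale \<epsilon> (\<lambda>m n. F m $$ n) i j = 0" if "j < 2 * N + i * (\<epsilon> - 1)" for i j
    using subst_phi_eq[OF N order_refl, where i = i and j = j] that by auto
  have "Sub F $$ i = Abs_fls (subst_phi scale \<epsilon> (\<lambda>m n. F m $$ n) i)"
    unfolding Sub_def by (rule nth_Abs_fls_lower_bound[of 0]) (simp add: neg flip: zero_fls_def)
  also have "\<dots> $$ j = subst_phi scale \<epsilon> (\<lambda>m n. F m $$ n) i j"
    by (rule nth_Abs_fls_lower_bound[of "2 * N + i * (\<epsilon> - 1)"]) (simp add: low)
  finally show ?thesis .
qed

lemma Sub_nth:
  assumes "bounded_from N F" and "j - i * (\<epsilon> - 1) - N \<le> B"
  shows "Sub F $$ i $$ j =
    (if i < 0 then 0 else \<Sum>p=N..B. scale (flow_coeff \<epsilon> p (nat i)) (F p $$ (j - p - i * (\<epsilon> - 1))))"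
proof -
  have "bounded F" using assms by (auto simp: bounded_def)
  then show ?thesis using subst_phi_eq[OF assms] by (simp add: Sub_nth_nth_subst_phi)
qed

lemma Sub_nth_neg: "bounded F \<Longrightarrow> i < 0 \<Longrightarrow> Sub F $$ i = 0"
  unfolding bounded_def by (auto intro!: fls_eqI simp: Sub_nth[OF _ order_refl])

text \<open>Multiplication by x_1; \<open>monom_act\<close> is multiplication by c x^r.\<close>

definition shift :: "(int \<Rightarrow> 'w fls) \<Rightarrow> int \<Rightarrow> 'w fls"
  where "shift F = (\<lambda>p. F (p - 1))"

definition monom_act :: "complex \<Rightarrow> int \<Rightarrow> (int \<Rightarrow> 'w fls) \<Rightarrow> int \<Rightarrow> 'w fls"
  where "monom_act c r F = (\<lambda>p. fls_monom c r \<bullet>x F p)"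

lemma Sub_add:
  assumes "bounded F" "bounded G"
  shows "Sub (F + G) = Sub F + Sub G"
proof -
  obtain N where N: "bounded_from N F" "bounded_from N G" using assms by (rule bounded2E)
  then have FG: "bounded_from N (F + G)" by (simp add: bounded_from_def)
  show ?thesis
    by (intro fls_eqI)
       (simp add: Sub_nth[OF N(1) order_refl] Sub_nth[OF N(2) order_refl] Sub_nth[OF FG order_refl]
         sum.distrib W.scale_right_distrib)
qed

lemma Sub_monom:
  assumes "bounded F"
  shows "Sub (monom_act c r F) = fls_const (fls_monom c r) \<bullet>z Sub F"
proof -
  obtain N0 where "bounded_from N0 F" using assms by (auto simp: bounded_def)
  then have N: "bounded_from (min N0 (N0 + r)) F" by (rule bounded_from_mono) simp
  have "bounded_from (min N0 (N0 + r)) (monom_act c r F)"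
    using \<open>bounded_from N0 F\<close> by (auto simp: bounded_from_def shift_def monom_act_def)
  note M = this
  show ?thesis
  proof (intro fls_eqI)
    fix i j
    let ?B = "max (j - i * (\<epsilon> - 1)) (j - r - i * (\<epsilon> - 1)) - min N0 (N0 + r)"
    have "j - i * (\<epsilon> - 1) - min N0 (N0 + r) \<le> ?B" "j - r - i * (\<epsilon> - 1) - min N0 (N0 + r) \<le> ?B" by auto
    note B = this
    have e: "j - p - i * (\<epsilon> - 1) - r = j - r - p - i * (\<epsilon> - 1)" for p by simp
    show "Sub (monom_act c r F) $$ i $$ j = (fls_const (fls_monom c r) \<bullet>z Sub F) $$ i $$ j"
      unfolding zact_const_nth xact_monom_nth monom_act_def[THEN fun_cong] Sub_nth[OF M B(1)] Sub_nth[OF N B(2)]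
      by (simp only: e W.scale_sum_right W.scale_scale W.scale_zero_right mult.commute[of c] if_distrib[of "scale c"])
  qed
qed

lemma bounded_add: "bounded F \<Longrightarrow> bounded G \<Longrightarrow> bounded (F + G)"
  unfolding bounded_def[of "F + G"]
  by (erule (1) bounded2E, rule exI) (auto simp: bounded_from_def shift_def monom_act_def)

lemma bounded_zero: "bounded 0"
  by (simp add: bounded_def bounded_from_def)

lemma bounded_monom: "bounded F \<Longrightarrow> bounded (monom_act c r F)"
  unfolding bounded_def
proof (elim exE)
  fix N assume "bounded_from N F"
  then have "bounded_from (min N (N + r)) (monom_act c r F)"
    by (auto simp: bounded_from_def shift_def monom_act_def)
  then show "\<exists>N. bounded_from N (monom_act c r F)" ..
qed

lemma bounded_shift: "bounded F \<Longrightarrow> bounded (shift F)"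
  unfolding bounded_def
proof (elim exE)
  fix N assume "bounded_from N F"
  then have "bounded_from N (shift F)" by (auto simp: bounded_from_def shift_def monom_act_def)
  then show "\<exists>N. bounded_from N (shift F)" ..
qed

lemma phi_act_nth:
  assumes "\<And>n. n < N \<Longrightarrow> X $$ n = 0" and "nat (n - N) \<le> R"
  shows "(phi \<epsilon> \<bullet>z X) $$ n =
    (\<Sum>i\<le>R. fls_monom (flow_coeff \<epsilon> 1 i) (1 + int i * (\<epsilon> - 1)) \<bullet>x X $$ (n - int i))"
proof -
  have "(phi \<epsilon> \<bullet>z X) $$ n = (\<Sum>i=0..n - N. phi \<epsilon> $$ i \<bullet>x X $$ (n - i))"
    by (rule X.fls_act_nth) (use assms in \<open>auto simp: phi_nth\<close>)
  also have "\<dots> = (\<Sum>i=0..int R. phi \<epsilon> $$ i \<bullet>x X $$ (n - i))"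
    by (rule sum.mono_neutral_left) (use assms in auto)
  also have "\<dots> = (\<Sum>i\<le>R. phi \<epsilon> $$ int i \<bullet>x X $$ (n - int i))"
    by (rule sum.reindex_bij_witness[of _ int nat]) auto
  finally show ?thesis by (simp add: phi_nth)
qed

text \<open>Coefficientwise this is \<open>flow_coeff_add\<close> with exponents 1 and p.\<close>

lemma Sub_shift:
  assumes "bounded F"
  shows "Sub (shift F) = phi \<epsilon> \<bullet>z Sub F"
proof -
  obtain N where N: "bounded_from N F" using assms by (auto simp: bounded_def)
  \<comment> \<open>The range starts one lower because the index moves by one: N - 1 for F
    corresponds to N for x_1 F.\<close>
  have N1: "bounded_from (N - 1) F" using N by (rule bounded_from_mono) simp
  have M: "bounded_from N (shift F)" using N by (auto simp: bounded_from_def shift_def monom_act_def)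
  have neg: "Sub F $$ i = 0" if "i < 0" for i using Sub_nth_neg assms that .
  show ?thesis
  proof (intro fls_eqI)
    fix n j
    show "Sub (shift F) $$ n $$ j = (phi \<epsilon> \<bullet>z Sub F) $$ n $$ j"
    proof (cases "n < 0")
      case True
      then show ?thesis using Sub_nth_neg[OF bounded_shift[OF assms] True] 
        by (simp add: phi_act_nth[OF neg order_refl] neg)
    next
      case False
      let ?e = "\<epsilon> - 1"
      let ?B = "j - n * ?e - N"
      have "(phi \<epsilon> \<bullet>z Sub F) $$ n $$ j =
          (\<Sum>i\<le>nat n. scale (flow_coeff \<epsilon> 1 i) (Sub F $$ (n - int i) $$ (j - (1 + int i * ?e))))"
        by (subst phi_act_nth[OF neg, where R = "nat n"]) (auto simp: fls_nth_sum)
      also have "\<dots> = (\<Sum>i\<le>nat n. \<Sum>p=N-1..?B. scale (flow_coeff \<epsilon> 1 i * flow_coeff \<epsilon> p (nat n - i))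
           (F p $$ (j - 1 - p - n * ?e)))"
      proof (intro sum.cong refl)
        fix i assume i: "i \<in> {..nat n}"
        have e: "j - (1 + int i * ?e) - (n - int i) * ?e = j - 1 - n * ?e"
          "\<And>p. j - (1 + int i * ?e) - p - (n - int i) * ?e = j - 1 - p - n * ?e" 
          by (simp_all add: algebra_simps)
        have "nat (n - int i) = nat n - i" using i by auto
        then show "scale (flow_coeff \<epsilon> 1 i) (Sub F $$ (n - int i) $$ (j - (1 + int i * ?e))) =
          (\<Sum>p=N-1..?B. scale (flow_coeff \<epsilon> 1 i * flow_coeff \<epsilon> p (nat n - i)) (F p $$ (j - 1 - p - n * ?e)))"
          using i False by (subst Sub_nth[OF N1, where B = ?B]) (auto simp: e W.scale_sum_right)
      qed
      also have "\<dots> = (\<Sum>p=N-1..?B. scale (flow_coeff \<epsilon> (1 + p) (nat n)) (F p $$ (j - 1 - p - n * ?e)))"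
        by (subst sum.swap) (simp add: flow_coeff_add W.scale_sum_left)
      also have "\<dots> = (\<Sum>p=N..?B+1. scale (flow_coeff \<epsilon> p (nat n)) (F (p - 1) $$ (j - p - n * ?e)))"
        by (rule sum.reindex_bij_witness[of _ "\<lambda>p. p - 1" "\<lambda>p. p + 1"]) (auto simp: algebra_simps)
      also have "\<dots> = Sub (shift F) $$ n $$ j"
        using False by (subst Sub_nth[OF M, where B = "?B + 1"]) (auto simp: shift_def)
      finally show ?thesis by simp
    qed
  qed
qed

end

section \<open>Coefficientwise maps, and substitution into series with a pole at x_1 = x\<close>

definition fls_map :: "('a::zero \<Rightarrow> 'b::zero) \<Rightarrow> 'a fls \<Rightarrow> 'b fls"
  where "fls_map h f = Abs_fls (\<lambda>n. h (f $$ n))"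

lemma fls_map_nth [simp]: "h 0 = 0 \<Longrightarrow> fls_map h f $$ n = h (f $$ n)"
  unfolding fls_map_def by (rule nth_Abs_fls_lower_bound[of "fls_subdegree f"]) simp

lemma additive_sum:
  fixes h :: "'a::ab_group_add \<Rightarrow> 'b::ab_group_add"
  assumes "\<And>u v. h (u + v) = h u + h v"
  shows "h (sum f A) = (\<Sum>a\<in>A. h (f a))"
  by (rule Modules.additive.sum) (simp add: additive_def assms)

lemma funpow_commute_app:
  assumes "\<And>x. f (g x) = g (f x)"
  shows "(f ^^ n) (g x) = g ((f ^^ n) x)"
  by (induction n) (simp_all add: assms)

text \<open>Stated for arbitrary scalars, so that it serves for W((x)) and again, with
  \<open>fls_map h\<close> in place of h, for W((x))((z)).\<close>

lemma (in vector_space) fls_map_act: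
  assumes add: "\<And>u v. h (u + v) = h u + h v" and sc: "\<And>c u. h (scale c u) = scale c (h u)"
  shows "fls_map h (fls_act scale p f) = fls_act scale p (fls_map h f)"
proof (rule fls_eqI)
  fix n
  have h0: "h 0 = 0" using add[of 0 0] by simp
  show "fls_map h (fls_act scale p f) $$ n = fls_act scale p (fls_map h f) $$ n"
    by (simp add: h0 fls_act_nth[of "fls_subdegree p" p "fls_subdegree f"] additive_sum[of h] add sc)
qed

context flow_space
begin

lemma xact_monom_0: "fls_monom (-1) 0 \<bullet>x f = - f"
  by (rule fls_eqI) simp

definition mul_diff :: "(int \<Rightarrow> 'w fls) \<Rightarrow> int \<Rightarrow> 'w fls"
  where "mul_diff F = (\<lambda>p. F (p - 1) - fls_monom 1 1 \<bullet>x F p)"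

lemma monom_act_neg: "monom_act (-1) 0 F = - F"
  by (simp add: monom_act_def xact_monom_0 fun_eq_iff)

abbreviation "pm \<equiv> phi_minus_x \<epsilon>"

lemma mul_diff_alt: "mul_diff F = shift F - monom_act 1 1 F"
  by (simp add: mul_diff_def shift_def monom_act_def fun_eq_iff)

lemma mul_diff_add: "mul_diff (F + G) = mul_diff F + mul_diff G"
  by (simp add: mul_diff_def fun_eq_iff X.scale_right_distrib)

lemma mul_diff_monom_act: "mul_diff (monom_act c r F) = monom_act c r (mul_diff F)"
  by (simp add: mul_diff_def monom_act_def fun_eq_iff X.scale_right_diff_distrib X.scale_left_commute)

lemma mul_diff_shift: "mul_diff (shift F) = shift (mul_diff F)"
  by (simp add: mul_diff_def shift_def)

lemma mul_diff_funpow_add: "(mul_diff ^^ k) (F + G) = (mul_diff ^^ k) F + (mul_diff ^^ k) G"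
  by (induction k) (simp_all only: funpow.simps comp_apply id_apply mul_diff_add)

lemma bounded_mul_diff: "bounded F \<Longrightarrow> bounded (mul_diff F)"
  unfolding mul_diff_alt diff_conv_add_uminus monom_act_neg[symmetric]
  by (intro bounded_add bounded_shift bounded_monom)

lemma bounded_mul_diff_funpow: "bounded F \<Longrightarrow> bounded ((mul_diff ^^ k) F)"
  by (induction k) (auto intro: bounded_mul_diff)

lemma fls_X_monom: "fls_X = fls_monom 1 1"
  by (rule fls_eqI) (simp add: fls_monom_nth)

lemma pm_act: "pm \<bullet>z X = phi \<epsilon> \<bullet>z X - fls_const (fls_monom 1 1) \<bullet>z X"
  by (simp add: phi_minus_x_def Z.scale_left_diff_distrib fls_X_monom)

lemma zact_const_neg: "fls_const (fls_monom (-1) 0) \<bullet>z X = - X"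
  by (rule fls_eqI) (simp add: xact_monom_0)

lemma Sub_mul_diff:
  assumes "bounded F"
  shows "Sub (mul_diff F) = pm \<bullet>z Sub F"
proof -
  have "mul_diff F = shift F + monom_act (-1) 0 (monom_act 1 1 F)"
    by (simp add: mul_diff_alt monom_act_neg)
  then show ?thesis using assms
    by (simp add: Sub_add bounded_shift bounded_monom Sub_shift Sub_monom pm_act zact_const_neg
          del: Z.scale_scale)
qed

lemma Sub_mul_diff_funpow: "bounded F \<Longrightarrow> Sub ((mul_diff ^^ k) F) = pm ^ k \<bullet>z Sub F"
  by (induction k) (simp_all add: Sub_mul_diff bounded_mul_diff_funpow)

lemma Sub_zero: "Sub 0 = 0"
  using Sub_monom[OF bounded_zero, of 0 0] 
  by (simp add: fls_monom_def monom_act_def zero_fun_def)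

text \<open>\<phi> - x is a nonzero element of the field C((x))((z)), so it can be divided out of
  any vector.\<close>

lemma pm_power_cancel: "pm ^ k \<bullet>z X = pm ^ k \<bullet>z Y \<Longrightarrow> X = Y"
  by (simp add: Z.scale_cancel_left phi_minus_x_neq_0)

text \<open>\<open>X\<close> is the value of \<open>F\<close> at \<open>x\<^sub>1 = \<phi>(x, z)\<close>, where \<open>F\<close> may have a pole at \<open>x\<^sub>1 = x\<close>.\<close>

definition phi_subst :: "(int \<Rightarrow> 'w fls) \<Rightarrow> 'w fls fls \<Rightarrow> bool"
  where "phi_subst F X \<longleftrightarrow> (\<exists>k. bounded ((mul_diff ^^ k) F) \<and> pm ^ k \<bullet>z X = Sub ((mul_diff ^^ k) F))"

lemma phi_substI: "bounded ((mul_diff ^^ k) F) \<Longrightarrow> pm ^ k \<bullet>z X = Sub ((mul_diff ^^ k) F) \<Longrightarrow> phi_subst F X"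
  by (auto simp: phi_subst_def)

text \<open>The two sides agree after multiplication by (\<phi> - x)^m, for the exponent m hidden in
  the relation, and this power cancels. This is why the product does not depend on the choice of
  k.\<close>

lemma phi_substD:
  assumes "phi_subst F X" and k: "bounded ((mul_diff ^^ k) F)"
  shows "pm ^ k \<bullet>z X = Sub ((mul_diff ^^ k) F)"
proof -
  obtain m where m: "bounded ((mul_diff ^^ m) F)" and X: "pm ^ m \<bullet>z X = Sub ((mul_diff ^^ m) F)"
    using assms(1) by (auto simp: phi_subst_def)
  have "pm ^ m \<bullet>z (pm ^ k \<bullet>z X) = pm ^ k \<bullet>z Sub ((mul_diff ^^ m) F)"
    unfolding X[symmetric] by (rule Z.scale_left_commute)
  also have "\<dots> = Sub ((mul_diff ^^ (k + m)) F)"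
    by (simp add: Sub_mul_diff_funpow[OF m, symmetric] funpow_add)
  also have "\<dots> = pm ^ m \<bullet>z Sub ((mul_diff ^^ k) F)"
    unfolding add.commute[of k] by (simp add: Sub_mul_diff_funpow[OF k, symmetric] funpow_add)
  finally show ?thesis by (rule pm_power_cancel)
qed

lemma phi_subst_unique: "phi_subst F X \<Longrightarrow> phi_subst F Y \<Longrightarrow> X = Y"
  by (metis pm_power_cancel phi_subst_def phi_substD)

lemma phi_subst_large:
  assumes "phi_subst F X"
  obtains k where "\<And>m. k \<le> m \<Longrightarrow> bounded ((mul_diff ^^ m) F)" "\<And>m. k \<le> m \<Longrightarrow> pm ^ m \<bullet>z X = Sub ((mul_diff ^^ m) F)"
proof -
  obtain k where k: "bounded ((mul_diff ^^ k) F)" using assms by (auto simp: phi_subst_def)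
  have "bounded ((mul_diff ^^ m) F)" if "k \<le> m" for m
    using bounded_mul_diff_funpow[OF k, of "m - k"] that by (simp flip: comp_apply[of "mul_diff ^^ _"] funpow_add)
  then show ?thesis using that[of k] phi_substD[OF assms] by blast
qed

lemma phi_subst_powi:
  assumes "bounded ((mul_diff ^^ k) F)"
  shows "phi_subst F (pm powi (- int k) \<bullet>z Sub ((mul_diff ^^ k) F))"
proof (rule phi_substI[OF assms])
  have "pm ^ k * pm powi (- int k) = 1"
    using phi_minus_x_neq_0 by (simp add: power_int_minus)
  then show "pm ^ k \<bullet>z pm powi (- int k) \<bullet>z Sub ((mul_diff ^^ k) F) = Sub ((mul_diff ^^ k) F)"
    by (simp add: Z.scale_scale)
qed

lemma phi_subst_add:
  assumes "phi_subst F X" "phi_subst G Y"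
  shows "phi_subst (F + G) (X + Y)"
proof -
  obtain k where k: "\<And>m. k \<le> m \<Longrightarrow> bounded ((mul_diff ^^ m) F)" "\<And>m. k \<le> m \<Longrightarrow> pm ^ m \<bullet>z X = Sub ((mul_diff ^^ m) F)"
    using assms(1) by (rule phi_subst_large) blast
  obtain l where l: "\<And>m. l \<le> m \<Longrightarrow> bounded ((mul_diff ^^ m) G)" "\<And>m. l \<le> m \<Longrightarrow> pm ^ m \<bullet>z Y = Sub ((mul_diff ^^ m) G)"
    using assms(2) by (rule phi_subst_large) blast
  show ?thesis
    by (rule phi_substI[of "max k l"])
       (use k(1) l(1) in \<open>auto simp: mul_diff_funpow_add bounded_add Sub_add k(2) l(2) Z.scale_right_distrib\<close>)
qed

lemma phi_subst_zero: "phi_subst 0 0"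
  by (rule phi_substI[of 0]) (simp_all add: bounded_zero Sub_zero)

lemma phi_subst_monom:
  assumes "phi_subst F X"
  shows "phi_subst (monom_act c r F) (fls_const (fls_monom c r) \<bullet>z X)"
proof -
  obtain k where k: "bounded ((mul_diff ^^ k) F)" "pm ^ k \<bullet>z X = Sub ((mul_diff ^^ k) F)"
    using assms by (auto simp: phi_subst_def)
  have "(mul_diff ^^ k) (monom_act c r F) = monom_act c r ((mul_diff ^^ k) F)"
    by (rule funpow_commute_app) (rule mul_diff_monom_act)
  then show ?thesis
    using k(1) k(2)[symmetric]
    by (intro phi_substI[of k]) (simp_all add: bounded_monom Sub_monom mult.commute)
qed

lemma phi_subst_uminus: "phi_subst F X \<Longrightarrow> phi_subst (- F) (- X)"
  using phi_subst_monom[of F X "-1" 0] by (simp add: monom_act_neg zact_const_neg)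

lemma phi_subst_diff: "phi_subst F X \<Longrightarrow> phi_subst G Y \<Longrightarrow> phi_subst (F - G) (X - Y)"
  using phi_subst_add[of F X "- G" "- Y"] phi_subst_uminus[of G Y] by simp

lemma phi_subst_sum: "(\<And>i. i \<in> I \<Longrightarrow> phi_subst (F i) (X i)) \<Longrightarrow> phi_subst (\<Sum>i\<in>I. F i) (\<Sum>i\<in>I. X i)"
  by (induction I rule: infinite_finite_induct) (auto intro: phi_subst_zero phi_subst_add)

lemma phi_subst_shift:
  assumes "phi_subst F X"
  shows "phi_subst (shift F) (phi \<epsilon> \<bullet>z X)"
proof -
  obtain k where k: "bounded ((mul_diff ^^ k) F)" "pm ^ k \<bullet>z X = Sub ((mul_diff ^^ k) F)"
    using assms by (auto simp: phi_subst_def)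
  have "(mul_diff ^^ k) (shift F) = shift ((mul_diff ^^ k) F)"
    by (rule funpow_commute_app) (rule mul_diff_shift)
  then show ?thesis
    using k(1) k(2)[symmetric]
    by (intro phi_substI[of k]) (simp_all add: bounded_shift Sub_shift mult.commute)
qed

text \<open>Moves one factor x_1 - x into or out of the relation; this drives the induction on the
  order of the pole in \<open>phi_subst_arg_deriv\<close>.\<close>

lemma phi_subst_mul_diff_iff: "phi_subst (mul_diff F) (pm \<bullet>z X) \<longleftrightarrow> phi_subst F X"
proof
  assume "phi_subst (mul_diff F) (pm \<bullet>z X)"
  then obtain k where "bounded ((mul_diff ^^ k) (mul_diff F))" "pm ^ k \<bullet>z pm \<bullet>z X = Sub ((mul_diff ^^ k) (mul_diff F))"
    by (auto simp: phi_subst_def)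
  then show "phi_subst F X"
    by (intro phi_substI[of "Suc k"]) (simp_all add: funpow_swap1 mult.commute)
next
  assume "phi_subst F X"
  then have "phi_subst (shift F - monom_act 1 1 F) (phi \<epsilon> \<bullet>z X - fls_const (fls_monom 1 1) \<bullet>z X)"
    by (intro phi_subst_diff phi_subst_shift phi_subst_monom)
  then show "phi_subst (mul_diff F) (pm \<bullet>z X)" by (simp add: mul_diff_alt pm_act)
qed

text \<open>Each coefficient of the value is a finite linear combination of coefficients of F, so L
  passes through. With L a coefficient of a further field c, this applies c outside the
  substitution.\<close>

lemma phi_subst_map:
  assumes phi_subst: "phi_subst F X" and add: "\<And>u v. L (u + v) = L u + L v" and sc: "\<And>c u. L (scale c u) = scale c (L u)"
  shows "phi_subst (\<lambda>p. fls_map L (F p)) (fls_map (fls_map L) X)"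
proof -
  have L0: "L 0 = 0" using add[of 0 0] by simp
  have fadd: "fls_map L (f + g) = fls_map L f + fls_map L g" for f g
    by (rule fls_eqI) (simp add: L0 add)
  have fx: "fls_map L (p \<bullet>x f) = p \<bullet>x fls_map L f" for p f
    by (rule W.fls_map_act) (auto simp: add sc)
  have f0: "fls_map L 0 = 0" by (rule fls_eqI) (simp add: L0)
  have fz: "fls_map (fls_map L) (p \<bullet>z X) = p \<bullet>z fls_map (fls_map L) X" for p X
    by (rule X.fls_map_act) (auto simp: fadd fx)
  have fdiff: "fls_map L (f - g) = fls_map L f - fls_map L g" for f g
    using fadd[of "f - g" g] by (simp add: algebra_simps)
  obtain k where k: "bounded ((mul_diff ^^ k) F)" "pm ^ k \<bullet>z X = Sub ((mul_diff ^^ k) F)"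
    using phi_subst by (auto simp: phi_subst_def)
  have mul_diff: "(mul_diff ^^ k) (\<lambda>p. fls_map L (F p)) = (\<lambda>p. fls_map L ((mul_diff ^^ k) F p))"
    by (rule funpow_commute_app[where g = "\<lambda>F p. fls_map L (F p)"]) (simp add: mul_diff_def fdiff fx)
  obtain N where N: "bounded_from N ((mul_diff ^^ k) F)" using k by (auto simp: bounded_def)
  have N': "bounded_from N (\<lambda>p. fls_map L ((mul_diff ^^ k) F p))"
    using N by (auto simp: bounded_from_def f0 L0)
  have "Sub (\<lambda>p. fls_map L ((mul_diff ^^ k) F p)) = fls_map (fls_map L) (Sub ((mul_diff ^^ k) F))"
    by (intro fls_eqI)
       (simp add: f0 L0 Sub_nth[OF N order_refl] Sub_nth[OF N' order_refl] additive_sum[of L] add sc)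
  then show ?thesis
    using N' by (intro phi_substI[of k]) (auto simp: mul_diff k(2)[symmetric] fz bounded_def)
qed


lemma fls_monom_zero [simp]: "fls_monom 0 r = 0"
  by (simp add: fls_monom_def)

section \<open>The derivation x^\<epsilon> d/dx under the substitution\<close>

definition x_deriv_act :: "'w fls \<Rightarrow> 'w fls"
  where "x_deriv_act f = Abs_fls (\<lambda>n. scale (of_int (n - \<epsilon> + 1)) (f $$ (n - \<epsilon> + 1)))"

lemma x_deriv_act_nth [simp]:
  "x_deriv_act f $$ n = scale (of_int (n - \<epsilon> + 1)) (f $$ (n - \<epsilon> + 1))"
  unfolding x_deriv_act_def by (rule nth_Abs_fls_lower_bound[of "fls_subdegree f + \<epsilon> - 1"]) auto

lemma x_deriv_act_zero [simp]: "x_deriv_act 0 = 0"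
  by (rule fls_eqI) simp

lemma x_deriv_act_add: "x_deriv_act (f + g) = x_deriv_act f + x_deriv_act g"
  by (rule fls_eqI) (simp add: W.scale_right_distrib)

lemma x_deriv_act_diff: "x_deriv_act (f - g) = x_deriv_act f - x_deriv_act g"
  by (rule fls_eqI) (simp add: W.scale_right_diff_distrib)

lemma x_deriv_act_monom:
  "x_deriv_act (fls_monom c r \<bullet>x f) =
    fls_monom c r \<bullet>x x_deriv_act f + fls_monom (of_int r * c) (r + \<epsilon> - 1) \<bullet>x f"
proof (rule fls_eqI)
  fix n
  have e: "n - \<epsilon> + 1 - r = n - r - \<epsilon> + 1" "n - (r + \<epsilon> - 1) = n - r - \<epsilon> + 1" by simp_all
  have "of_int (n - \<epsilon> + 1) * c = c * of_int (n - r - \<epsilon> + 1) + of_int r * c"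
    by (simp add: algebra_simps)
  then show "x_deriv_act (fls_monom c r \<bullet>x f) $$ n =
      (fls_monom c r \<bullet>x x_deriv_act f + fls_monom (of_int r * c) (r + \<epsilon> - 1) \<bullet>x f) $$ n"
    unfolding fls_plus_nth x_deriv_act_nth xact_monom_nth e
    by (simp only: W.scale_scale W.scale_left_distrib[symmetric])
qed

lemma xact_monom_add: "fls_monom c r \<bullet>x f + fls_monom d r \<bullet>x f = fls_monom (c + d) r \<bullet>x f"
  by (rule fls_eqI) (simp add: W.scale_left_distrib)

lemma xact_monom_mult: "fls_monom c r \<bullet>x fls_monom d s \<bullet>x f = fls_monom (c * d) (r + s) \<bullet>x f"
  by (rule fls_eqI) (simp del: X.scale_scale add: algebra_simps)

text \<open>The difference of \<open>x\<^sup>\<epsilon> d/dx\<close> and \<open>d/dz\<close>, a derivation which annihilates \<open>\<phi>\<^sub>\<epsilon>\<close>.\<close>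

definition flow_deriv :: "'w fls fls \<Rightarrow> 'w fls fls"
  where "flow_deriv X = Abs_fls (\<lambda>n. x_deriv_act (X $$ n) - fls_monom (of_int (n + 1)) 0 \<bullet>x X $$ (n + 1))"

lemma flow_deriv_nth:
  "flow_deriv X $$ n = x_deriv_act (X $$ n) - fls_monom (of_int (n + 1)) 0 \<bullet>x X $$ (n + 1)"
  unfolding flow_deriv_def
  by (rule nth_Abs_fls_lower_bound[of "fls_subdegree X - 1"]) auto

text \<open>Here x^\<epsilon> d/dx acts on the second variable with x_1 held fixed.\<close>

definition arg_deriv :: "(int \<Rightarrow> 'w fls) \<Rightarrow> int \<Rightarrow> 'w fls"
  where "arg_deriv F = (\<lambda>p. x_deriv_act (F p))"

lemma bounded_from_arg_deriv:
  assumes "bounded_from N F"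
  shows "bounded_from (min N (N + \<epsilon> - 1)) (arg_deriv F)"
  using assms by (auto simp: bounded_from_def arg_deriv_def)

text \<open>Chain rule: after x_1 = \<phi>(x, z) the operator x^\<epsilon> d/dx also differentiates
  \<phi>, while d/dz differentiates only \<phi>, and by the same amount. The difference is the
  derivative in the explicit x.\<close>

lemma Sub_arg_deriv:
  assumes "bounded F"
  shows "Sub (arg_deriv F) = flow_deriv (Sub F)"
proof -
  obtain N where N: "bounded_from N F" using assms by (auto simp: bounded_def)
  define M where "M = min N (N + \<epsilon> - 1)"
  have M: "bounded_from M (arg_deriv F)" "bounded_from M F"
    using bounded_from_arg_deriv[OF N] bounded_from_mono[OF N, of M] by (auto simp: M_def)
  show ?thesis
  proof (intro fls_eqI)
    fix i j
    define j' where "j' = j - \<epsilon> + 1"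
    show "Sub (arg_deriv F) $$ i $$ j = flow_deriv (Sub F) $$ i $$ j"
    proof (cases "i < 0")
      case True
      have "bounded (arg_deriv F)" using M by (auto simp: bounded_def)
      then have "Sub (arg_deriv F) $$ i = 0" by (rule Sub_nth_neg) fact
      moreover have "flow_deriv (Sub F) $$ i = 0"
      proof (cases "i = -1")
        case True
        then show ?thesis
          using Sub_nth_neg[OF assms \<open>i < 0\<close>] by (simp add: flow_deriv_nth)
      next
        case False
        then show ?thesis
          using Sub_nth_neg[OF assms, of i] Sub_nth_neg[OF assms, of "i + 1"] True
          by (simp add: flow_deriv_nth)
      qed
      ultimately show ?thesis by simp
    next
      case False
      define B where "B = max (j - i * (\<epsilon> - 1)) (j' - i * (\<epsilon> - 1)) - M"
      have B: "j - i * (\<epsilon> - 1) - M \<le> B" "j' - i * (\<epsilon> - 1) - M \<le> B" "j - (i + 1) * (\<epsilon> - 1) - M \<le> B"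
        by (auto simp: B_def j'_def algebra_simps)
      let ?c = "\<lambda>p. flow_coeff \<epsilon> p (nat i)"
      let ?v = "\<lambda>p. F p $$ (j' - p - i * (\<epsilon> - 1))"
      have i1: "nat (i + 1) = Suc (nat i)" using False by simp
      have i2: "of_int (i + 1) = of_nat (Suc (nat i))" using False by simp
      \<comment> \<open>The flow equation: d/dz contributes p + i (\<epsilon> - 1), and subtracting
        this from j' leaves the exponent of x in F p.\<close>
      have Sc: "of_int (i + 1) * flow_coeff \<epsilon> p (nat (i + 1)) = of_int (p + i * (\<epsilon> - 1)) * ?c p" for p
        unfolding i1 i2 using flow_coeff_Suc[of "nat i" \<epsilon> p] False by simp
      have "flow_deriv (Sub F) $$ i $$ j =
         scale (of_int j') (\<Sum>p=M..B. scale (?c p) (?v p)) -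
         scale (of_int (i + 1)) (\<Sum>p=M..B. scale (flow_coeff \<epsilon> p (nat (i + 1))) (F p $$ (j - p - (i + 1) * (\<epsilon> - 1))))"
        using False unfolding flow_deriv_nth fls_minus_nth x_deriv_act_nth j'_def[symmetric] xact_monom_nth
        by (simp add: Sub_nth[OF M(2) B(2)] Sub_nth[OF M(2) B(3)])
      also have "(\<Sum>p=M..B. scale (flow_coeff \<epsilon> p (nat (i + 1))) (F p $$ (j - p - (i + 1) * (\<epsilon> - 1)))) =
         (\<Sum>p=M..B. scale (flow_coeff \<epsilon> p (nat (i + 1))) (?v p))"
        by (simp add: j'_def algebra_simps)
      also have "scale (of_int j') (\<Sum>p=M..B. scale (?c p) (?v p)) - scale (of_int (i + 1)) \<dots> =
         (\<Sum>p=M..B. scale (of_int j' * ?c p) (?v p) - scale (of_int (i + 1) * flow_coeff \<epsilon> p (nat (i + 1))) (?v p))"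
        by (simp only: W.scale_sum_right W.scale_scale sum_subtractf)
      also have "\<dots> = (\<Sum>p=M..B. scale (?c p) (scale (of_int (j' - p - i * (\<epsilon> - 1))) (?v p)))"
        unfolding Sc W.scale_left_diff_distrib[symmetric] left_diff_distrib[symmetric] W.scale_scale of_int_diff[symmetric]
        by (intro sum.cong refl) (simp add: mult.commute diff_diff_eq)
      also have "\<dots> = Sub (arg_deriv F) $$ i $$ j"
      proof -
        have e: "j - p - i * (\<epsilon> - 1) - \<epsilon> + 1 = j' - p - i * (\<epsilon> - 1)" for p by (simp add: j'_def)
        show ?thesis
          using False unfolding Sub_nth[OF M(1) B(1)] arg_deriv_def[THEN fun_cong] x_deriv_act_nth e by simp
      qed
      finally show ?thesis by simp
    qed
  qed
qed

text \<open>Product rule with \<phi> annihilated: x^\<epsilon> d/dx sends the i-th coefficient of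
  \<phi> to i + 1 times the next one, which is what d/dz subtracts.\<close>

lemma flow_deriv_phi: "flow_deriv (phi \<epsilon> \<bullet>z X) = phi \<epsilon> \<bullet>z flow_deriv X"
proof (rule fls_eqI)
  fix n
  obtain N0 where N0: "\<And>i. i < N0 \<Longrightarrow> X $$ i = 0" using fls_bounded by blast
  \<comment> \<open>One lower, since d/dz lowers the order in z by one; the minimum with n keeps n -
    N positive, so \<open>nat\<close> truncates nothing.\<close>
  define N where "N = min N0 n - 1"
  have X0: "X $$ i = 0" if "i < N + 1" for i using that N0 by (auto simp: N_def)
  have F0: "flow_deriv X $$ i = 0" if "i < N" for i
    using that X0 by (simp add: flow_deriv_nth)
  let ?e = "\<lambda>i::nat. 1 + int i * (\<epsilon> - 1)"
  let ?m = "\<lambda>i. fls_monom (flow_coeff \<epsilon> 1 i) (?e i)"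
  define R where "R = nat (n - N)"
  have D: "x_deriv_act (?m i \<bullet>x f) = ?m i \<bullet>x x_deriv_act f +
      fls_monom (of_nat (Suc i) * flow_coeff \<epsilon> 1 (Suc i)) (?e (Suc i)) \<bullet>x f" for i f
    unfolding x_deriv_act_monom flow_coeff_Suc by (simp add: algebra_simps)
  have 1: "x_deriv_act ((phi \<epsilon> \<bullet>z X) $$ n) =
      (\<Sum>i\<le>R. ?m i \<bullet>x x_deriv_act (X $$ (n - int i))) +
      (\<Sum>i\<le>R. fls_monom (of_nat (Suc i) * flow_coeff \<epsilon> 1 (Suc i)) (?e (Suc i)) \<bullet>x X $$ (n - int i))"
    unfolding sum.distrib[symmetric] D[symmetric]
    by (subst phi_act_nth[where N = "N + 1" and R = R])
       (auto simp: X0 R_def additive_sum[of x_deriv_act] x_deriv_act_add)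
  have sh: "n + 1 - int (Suc i) = n - int i" for i by simp
  have "(\<Sum>i\<le>R. fls_monom (of_nat (Suc i) * flow_coeff \<epsilon> 1 (Suc i)) (?e (Suc i)) \<bullet>x X $$ (n - int i)) =
      (\<Sum>i\<le>Suc R. fls_monom (of_nat i * flow_coeff \<epsilon> 1 i) (?e i) \<bullet>x X $$ (n + 1 - int i))"
    by (subst sum.atMost_Suc_shift) (simp del: of_nat_Suc add: sh)
  also have "\<dots> = (\<Sum>i\<le>R. fls_monom (of_nat i * flow_coeff \<epsilon> 1 i) (?e i) \<bullet>x X $$ (n + 1 - int i))"
    by (simp add: X0 R_def)
  finally have 2: "(\<Sum>i\<le>R. fls_monom (of_nat (Suc i) * flow_coeff \<epsilon> 1 (Suc i)) (?e (Suc i)) \<bullet>x X $$ (n - int i)) = \<dots>" .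
  have 3: "fls_monom (of_int (n + 1)) 0 \<bullet>x (phi \<epsilon> \<bullet>z X) $$ (n + 1) =
      (\<Sum>i\<le>R. fls_monom (of_int (n + 1)) 0 \<bullet>x ?m i \<bullet>x X $$ (n + 1 - int i))"
    unfolding X.scale_sum_right[symmetric]
    by (subst phi_act_nth[where N = "N + 1" and R = R]) (auto simp: X0 R_def)
  have 4: "(phi \<epsilon> \<bullet>z flow_deriv X) $$ n = (\<Sum>i\<le>R. ?m i \<bullet>x x_deriv_act (X $$ (n - int i))) -
      (\<Sum>i\<le>R. ?m i \<bullet>x fls_monom (of_int (n + 1 - int i)) 0 \<bullet>x X $$ (n + 1 - int i))"
    unfolding sum_subtractf[symmetric] X.scale_right_diff_distrib[symmetric]
    by (subst phi_act_nth[OF F0, where R = R]) (auto simp: R_def flow_deriv_nth algebra_simps)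
  have 5: "fls_monom (of_int (n + 1)) 0 \<bullet>x ?m i \<bullet>x f =
      fls_monom (of_nat i * flow_coeff \<epsilon> 1 i) (?e i) \<bullet>x f +
      ?m i \<bullet>x fls_monom (of_int (n + 1 - int i)) 0 \<bullet>x f" for i f
    unfolding xact_monom_mult by (simp add: xact_monom_add algebra_simps del: X.scale_scale)
  show "flow_deriv (phi \<epsilon> \<bullet>z X) $$ n = (phi \<epsilon> \<bullet>z flow_deriv X) $$ n"
    unfolding flow_deriv_nth[of "phi \<epsilon> \<bullet>z X"] 1 2 3 4 5 sum.distrib by simp
qed

text \<open>\<phi> is annihilated and x is sent to x^\<epsilon>, so \<phi> - x is sent to -
  x^\<epsilon>.\<close>

lemma flow_deriv_pm: "flow_deriv (pm \<bullet>z X) = pm \<bullet>z flow_deriv X - fls_const (fls_monom 1 \<epsilon>) \<bullet>z X"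
proof -
  have "flow_deriv (fls_const (fls_monom 1 1) \<bullet>z X) =
      fls_const (fls_monom 1 1) \<bullet>z flow_deriv X + fls_const (fls_monom 1 \<epsilon>) \<bullet>z X"
    by (rule fls_eqI)
       (simp add: flow_deriv_nth x_deriv_act_monom X.scale_right_diff_distrib mult.commute)
  moreover have "flow_deriv (Y - Z) = flow_deriv Y - flow_deriv Z" for Y Z
    by (rule fls_eqI) (simp add: flow_deriv_nth x_deriv_act_diff X.scale_right_diff_distrib)
  ultimately show ?thesis by (simp add: pm_act flow_deriv_phi)
qed

lemma mul_diff_arg_deriv: "mul_diff (arg_deriv F) = arg_deriv (mul_diff F) + monom_act 1 \<epsilon> F"
  by (rule ext) (simp add: mul_diff_def arg_deriv_def monom_act_def x_deriv_act_diff x_deriv_act_monom)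

text \<open>Induction on the order k of the pole. Multiplication by x_1 - x does not commute with
  the derivation, but the extra term x^\<epsilon> F matches the one in \<open>flow_deriv_pm\<close>,
  so the factor can be removed again.\<close>

lemma phi_subst_arg_deriv:
  assumes "phi_subst F X"
  shows "phi_subst (arg_deriv F) (flow_deriv X)"
proof -
  obtain k where "bounded ((mul_diff ^^ k) F)" "pm ^ k \<bullet>z X = Sub ((mul_diff ^^ k) F)"
    using assms by (auto simp: phi_subst_def)
  then show ?thesis
  proof (induction k arbitrary: F X)
    case 0
    then have b: "bounded F" and X: "X = Sub F" by simp_all
    have "bounded (arg_deriv F)"
      using b bounded_from_arg_deriv by (auto simp: bounded_def)
    then show ?case using b by (intro phi_substI[of 0]) (simp_all add: X Sub_arg_deriv)
  next
    case (Suc k)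
    have "phi_subst F X" using Suc.prems by (rule phi_substI)
    have "phi_subst (arg_deriv (mul_diff F)) (flow_deriv (pm \<bullet>z X))"
      by (rule Suc.IH) (use Suc.prems in \<open>simp_all add: funpow_swap1 mult.commute\<close>)
    then have "phi_subst (arg_deriv (mul_diff F) + monom_act 1 \<epsilon> F) (flow_deriv (pm \<bullet>z X) + fls_const (fls_monom 1 \<epsilon>) \<bullet>z X)"
      by (intro phi_subst_add phi_subst_monom \<open>phi_subst F X\<close>)
    then have "phi_subst (mul_diff (arg_deriv F)) (pm \<bullet>z flow_deriv X)"
      by (simp add: mul_diff_arg_deriv flow_deriv_pm)
    then show ?case by (simp add: phi_subst_mul_diff_iff)
  qed
qed

end

section \<open>The products of fields\<close>

lemma mult_diff_funpow_add:
  fixes F G :: "int \<Rightarrow> int \<Rightarrow> 'a::ab_group_add"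
  shows "(mult_diff ^^ k) (F + G) = (mult_diff ^^ k) F + (mult_diff ^^ k) G"
  by (induction k arbitrary: F G) (simp_all only: funpow.simps id_apply comp_apply, simp add: mult_diff_def fun_eq_iff)

lemma mult_diff_funpow_left0:
  fixes F :: "int \<Rightarrow> int \<Rightarrow> 'a::ab_group_add"
  assumes "\<And>m n. m < N \<Longrightarrow> F m n = 0"
  shows "m < N \<Longrightarrow> (mult_diff ^^ k) F m n = 0"
  using assms by (induction k arbitrary: m n) (simp_all add: mult_diff_def)

lemma mult_diff_funpow_right0:
  fixes F :: "int \<Rightarrow> int \<Rightarrow> 'a::ab_group_add"
  assumes "\<And>m n. n < N \<Longrightarrow> F m n = 0"
  shows "n < N \<Longrightarrow> (mult_diff ^^ k) F m n = 0"
  using assms by (induction k arbitrary: m n) (simp_all add: mult_diff_def)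

lemma (in vector_space) mult_diff_funpow_scale:
  "(mult_diff ^^ k) (scale_series (scale_series scale) c F) = scale_series (scale_series scale) c ((mult_diff ^^ k) F)"
  by (induction k) (simp_all add: mult_diff_def scale_series_def scale_right_diff_distrib)

context flow_space
begin

abbreviation "fields\<^sub>W \<equiv> fields scale"

lemma fields_iff:
  "a \<in> fields\<^sub>W \<longleftrightarrow> (\<forall>u v. a (u + v) = a u + a v) \<and> (\<forall>c u n. a (scale c u) n = scale c (a u n)) \<and>
    (\<forall>w. \<exists>N. \<forall>n<N. a w n = 0)"
  unfolding Hom_laurent_def linear_on_def laurent_def scale_series_def by (simp add: fun_eq_iff)

lemma fields_add: "a \<in> fields\<^sub>W \<Longrightarrow> a (u + v) n = a u n + a v n"
  by (simp add: fields_iff)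

lemma fields_scale: "a \<in> fields\<^sub>W \<Longrightarrow> a (scale c u) n = scale c (a u n)"
  by (simp add: fields_iff)

lemma fields_zero: "a \<in> fields\<^sub>W \<Longrightarrow> a 0 n = 0"
  using fields_scale[of a 0 0 n] by simp

lemma fields_minus: "a \<in> fields\<^sub>W \<Longrightarrow> a (u - v) n = a u n - a v n"
  using fields_add[of a "u - v" v n] by (simp add: algebra_simps)

lemma fieldsE:
  assumes "a \<in> fields\<^sub>W"
  obtains N where "\<And>n. n < N \<Longrightarrow> a w n = 0"
proof -
  have "\<exists>N. \<forall>n<N. a w n = 0" using assms by (simp add: fields_iff)
  then show ?thesis using that by blast
qed

definition field_fls :: "('w \<Rightarrow> int \<Rightarrow> 'w) \<Rightarrow> 'w \<Rightarrow> 'w fls"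
  where "field_fls a w = Abs_fls (a w)"

lemma field_fls_nth: "a \<in> fields\<^sub>W \<Longrightarrow> field_fls a w $$ n = a w n"
  unfolding field_fls_def by (metis fieldsE nth_Abs_fls_lower_bound)

definition prod_fls :: "('w \<Rightarrow> int \<Rightarrow> 'w) \<Rightarrow> ('w \<Rightarrow> int \<Rightarrow> 'w) \<Rightarrow> 'w \<Rightarrow> int \<Rightarrow> 'w fls"
  where "prod_fls a b w = (\<lambda>p. fls_map (\<lambda>v. a v p) (field_fls b w))"

lemma prod_fls_nth: "a \<in> fields\<^sub>W \<Longrightarrow> b \<in> fields\<^sub>W \<Longrightarrow> prod_fls a b w p $$ j = a (b w j) p"
  by (simp add: prod_fls_def field_fls_nth fields_zero)

lemma mul_diff_funpow_nth:
  assumes "\<And>p j. F p $$ j = G p j"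
  shows "(mul_diff ^^ k) F p $$ j = (mult_diff ^^ k) G p j"
  by (induction k arbitrary: p j) (simp_all add: assms mul_diff_def mult_diff_def)

lemma mul_diff_funpow_prod_nth:
  "a \<in> fields\<^sub>W \<Longrightarrow> b \<in> fields\<^sub>W \<Longrightarrow>
    (mul_diff ^^ k) (prod_fls a b w) p $$ j = (mult_diff ^^ k) (field_prod a b w) p j"
  by (rule mul_diff_funpow_nth) (simp add: prod_fls_nth field_prod_def)

lemma compatible_order_bounded:
  assumes "a \<in> fields\<^sub>W" "b \<in> fields\<^sub>W" "compatible_order scale a b k"
  shows "bounded ((mul_diff ^^ k) (prod_fls a b w))"
proof -
  obtain N where N: "\<And>m n. m < N \<or> n < N \<Longrightarrow> (mult_diff ^^ k) (field_prod a b w) m n = 0"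
    using assms(3) unfolding compatible_order_def Hom_laurent2_def laurent2_def by blast
  have "bounded_from N ((mul_diff ^^ k) (prod_fls a b w))"
    unfolding bounded_from_def by (auto simp: mul_diff_funpow_prod_nth assms N intro!: fls_eqI)
  then show ?thesis by (auto simp: bounded_def)
qed

text \<open>On a vector, the left-hand side of the equation is bounded below in x_2 because b acts
  first, the right-hand side in x_1 because a acts first; equality gives both bounds.\<close>

lemma compatible_orderI:
  assumes a: "a \<in> fields\<^sub>W" and b: "b \<in> fields\<^sub>W"
    and eq: "\<And>w. (mult_diff ^^ k) (field_prod a b w) = (mult_diff ^^ k) (\<lambda>m n. field_prod b a w n m)"
  shows "compatible_order scale a b k"
  unfolding compatible_order_def Hom_laurent2_def
proof (intro CollectI conjI allI)
  have "field_prod a b (u + v) = field_prod a b u + field_prod a b v" for u v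
    using a b by (simp add: field_prod_def fun_eq_iff fields_add)
  moreover have "field_prod a b (scale c u) = scale_series (scale_series scale) c (field_prod a b u)" for c u
    using a b by (simp add: field_prod_def fun_eq_iff fields_scale scale_series_def)
  ultimately show "linear_on UNIV scale (scale_series (scale_series scale)) (\<lambda>w. (mult_diff ^^ k) (field_prod a b w))"
    by (simp add: linear_on_def mult_diff_funpow_add W.mult_diff_funpow_scale)
  fix w
  obtain M where M: "\<And>n. n < M \<Longrightarrow> a w n = 0" using a by (rule fieldsE[where w = w]) blast
  obtain N where N: "\<And>n. n < N \<Longrightarrow> b w n = 0" using b by (rule fieldsE[where w = w]) blast
  have "(mult_diff ^^ k) (field_prod a b w) m n = 0" if "n < N" for m n
    using that by (rule mult_diff_funpow_right0[rotated]) (simp add: field_prod_def N fields_zero a)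
  moreover have "(mult_diff ^^ k) (field_prod a b w) m n = 0" if "m < M" for m n
    unfolding eq using that
    by (rule mult_diff_funpow_left0[rotated]) (simp add: field_prod_def M fields_zero b)
  ultimately have "(mult_diff ^^ k) (field_prod a b w) m n = 0" if "m < min M N \<or> n < min M N" for m n
    using that by auto
  then show "(mult_diff ^^ k) (field_prod a b w) \<in> laurent2"
    unfolding laurent2_def by blast
qed

lemma compatible_if_mutually_local:
  assumes "a \<in> fields\<^sub>W" "b \<in> fields\<^sub>W" "mutually_local UNIV a b"
  shows "\<exists>k. compatible_order scale a b k"
  using compatible_orderI[OF assms(1,2)] assms(3) unfolding mutually_local_def by blast

text \<open>The support lies in a finite set determined by the subdegrees, so \<open>Sum_any\<close>
  is a genuine sum and splits into the two nested convolutions.\<close>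

lemma smult_series_eq: "smult_series scale p (\<lambda>i j. X $$ i $$ j) i j = (p \<bullet>z X) $$ i $$ j"
proof -
  define a where "a = fls_subdegree p"
  define b where "b = fls_subdegree X"
  define a' where "a' m = fls_subdegree (p $$ m)" for m
  define b' where "b' m = fls_subdegree (X $$ m)" for m
  define S where "S = (SIGMA m:{a..i - b}. {a' m..j - b' (i - m)})"
  let ?g = "\<lambda>(m, n). scale (p $$ m $$ n) (X $$ (i - m) $$ (j - n))"
  have "{x. ?g x \<noteq> 0} \<subseteq> S"
  proof clarify
    fix m n assume "scale (p $$ m $$ n) (X $$ (i - m) $$ (j - n)) \<noteq> 0"
    then have nz: "p $$ m $$ n \<noteq> 0" "X $$ (i - m) $$ (j - n) \<noteq> 0" by auto
    then have "p $$ m \<noteq> 0" "X $$ (i - m) \<noteq> 0" by auto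
    then have "a \<le> m" "b \<le> i - m" unfolding a_def b_def by (auto simp: not_less intro!: fls_subdegree_leI)
    moreover have "a' m \<le> n" "b' (i - m) \<le> j - n" 
      unfolding a'_def b'_def using nz by (auto intro!: fls_subdegree_leI)
    ultimately show "(m, n) \<in> S" by (simp add: S_def)
  qed
  moreover have "finite S" by (simp add: S_def)
  ultimately have "smult_series scale p (\<lambda>i j. X $$ i $$ j) i j = sum ?g S"
    unfolding smult_series_def by (intro Sum_any.expand_superset)
  also have "\<dots> = (\<Sum>m=a..i - b. \<Sum>n=a' m..j - b' (i - m). scale (p $$ m $$ n) (X $$ (i - m) $$ (j - n)))"
    unfolding S_def by (subst sum.Sigma) auto
  also have "\<dots> = (p \<bullet>z X) $$ i $$ j"
  proof -
    have "(p \<bullet>z X) $$ i = (\<Sum>m=a..i - b. p $$ m \<bullet>x X $$ (i - m))"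
      by (rule X.fls_act_nth) (auto simp: a_def b_def)
    moreover have "(p $$ m \<bullet>x X $$ (i - m)) $$ j =
        (\<Sum>n=a' m..j - b' (i - m). scale (p $$ m $$ n) (X $$ (i - m) $$ (j - n)))" for m
      by (rule W.fls_act_nth) (auto simp: a'_def b'_def)
    ultimately show ?thesis by (simp add: fls_nth_sum)
  qed
  finally show ?thesis .
qed

text \<open>\<phi> - x has order exactly 1 in z, which bounds the pole of the product by k.\<close>

lemma pm_powi_nth: "n < - int k \<Longrightarrow> (pm powi (- int k)) $$ n = 0"
proof -
  have "fls_subdegree pm = 1"
  proof (rule fls_subdegree_eqI)
    have "pm $$ 1 $$ \<epsilon> \<noteq> 0"
      by (simp add: phi_minus_x_def phi_nth flow_coeff_def fls_monom_def)
    then show "pm $$ 1 \<noteq> 0" by auto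
    show "pm $$ n = 0" if "n < 1" for n
      using that by (auto simp: phi_minus_x_def phi_nth fls_X_monom)
  qed
  then have "fls_subdegree (inverse (pm ^ k)) = - int k"
    by (simp add: fls_subdegree_pow)
  then show "n < - int k \<Longrightarrow> (pm powi (- int k)) $$ n = 0"
    by (simp add: power_int_minus)
qed

abbreviation "YE \<equiv> Y_E scale \<epsilon>"

definition YE_fls :: "('w \<Rightarrow> int \<Rightarrow> 'w) \<Rightarrow> ('w \<Rightarrow> int \<Rightarrow> 'w) \<Rightarrow> 'w \<Rightarrow> 'w fls fls"
  where "YE_fls a b w = Abs_fls (\<lambda>n. Abs_fls (YE a b n w))"

text \<open>The only place where \<open>Y_E\<close> is unfolded. Afterwards the product is
  characterised by the relation \<open>phi_subst\<close>, and k serves as an exponent of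
  compatibility and a bound on the pole.\<close>

lemma Y_E_fls:
  assumes a: "a \<in> fields\<^sub>W" and b: "b \<in> fields\<^sub>W" and "\<exists>k. compatible_order scale a b k"
  obtains k where "compatible_order scale a b k" "\<And>w. phi_subst (prod_fls a b w) (YE_fls a b w)"
    "\<And>w n j. YE_fls a b w $$ n $$ j = YE a b n w j"
    "\<And>w n. n < - int k \<Longrightarrow> YE_fls a b w $$ n = 0"
proof -
  define k where "k = (SOME k. compatible_order scale a b k)"
  have k: "compatible_order scale a b k" unfolding k_def by (rule someI_ex) fact
  define X where "X w = pm powi (- int k) \<bullet>z Sub ((mul_diff ^^ k) (prod_fls a b w))" for w
  have bd: "bounded ((mul_diff ^^ k) (prod_fls a b w))" for w
    using a b k by (rule compatible_order_bounded)
  have XY: "X w $$ n $$ j = YE a b n w j" for w n j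
  proof -
    have "subst_phi scale \<epsilon> ((mult_diff ^^ k) (field_prod a b w)) =
        (\<lambda>i j. Sub ((mul_diff ^^ k) (prod_fls a b w)) $$ i $$ j)"
      by (simp add: fun_eq_iff Sub_nth_nth_subst_phi[OF bd] mul_diff_funpow_prod_nth a b)
    then show ?thesis
      by (simp add: Y_E_def Let_def k_def[symmetric] smult_series_eq X_def)
  qed
  have low: "X w $$ n = 0" if "n < - int k" for w n
    unfolding X_def using that
    by (simp add: X.fls_act_nth[of "- int k" _ 0] pm_powi_nth Sub_nth_neg[OF bd])
  have "Abs_fls (YE a b n w) = X w $$ n" for w n
    by (simp add: XY[abs_def, symmetric] fun_eq_iff fls_nth_inverse)
  then have "YE_fls a b w = X w" for w
    by (simp add: YE_fls_def fls_nth_inverse)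
  then show thesis using that[of k] k XY low phi_subst_powi[OF bd] by (simp add: X_def)
qed

end

section \<open>Locality of the products\<close>

lemma mult_diff_funpow_swap:
  fixes F :: "int \<Rightarrow> int \<Rightarrow> 'a::ab_group_add"
  shows "(mult_diff ^^ k) (\<lambda>m n. F n m) m n = (if even k then (mult_diff ^^ k) F n m else - (mult_diff ^^ k) F n m)"
  by (induction k arbitrary: m n) (auto simp: mult_diff_def)

lemma mult_diff_zero: "mult_diff (0 :: int \<Rightarrow> int \<Rightarrow> 'a::ab_group_add) = 0"
  by (simp add: mult_diff_def fun_eq_iff)

lemma mult_diff_funpow_zero: "(mult_diff ^^ k) (0 :: int \<Rightarrow> int \<Rightarrow> 'a::ab_group_add) = 0"
  by (induction k) (simp_all only: funpow.simps id_apply comp_apply mult_diff_zero)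

lemma mult_diff_funpow_diff:
  fixes F G :: "int \<Rightarrow> int \<Rightarrow> 'a::ab_group_add"
  shows "(mult_diff ^^ k) (F - G) = (mult_diff ^^ k) F - (mult_diff ^^ k) G"
  using mult_diff_funpow_add[of k "F - G" G] by (simp only: diff_add_cancel eq_diff_eq)

lemma funpow_zero_mono:
  fixes h :: "'a::zero \<Rightarrow> 'a"
  assumes "h 0 = 0" "(h ^^ k) x = 0" "k \<le> m"
  shows "(h ^^ m) x = 0"
proof -
  have 0: "(h ^^ j) 0 = 0" for j by (induction j) (simp_all only: funpow.simps id_apply comp_apply assms(1))
  obtain j where "m = j + k" using assms(3) by (metis le_iff_add add.commute)
  then show ?thesis by (simp only: funpow_add comp_apply assms(2) 0)
qed

lemmas mult_diff_funpow_zero_mono = funpow_zero_mono[of mult_diff, OF mult_diff_zero]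

text \<open>A single series instead of an equation between two, so that locality becomes
  annihilation by a power of x_1 - x_2 and is visibly additive. The index m always belongs to a, and
  n to b.\<close>

definition commutator :: "('w \<Rightarrow> int \<Rightarrow> 'w) \<Rightarrow> ('w \<Rightarrow> int \<Rightarrow> 'w) \<Rightarrow> 'w \<Rightarrow> int \<Rightarrow> int \<Rightarrow> 'w::ab_group_add"
  where "commutator a b w = (\<lambda>m n. a (b w n) m - b (a w m) n)"

lemma mutually_local_iff:
  "mutually_local V a b \<longleftrightarrow> (\<exists>k. \<forall>w\<in>V. (mult_diff ^^ k) (commutator a b w) = 0)"
proof -
  have "commutator a b w = field_prod a b w - (\<lambda>m n. field_prod b a w n m)" for w
    by (simp add: commutator_def field_prod_def fun_eq_iff)
  then show ?thesis
    unfolding mutually_local_def by (simp only: mult_diff_funpow_diff right_minus_eq)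
qed

lemma mutually_local_sym:
  fixes a b :: "'a \<Rightarrow> int \<Rightarrow> 'a::ab_group_add"
  assumes "mutually_local V a b"
  shows "mutually_local V b a"
proof -
  obtain k where k: "\<forall>w\<in>V. (mult_diff ^^ k) (commutator a b w) = 0"
    using assms by (auto simp only: mutually_local_iff)
  have "(mult_diff ^^ k) (commutator b a w) = 0" if "w \<in> V" for w
  proof -
    have "commutator b a w = 0 - (\<lambda>m n. commutator a b w n m)"
      by (simp add: commutator_def fun_eq_iff)
    moreover have "(mult_diff ^^ k) (\<lambda>m n. commutator a b w n m) = 0"
    proof (intro ext)
      fix m n
      have "(mult_diff ^^ k) (commutator a b w) = 0" using k that by blast
      then show "(mult_diff ^^ k) (\<lambda>m n. commutator a b w n m) m n = 0 m n"
        unfolding mult_diff_funpow_swap[of k "commutator a b w" m n] by simp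
    qed
    ultimately show ?thesis
      using mult_diff_funpow_diff[of k 0 "\<lambda>m n. commutator a b w n m"]
      by (simp only: mult_diff_funpow_zero diff_0_right)
  qed
  then show ?thesis unfolding mutually_local_iff by blast
qed

definition mul_diff12 :: "(int \<Rightarrow> int \<Rightarrow> 'b \<Rightarrow> 'a::ab_group_add) \<Rightarrow> int \<Rightarrow> int \<Rightarrow> 'b \<Rightarrow> 'a"
  where "mul_diff12 G = (\<lambda>m p j. G (m - 1) p j - G m (p - 1) j)"

definition mul_diff13 :: "(int \<Rightarrow> 'b \<Rightarrow> int \<Rightarrow> 'a::ab_group_add) \<Rightarrow> int \<Rightarrow> 'b \<Rightarrow> int \<Rightarrow> 'a"
  where "mul_diff13 G = (\<lambda>m p j. G (m - 1) p j - G m p (j - 1))"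

lemma mul_diff12_funpow: "(mul_diff12 ^^ k) G m p j = (mult_diff ^^ k) (\<lambda>m p. G m p j) m p"
  by (induction k arbitrary: m p) (simp_all add: mul_diff12_def mult_diff_def)

lemma mul_diff13_funpow: "(mul_diff13 ^^ k) G m p j = (mult_diff ^^ k) (\<lambda>m j. G m p j) m j"
  by (induction k arbitrary: m j) (simp_all add: mul_diff13_def mult_diff_def)

lemma mul_diff12_mul_diff13_commute: "mul_diff12 (mul_diff13 G) = mul_diff13 (mul_diff12 G)"
  by (simp add: mul_diff12_def mul_diff13_def fun_eq_iff)

lemma mul_diff12_mul_diff13_funpow_commute: "(mul_diff12 ^^ k) ((mul_diff13 ^^ l) G) = (mul_diff13 ^^ l) ((mul_diff12 ^^ k) G)"
  by (induction k) (simp_all only: funpow.simps id_apply comp_apply funpow_commute_app[of mul_diff13 mul_diff12, OF mul_diff12_mul_diff13_commute[symmetric]])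

lemma mul_diff12_add: "mul_diff12 (G + H) = mul_diff12 G + mul_diff12 H" and mul_diff13_add: "mul_diff13 (G' + H') = mul_diff13 G' + mul_diff13 H'"
  by (simp_all add: mul_diff12_def mul_diff13_def fun_eq_iff)

lemma mul_diff12_funpow_add: "(mul_diff12 ^^ k) (G + H) = (mul_diff12 ^^ k) G + (mul_diff12 ^^ k) H"
  by (induction k) (simp_all only: funpow.simps id_apply comp_apply mul_diff12_add)

lemma mul_diff13_funpow_add: "(mul_diff13 ^^ k) (G + H) = (mul_diff13 ^^ k) G + (mul_diff13 ^^ k) H"
  by (induction k) (simp_all only: funpow.simps id_apply comp_apply mul_diff13_add)

lemma mul_diff12_zero: "mul_diff12 0 = 0" and mul_diff13_zero: "mul_diff13 0 = 0"
  by (simp_all add: mul_diff12_def mul_diff13_def fun_eq_iff)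

lemma mul_diff12_funpow_zero: "(mul_diff12 ^^ k) 0 = 0"
  by (induction k) (simp_all only: funpow.simps id_apply comp_apply mul_diff12_zero)

lemma mul_diff13_funpow_zero: "(mul_diff13 ^^ k) 0 = 0"
  by (induction k) (simp_all only: funpow.simps id_apply comp_apply mul_diff13_zero)

context flow_space
begin

lemma mult_diff_funpow_additive:
  fixes h :: "'a::ab_group_add \<Rightarrow> 'b::ab_group_add"
  assumes "\<And>u v. h (u - v) = h u - h v"
  shows "(mult_diff ^^ k) (\<lambda>m n. h (F m n)) m n = h ((mult_diff ^^ k) F m n)"
  by (induction k arbitrary: m n) (simp_all add: mult_diff_def assms)

text \<open>[c, ab] = [c, a]b + a[c, b]: the first term is annihilated by a power of the difference
  of the variables of c and a, the second by one of the variables of c and b, and the two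
  multiplications commute.\<close>

lemma commutator_triple_zero:
  fixes c a b :: "'w \<Rightarrow> int \<Rightarrow> 'w"
  assumes a: "a \<in> fields\<^sub>W"
    and ca: "\<And>w. (mult_diff ^^ k) (commutator c a w) = 0"
    and cb: "\<And>w. (mult_diff ^^ l) (commutator c b w) = 0"
  shows "(mul_diff12 ^^ k) ((mul_diff13 ^^ l) (\<lambda>m p j. c (a (b w j) p) m - a (b (c w m) j) p)) = 0"
proof -
  define G1 where "G1 = (\<lambda>m p j. commutator c a (b w j) m p)"
  define G2 where "G2 = (\<lambda>m p j. a (commutator c b w m j) p)"
  have G: "(\<lambda>m p j. c (a (b w j) p) m - a (b (c w m) j) p) = G1 + G2"
    by (simp add: G1_def G2_def commutator_def fields_minus[OF a] fun_eq_iff)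
  have G1: "(mul_diff12 ^^ k) G1 = 0"
    by (intro ext) (simp add: mul_diff12_funpow G1_def ca)
  have G2: "(mul_diff13 ^^ l) G2 = 0"
  proof (intro ext)
    fix m p j
    show "(mul_diff13 ^^ l) G2 m p j = 0 m p j"
      using mult_diff_funpow_additive[of "\<lambda>v. a v p" l "commutator c b w" m j]
      by (simp add: mul_diff13_funpow G2_def fields_minus[OF a] cb fields_zero[OF a])
  qed
  show ?thesis
    unfolding G mul_diff13_funpow_add mul_diff12_funpow_add G2 mul_diff12_funpow_zero mul_diff12_mul_diff13_funpow_commute G1 mul_diff13_funpow_zero
    by simp
qed

text \<open>
  For families indexed by the exponent of a further variable \<open>x\<^sub>1\<close>: multiplication by \<open>x\<^sub>1 - \<phi>(x, z)\<close> and
  \<open>x\<^sub>1 - x\<close>, and before the substitution \<open>y = \<phi>(x, z)\<close> by \<open>x\<^sub>1 - y\<close> and \<open>x\<^sub>1 - x\<close>.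
\<close>

definition fam_phi :: "(int \<Rightarrow> 'w fls fls) \<Rightarrow> int \<Rightarrow> 'w fls fls"
  where "fam_phi E = (\<lambda>m. E (m - 1) - phi \<epsilon> \<bullet>z E m)"

definition fam_x :: "(int \<Rightarrow> 'w fls fls) \<Rightarrow> int \<Rightarrow> 'w fls fls"
  where "fam_x E = (\<lambda>m. E (m - 1) - fls_const (fls_monom 1 1) \<bullet>z E m)"

definition fam_shift :: "(int \<Rightarrow> int \<Rightarrow> 'w fls) \<Rightarrow> int \<Rightarrow> int \<Rightarrow> 'w fls"
  where "fam_shift F = (\<lambda>m. F (m - 1) - shift (F m))"

definition fam_monom :: "(int \<Rightarrow> int \<Rightarrow> 'w fls) \<Rightarrow> int \<Rightarrow> int \<Rightarrow> 'w fls"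
  where "fam_monom F = (\<lambda>m. F (m - 1) - monom_act 1 1 (F m))"

lemma phi_subst_fam_phi: "(\<And>m. phi_subst (F m) (E m)) \<Longrightarrow> phi_subst ((fam_shift ^^ k) F m) ((fam_phi ^^ k) E m)"
  by (induction k arbitrary: m) (auto simp: fam_shift_def fam_phi_def intro!: phi_subst_diff phi_subst_shift)

lemma phi_subst_fam_x: "(\<And>m. phi_subst (F m) (E m)) \<Longrightarrow> phi_subst ((fam_monom ^^ k) F m) ((fam_x ^^ k) E m)"
  by (induction k arbitrary: m) (auto simp: fam_monom_def fam_x_def intro!: phi_subst_diff phi_subst_monom)

lemma fam_shift_nth:
  assumes "\<And>m p j. F m p $$ j = G m p j"
  shows "(fam_shift ^^ k) F m p $$ j = (mul_diff12 ^^ k) G m p j"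
  by (induction k arbitrary: m p j) (simp_all add: assms fam_shift_def shift_def mul_diff12_def)

lemma fam_monom_nth:
  assumes "\<And>m p j. F m p $$ j = G m p j"
  shows "(fam_monom ^^ k) F m p $$ j = (mul_diff13 ^^ k) G m p j"
  by (induction k arbitrary: m p j) (simp_all add: assms fam_monom_def monom_act_def mul_diff13_def)

lemma fam_x_nth: "(fam_x ^^ k) E m $$ n $$ j = (mult_diff ^^ k) (\<lambda>m j. E m $$ n $$ j) m j"
  by (induction k arbitrary: m j) (simp_all add: fam_x_def mult_diff_def)

lemma fam_x_low:
  assumes "\<And>m n. n < N \<Longrightarrow> E m $$ n = 0"
  shows "n < N \<Longrightarrow> (fam_x ^^ k) E m $$ n = 0"
  using assms by (induction k arbitrary: m n) (simp_all add: fam_x_def)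

lemma fam_x_add: "fam_x (E + E') = fam_x E + fam_x E'"
  by (simp add: fam_x_def fun_eq_iff Z.scale_right_distrib)

lemma fam_x_funpow_add: "(fam_x ^^ k) (E + E') = (fam_x ^^ k) E + (fam_x ^^ k) E'"
  by (induction k) (simp_all only: funpow.simps id_apply comp_apply fam_x_add)

lemma fam_x_zero: "fam_x 0 = 0"
  by (simp add: fam_x_def fun_eq_iff)

lemma fam_x_funpow_zero: "(fam_x ^^ k) 0 = 0"
  by (induction k) (simp_all only: funpow.simps id_apply comp_apply fam_x_zero)

lemma pm_act_low:
  assumes "\<And>n. n < N \<Longrightarrow> X $$ n = 0" "n < N + 1"
  shows "(pm \<bullet>z X) $$ n = 0"
proof -
  have "pm $$ i = 0" if "i < 1" for i
    using that by (auto simp: phi_minus_x_def phi_nth fls_X_monom)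
  then show ?thesis using assms by (subst X.fls_act_nth[where M = 1 and N = N]) auto
qed

text \<open>Expanding \<open>x\<^sub>1 - x = (x\<^sub>1 - \<phi>) + (\<phi> - x)\<close>, where \<open>\<phi> - x\<close> raises the order in \<open>z\<close>.\<close>

lemma fam_x_eventually_zero:
  assumes "(fam_phi ^^ s) E = 0" "\<And>m n. n < N \<Longrightarrow> E m $$ n = 0" "n < N + int d"
  shows "(fam_x ^^ (s + d)) E m $$ n = 0"
  using assms
\<comment> \<open>Each factor x_1 - x is spent either as x_1 - \<phi>, lowering s, or as \<phi> - x,
  lowering d and raising N by one. At s = 0 the family is zero; at d = 0 the index n lies below the
  order.\<close>
proof (induction "s + d" arbitrary: s d E N n m)
  case 0
  then show ?case by simp
next
  case (Suc r)
  show ?case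
  proof (cases "s = 0 \<or> d = 0")
    case True
    then show ?thesis
    proof
      assume "s = 0"
      then have "E = 0" using Suc.prems(1) by simp
      then show ?thesis by (simp only: fam_x_funpow_zero zero_fun_apply fls_zero_nth)
    next
      assume "d = 0"
      then show ?thesis using Suc.prems by (intro fam_x_low[of N]) auto
    qed
  next
    case False
    then obtain s' d' where s': "s = Suc s'" and d': "d = Suc d'" by (meson not0_implies_Suc)
    define E' where "E' = (\<lambda>m. pm \<bullet>z E m)"
    have split: "fam_x E = fam_phi E + E'"
      by (simp add: fam_x_def fam_phi_def E'_def pm_act fun_eq_iff)
    have low: "fam_phi E m $$ n = 0" if "n < N" for m n
    proof -
      have "(phi \<epsilon> \<bullet>z E m) $$ n = 0"
        using Suc.prems(2) that by (subst phi_act_nth[of N _ n "nat (n - N)"]) auto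
      then show ?thesis using Suc.prems(2) that by (simp add: fam_phi_def)
    qed
    have 1: "(fam_x ^^ (s' + d)) (fam_phi E) m $$ n = 0"
      by (rule Suc.hyps(1)[where N = N])
         (use Suc.hyps(2) Suc.prems low s' in \<open>simp_all add: funpow_swap1\<close>)
    have comm: "(fam_phi ^^ s) E' = (\<lambda>m. pm \<bullet>z (fam_phi ^^ s) E m)"
      unfolding E'_def
      by (rule funpow_commute_app[where g = "\<lambda>E m. pm \<bullet>z E m"])
         (simp add: fam_phi_def Z.scale_right_diff_distrib mult.commute fun_eq_iff)
    have 2: "(fam_x ^^ (s + d')) E' m $$ n = 0"
    proof (rule Suc.hyps(1)[where N = "N + 1"])
      show "r = s + d'" using Suc.hyps(2) d' by simp
      show "(fam_phi ^^ s) E' = 0" unfolding comm Suc.prems(1) by (simp add: fun_eq_iff)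
      show "E' m $$ n = 0" if "n < N + 1" for m n
        unfolding E'_def using Suc.prems(2) that by (intro pm_act_low[of N]) auto
      show "n < N + 1 + int d'" using Suc.prems(3) d' by simp
    qed
    have "(fam_x ^^ (s + d)) E = (fam_x ^^ r) (fam_x E)"
      unfolding Suc.hyps(2)[symmetric] funpow.simps comp_apply by (rule funpow_swap1)
    then have "(fam_x ^^ (s + d)) E m $$ n = (fam_x ^^ r) (fam_phi E) m $$ n + (fam_x ^^ r) E' m $$ n"
      unfolding split fam_x_funpow_add by simp
    also have "\<dots> = 0" using 1 2 Suc.hyps(2) s' d' by simp
    finally show ?thesis .
  qed
qed

text \<open>The commutator of c with Y(a, z)b is the value at y = \<phi>(x, z) of the commutator of
  c with a(y)b(x). Powers of x_1 - y and x_1 - x annihilate the latter, so by uniqueness of values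
  powers of x_1 - \<phi> and x_1 - x annihilate the former.\<close>

lemma mutually_local_Y_E:
  assumes F: "a \<in> fields\<^sub>W" "b \<in> fields\<^sub>W" "c \<in> fields\<^sub>W"
    and ab: "\<exists>k. compatible_order scale a b k" and ca: "mutually_local UNIV c a" and cb: "mutually_local UNIV c b"
  shows "mutually_local UNIV c (YE a b n)"
proof -
  obtain k0 where Y: "\<And>w. phi_subst (prod_fls a b w) (YE_fls a b w)"
    "\<And>w n j. YE_fls a b w $$ n $$ j = YE a b n w j"
    "\<And>w n. n < - int k0 \<Longrightarrow> YE_fls a b w $$ n = 0"
    using F(1,2) ab by (rule Y_E_fls) blast
  obtain k where k: "\<And>w. (mult_diff ^^ k) (commutator c a w) = 0"
    using ca unfolding mutually_local_iff by blast
  obtain l where l: "\<And>w. (mult_diff ^^ l) (commutator c b w) = 0"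
    using cb unfolding mutually_local_iff by blast
  \<comment> \<open>The orders in z from -k0 up to n number n + k0 + 1; that many factors \<phi> - x
    push everything above z^n.\<close>
  define d where "d = nat (n + int k0 + 1)"
  have c0: "c 0 m = 0" for m using fields_zero F(3) .
  have "(mult_diff ^^ (k + d + l)) (commutator c (YE a b n) w) = 0" for w
  proof (intro ext)
    fix m j
    define E where "E m = fls_map (fls_map (\<lambda>v. c v m)) (YE_fls a b w) - YE_fls a b (c w m)" for m
    define P where "P m = (\<lambda>p. fls_map (\<lambda>v. c v m) (prod_fls a b w p)) - prod_fls a b (c w m)" for m
    have map0: "fls_map (\<lambda>v. c v m) 0 = 0" for m
      by (rule fls_eqI) (simp add: c0)
    have phi_subst: "phi_subst (P m) (E m)" for m
      unfolding P_def E_def by (intro phi_subst_diff phi_subst_map Y) (simp_all add: fields_add fields_scale F)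
    have P: "P m p $$ j = c (a (b w j) p) m - a (b (c w m) j) p" for m p j
      by (simp add: P_def prod_fls_nth F c0)
    have P0: "(fam_shift ^^ k) ((fam_monom ^^ l) P) m = 0" for m
    proof (intro ext fls_eqI)
      fix p j
      show "(fam_shift ^^ k) ((fam_monom ^^ l) P) m p $$ j = 0 p $$ j"
        unfolding fam_shift_nth[OF fam_monom_nth[OF P]] commutator_triple_zero[OF F(1) k l] by simp
    qed
    have "phi_subst ((fam_shift ^^ k) ((fam_monom ^^ l) P) m) ((fam_phi ^^ k) ((fam_x ^^ l) E) m)" for m
      by (intro phi_subst_fam_phi phi_subst_fam_x phi_subst)
    then have "(fam_phi ^^ k) ((fam_x ^^ l) E) m = 0" for m
      unfolding P0 by (rule phi_subst_unique) (rule phi_subst_zero)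
    then have "(fam_phi ^^ k) ((fam_x ^^ l) E) = 0"
      by (intro ext) (simp only: zero_fun_apply)
    moreover have "(fam_x ^^ l) E m $$ n = 0" if "n < - int k0" for m n
      by (rule fam_x_low[OF _ that]) (simp add: E_def Y map0)
    moreover have "n < - int k0 + int d" by (simp add: d_def)
    ultimately have "(fam_x ^^ (k + d)) ((fam_x ^^ l) E) m $$ n = 0"
      by (rule fam_x_eventually_zero)
    then have "(fam_x ^^ (k + d + l)) E m $$ n $$ j = 0"
      by (simp add: funpow_add)
    moreover have "commutator c (YE a b n) w = (\<lambda>m j. E m $$ n $$ j)"
      by (simp add: commutator_def E_def map0 c0 Y fun_eq_iff)
    ultimately show "(mult_diff ^^ (k + d + l)) (commutator c (YE a b n) w) m j = 0 m j"
      by (simp add: fam_x_nth)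
  qed
  then show ?thesis unfolding mutually_local_iff by blast
qed


section \<open>Linearity, vacuum and derivation for the products\<close>

abbreviation "compatible a b \<equiv> \<exists>k. compatible_order scale a b k"

lemma rel_YE_fls:
  "a \<in> fields\<^sub>W \<Longrightarrow> b \<in> fields\<^sub>W \<Longrightarrow> compatible a b \<Longrightarrow> phi_subst (prod_fls a b w) (YE_fls a b w)"
  by (erule (2) Y_E_fls)

lemma YE_fls_nth:
  "a \<in> fields\<^sub>W \<Longrightarrow> b \<in> fields\<^sub>W \<Longrightarrow> compatible a b \<Longrightarrow> YE_fls a b w $$ n $$ j = YE a b n w j"
  by (erule (2) Y_E_fls)

text \<open>Uniqueness of values: algebraic properties of the products reduce to exhibiting a
  candidate X.\<close>

lemma Y_E_eqI:
  assumes "a \<in> fields\<^sub>W" "b \<in> fields\<^sub>W" "compatible a b" "phi_subst (prod_fls a b w) X"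
  shows "YE a b n w j = X $$ n $$ j"
  using phi_subst_unique[OF assms(4) rel_YE_fls[OF assms(1-3)]] YE_fls_nth[OF assms(1-3)] by simp

lemma Y_E_low:
  assumes "a \<in> fields\<^sub>W" "b \<in> fields\<^sub>W" "compatible a b"
  shows "\<exists>N. \<forall>n<N. YE a b n = 0"
proof -
  obtain k where "\<And>w n. n < - int k \<Longrightarrow> YE_fls a b w $$ n = 0"
    using assms by (rule Y_E_fls) blast
  then have "\<forall>n < - int k. YE a b n = 0"
    using YE_fls_nth[OF assms] by (metis ext fls_zero_nth zero_fun_apply)
  then show ?thesis by blast
qed

lemma prod_fls_add:
  assumes "a \<in> fields\<^sub>W" "b \<in> fields\<^sub>W"
  shows "prod_fls a b (u + v) = prod_fls a b u + prod_fls a b v"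
  by (intro ext fls_eqI) (simp add: prod_fls_nth assms fields_add)

lemma prod_fls_scale:
  assumes "a \<in> fields\<^sub>W" "b \<in> fields\<^sub>W"
  shows "prod_fls a b (scale c u) = monom_act c 0 (prod_fls a b u)"
  by (intro ext fls_eqI) (simp add: prod_fls_nth assms fields_scale monom_act_def)

lemma Y_E_field:
  assumes "a \<in> fields\<^sub>W" "b \<in> fields\<^sub>W" "compatible a b"
  shows "YE a b n \<in> fields\<^sub>W"
  unfolding fields_iff
proof (intro conjI allI)
  fix u v w c m
  note phi_subst = rel_YE_fls[OF assms] and nth = YE_fls_nth[OF assms] and eqI = Y_E_eqI[OF assms]
  show "YE a b n (u + v) = YE a b n u + YE a b n v"
    using eqI[OF phi_subst_add[OF phi_subst[of u] phi_subst[of v], folded prod_fls_add[OF assms(1,2)]]]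
    by (intro ext) (simp add: nth)
  show "YE a b n (scale c u) m = scale c (YE a b n u m)"
    using eqI[OF phi_subst_monom[OF phi_subst[of u], of c 0, folded prod_fls_scale[OF assms(1,2)]]]
    by (simp add: nth)
  show "\<exists>N. \<forall>m<N. YE a b n w m = 0"
    unfolding nth[symmetric] by (rule fls_bounded)
qed

lemma fields_plus: "a \<in> fields\<^sub>W \<Longrightarrow> b \<in> fields\<^sub>W \<Longrightarrow> a + b \<in> fields\<^sub>W"
  unfolding fields_iff
proof (intro conjI allI)
  fix u v w c n
  assume a: "(\<forall>u v. a (u + v) = a u + a v) \<and> (\<forall>c u n. a (scale c u) n = scale c (a u n)) \<and> (\<forall>w. \<exists>N. \<forall>n<N. a w n = 0)"
    and b: "(\<forall>u v. b (u + v) = b u + b v) \<and> (\<forall>c u n. b (scale c u) n = scale c (b u n)) \<and> (\<forall>w. \<exists>N. \<forall>n<N. b w n = 0)"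
  show "(a + b) (u + v) = (a + b) u + (a + b) v" using a b by (simp add: fun_eq_iff)
  show "(a + b) (scale c u) n = scale c ((a + b) u n)" using a b by (simp add: W.scale_right_distrib)
  obtain N where "\<forall>n<N. a w n = 0" using a by blast
  moreover obtain M where "\<forall>n<M. b w n = 0" using b by blast
  ultimately have "\<forall>n<min M N. (a + b) w n = 0" by simp
  then show "\<exists>N. \<forall>n<N. (a + b) w n = 0" ..
qed

lemma scale_field_nth: "scale_field scale c a w n = scale c (a w n)"
  by (simp add: scale_field_def scale_series_def)

lemma fields_scale_field: "a \<in> fields\<^sub>W \<Longrightarrow> scale_field scale c a \<in> fields\<^sub>W"
  unfolding fields_iff
  by (auto simp: fun_eq_iff scale_field_nth W.scale_right_distrib mult.commute) (metis W.scale_zero_right)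

lemma id_field_nth: "id_field w n = (if n = 0 then w else 0)"
  by (simp add: id_field_def monomial0_def)

lemma id_field_fields: "id_field \<in> fields\<^sub>W"
  unfolding fields_iff id_field_def monomial0_def by (auto simp: fun_eq_iff intro!: exI[of _ 0])

lemma Y_E_add_right:
  assumes "a \<in> fields\<^sub>W" "b \<in> fields\<^sub>W" "b' \<in> fields\<^sub>W" "compatible a b" "compatible a b'" "compatible a (b + b')"
  shows "YE a (b + b') n = YE a b n + YE a b' n"
proof (intro ext)
  fix w j
  have "prod_fls a (b + b') w = prod_fls a b w + prod_fls a b' w"
    by (intro ext fls_eqI) (simp add: prod_fls_nth assms fields_add fields_plus)
  then have "phi_subst (prod_fls a (b + b') w) (YE_fls a b w + YE_fls a b' w)"
    using assms by (simp only: phi_subst_add rel_YE_fls)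
  then show "YE a (b + b') n w j = (YE a b n + YE a b' n) w j"
    using Y_E_eqI[of a "b + b'"] by (simp add: assms fields_plus YE_fls_nth)
qed

lemma Y_E_add_left:
  assumes "a \<in> fields\<^sub>W" "a' \<in> fields\<^sub>W" "b \<in> fields\<^sub>W" "compatible a b" "compatible a' b" "compatible (a + a') b"
  shows "YE (a + a') b n = YE a b n + YE a' b n"
proof (intro ext)
  fix w j
  have "prod_fls (a + a') b w = prod_fls a b w + prod_fls a' b w"
    by (intro ext fls_eqI) (simp add: prod_fls_nth assms fields_plus)
  then have "phi_subst (prod_fls (a + a') b w) (YE_fls a b w + YE_fls a' b w)"
    using assms by (simp only: phi_subst_add rel_YE_fls)
  then show "YE (a + a') b n w j = (YE a b n + YE a' b n) w j"
    using Y_E_eqI[of "a + a'" b] by (simp add: assms fields_plus YE_fls_nth)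
qed

lemma Y_E_scale_right:
  assumes "a \<in> fields\<^sub>W" "b \<in> fields\<^sub>W" "compatible a b" "compatible a (scale_field scale c b)"
  shows "YE a (scale_field scale c b) n = scale_field scale c (YE a b n)"
proof (intro ext)
  fix w j
  have "prod_fls a (scale_field scale c b) w = monom_act c 0 (prod_fls a b w)"
    by (intro ext fls_eqI)
       (simp add: prod_fls_nth assms fields_scale_field scale_field_nth fields_scale monom_act_def)
  then have "phi_subst (prod_fls a (scale_field scale c b) w) (fls_const (fls_monom c 0) \<bullet>z YE_fls a b w)"
    using assms by (simp only: phi_subst_monom rel_YE_fls)
  then show "YE a (scale_field scale c b) n w j = scale_field scale c (YE a b n) w j"
    using Y_E_eqI[of a "scale_field scale c b"] by (simp add: assms fields_scale_field YE_fls_nth scale_field_nth)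
qed

lemma Y_E_scale_left:
  assumes "a \<in> fields\<^sub>W" "b \<in> fields\<^sub>W" "compatible a b" "compatible (scale_field scale c a) b"
  shows "YE (scale_field scale c a) b n = scale_field scale c (YE a b n)"
proof (intro ext)
  fix w j
  have "prod_fls (scale_field scale c a) b w = monom_act c 0 (prod_fls a b w)"
    by (intro ext fls_eqI)
       (simp add: prod_fls_nth assms fields_scale_field scale_field_nth monom_act_def)
  then have "phi_subst (prod_fls (scale_field scale c a) b w) (fls_const (fls_monom c 0) \<bullet>z YE_fls a b w)"
    using assms by (simp only: phi_subst_monom rel_YE_fls)
  then show "YE (scale_field scale c a) b n w j = scale_field scale c (YE a b n) w j"
    using Y_E_eqI[of "scale_field scale c a" b] by (simp add: assms fields_scale_field YE_fls_nth scale_field_nth)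
qed

text \<open>Only x_1^0 occurs, and \<phi>^0 = 1 does not involve z; there is no pole, so the
  relation holds with exponent 0.\<close>

lemma Y_E_id_left:
  assumes b: "b \<in> fields\<^sub>W" and "compatible id_field b"
  shows "YE id_field b = monomial0 b"
proof (intro ext)
  fix n w j
  define F where "F = prod_fls id_field b w"
  have F: "F p = (if p = 0 then field_fls b w else 0)" for p
    by (rule fls_eqI) (auto simp: F_def prod_fls_nth id_field_fields b field_fls_nth id_field_nth)
  define N where "N = min 0 (fls_subdegree (field_fls b w))"
  have bd: "bounded_from N F" by (auto simp: bounded_from_def F N_def)
  have "Sub F = fls_const (field_fls b w)"
  proof (intro fls_eqI)
    fix i j
    define B where "B = max 0 (j - i * (\<epsilon> - 1) - N)"
    have "Sub F $$ i $$ j = (if i < 0 then 0 else \<Sum>p=N..B. scale (flow_coeff \<epsilon> p (nat i)) (F p $$ (j - p - i * (\<epsilon> - 1))))"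
      by (rule Sub_nth[OF bd]) (simp add: B_def)
    also have "\<dots> = (if i < 0 then 0 else \<Sum>p=N..B. if p = 0 then scale (flow_coeff \<epsilon> 0 (nat i)) (field_fls b w $$ (j - i * (\<epsilon> - 1))) else 0)"
      by (intro if_cong refl sum.cong) (auto simp: F)
    also have "\<dots> = fls_const (field_fls b w) $$ i $$ j"
      by (auto simp: flow_coeff_zero N_def B_def)
    finally show "Sub F $$ i $$ j = fls_const (field_fls b w) $$ i $$ j" .
  qed
  then have "phi_subst (prod_fls id_field b w) (fls_const (field_fls b w))"
    using bd by (intro phi_substI[of 0]) (auto simp: F_def bounded_def)
  then show "YE id_field b n w j = monomial0 b n w j"
    using Y_E_eqI[of id_field b] assms by (simp add: id_field_fields field_fls_nth monomial0_def)
qed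

text \<open>The value is a(\<phi>(x, z)) = e^(z x^\<epsilon> d/dx) a(x), a power series in z with
  constant term a(x).\<close>

lemma Y_E_id_right:
  assumes a: "a \<in> fields\<^sub>W" and "compatible a id_field"
  shows "n < 0 \<Longrightarrow> YE a id_field n = 0" and "YE a id_field 0 = a"
proof -
  define F where "F w = prod_fls a id_field w" for w
  have F: "F w p = fls_const (a w p)" for w p
    by (rule fls_eqI) (auto simp: F_def prod_fls_nth id_field_fields a id_field_nth fields_zero)
  have bd: "\<exists>N\<le>0. bounded_from N (F w)" for w
  proof -
    obtain N where "\<And>n. n < N \<Longrightarrow> a w n = 0" using a by (rule fieldsE[where w = w]) blast
    then have "bounded_from (min 0 N) (F w)" by (auto simp: bounded_from_def F)
    then show ?thesis by (meson min.cobounded1)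
  qed
  have "phi_subst (prod_fls a id_field w) (Sub (F w))" for w
    using bd[of w] by (intro phi_substI[of 0]) (auto simp: F_def bounded_def)
  then have Y: "YE a id_field n w j = Sub (F w) $$ n $$ j" for n w j
    by (intro Y_E_eqI assms id_field_fields)
  show "YE a id_field n = 0" if "n < 0" for n
  proof (intro ext)
    fix w j
    have "bounded (F w)" using bd[of w] by (auto simp: bounded_def)
    then show "YE a id_field n w j = 0 w j" using that by (simp add: Y Sub_nth_neg)
  qed
  show "YE a id_field 0 = a"
  proof (intro ext)
    fix w j
    obtain N where N: "bounded_from N (F w)" using bd by blast
    then have N': "bounded_from (min N j) (F w)" by (rule bounded_from_mono) simp
    have "YE a id_field 0 w j = (\<Sum>p=min N j..max j (j - min N j). if p = j then a w j else 0)"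
      unfolding Y by (subst Sub_nth[OF N', where B = "max j (j - min N j)"]) (auto simp: F intro!: sum.cong)
    then show "YE a id_field 0 w j = a w j" by simp
  qed
qed

definition field_deriv :: "('w \<Rightarrow> int \<Rightarrow> 'w) \<Rightarrow> 'w \<Rightarrow> int \<Rightarrow> 'w"
  where "field_deriv a = (\<lambda>w n. scale (of_int (n - \<epsilon> + 1)) (a w (n - \<epsilon> + 1)))"

lemma field_deriv_nth: "field_deriv a w n = scale (of_int (n - \<epsilon> + 1)) (a w (n - \<epsilon> + 1))"
  by (simp add: field_deriv_def)

lemma field_deriv_fields:
  assumes "a \<in> fields\<^sub>W"
  shows "field_deriv a \<in> fields\<^sub>W"
  unfolding fields_iff
proof (intro conjI allI)
  fix u v w c n
  show "field_deriv a (u + v) = field_deriv a u + field_deriv a v"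
    by (simp add: field_deriv_def fun_eq_iff fields_add[OF assms] W.scale_right_distrib)
  show "field_deriv a (scale c u) n = scale c (field_deriv a u n)"
    by (simp add: field_deriv_def fields_scale[OF assms] mult.commute)
  obtain N where "\<And>n. n < N \<Longrightarrow> a w n = 0" using assms by (rule fieldsE[where w = w]) blast
  then have "\<forall>n<N + \<epsilon> - 1. field_deriv a w n = 0" by (simp add: field_deriv_def)
  then show "\<exists>N. \<forall>n<N. field_deriv a w n = 0" ..
qed

lemma field_deriv_id: "field_deriv id_field = 0"
  by (auto simp add: field_deriv_nth id_field_nth fun_eq_iff simp del: of_int_add of_int_diff)

text \<open>Differentiating the second factor b is x^\<epsilon> d/dx at fixed x_1, so
  \<open>phi_subst_arg_deriv\<close> gives the value.\<close>

lemma Y_E_field_deriv_right: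
  assumes a: "a \<in> fields\<^sub>W" and b: "b \<in> fields\<^sub>W" and "compatible a b" "compatible a (field_deriv b)"
  shows "field_deriv (YE a b n) =
    YE a (field_deriv b) n + scale_field scale (of_int (n + 1)) (YE a b (n + 1))"
proof (intro ext)
  fix w j
  have "prod_fls a (field_deriv b) w = arg_deriv (prod_fls a b w)"
    by (intro ext fls_eqI)
       (simp add: prod_fls_nth a b field_deriv_fields arg_deriv_def field_deriv_nth fields_scale)
  then have "phi_subst (prod_fls a (field_deriv b) w) (flow_deriv (YE_fls a b w))"
    using assms by (simp only: phi_subst_arg_deriv rel_YE_fls)
  then have "YE a (field_deriv b) n w j = flow_deriv (YE_fls a b w) $$ n $$ j"
    by (intro Y_E_eqI assms field_deriv_fields)
  then show "field_deriv (YE a b n) w j =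
      (YE a (field_deriv b) n + scale_field scale (of_int (n + 1)) (YE a b (n + 1))) w j"
    by (simp add: flow_deriv_nth YE_fls_nth assms scale_field_nth field_deriv_nth)
qed


section \<open>Weak commutativity\<close>

text \<open>Series in \<open>z\<^sub>1, z\<^sub>2\<close> on which power series in both variables act, regardless of the order in which
  negative powers are expanded.\<close>

definition quadrant_finite :: "(int \<Rightarrow> int \<Rightarrow> 'w fls) \<Rightarrow> bool"
  where "quadrant_finite Y \<longleftrightarrow>
    (\<forall>m n. \<exists>N. \<forall>i j. i \<le> m \<and> j \<le> n \<and> (i < N \<or> j < N) \<longrightarrow> Y i j = 0)"

definition act2 :: "(nat \<Rightarrow> nat \<Rightarrow> complex fls) \<Rightarrow> (int \<Rightarrow> int \<Rightarrow> 'w fls) \<Rightarrow> int \<Rightarrow> int \<Rightarrow> 'w fls"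
  where "act2 c Y m n = Sum_any (\<lambda>(s, t). c s t \<bullet>x Y (m - int s) (n - int t))"

lemma quadrant_finiteE:
  assumes "quadrant_finite Y"
  obtains N where "\<And>i j. i \<le> m \<Longrightarrow> j \<le> n \<Longrightarrow> i < N \<or> j < N \<Longrightarrow> Y i j = 0"
proof -
  have "\<exists>N. \<forall>i j. i \<le> m \<and> j \<le> n \<and> (i < N \<or> j < N) \<longrightarrow> Y i j = 0"
    using assms by (simp only: quadrant_finite_def)
  then show ?thesis using that by blast
qed

lemma act2_eq:
  assumes N: "\<And>i j. i \<le> m \<Longrightarrow> j \<le> n \<Longrightarrow> i < N \<or> j < N \<Longrightarrow> Y i j = 0"
    and R: "nat (m - N) \<le> R" "nat (n - N) \<le> R"
  shows "act2 c Y m n = (\<Sum>(s, t)\<in>{..R} \<times> {..R}. c s t \<bullet>x Y (m - int s) (n - int t))"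
  unfolding act2_def
proof (rule Sum_any.expand_superset)
  show "{a. (case a of (s, t) \<Rightarrow> c s t \<bullet>x Y (m - int s) (n - int t)) \<noteq> 0} \<subseteq> {..R} \<times> {..R}"
  proof clarify
    fix s t assume "c s t \<bullet>x Y (m - int s) (n - int t) \<noteq> 0"
    then have "Y (m - int s) (n - int t) \<noteq> 0" by auto
    then have "\<not> (m - int s < N \<or> n - int t < N)" using N[of "m - int s" "n - int t"] by auto
    then show "s \<in> {..R} \<and> t \<in> {..R}" using R by auto
  qed
qed simp

lemma act2_zero_region:
  assumes N: "\<And>i j. i \<le> m \<Longrightarrow> j \<le> n \<Longrightarrow> i < N \<or> j < N \<Longrightarrow> Y i j = 0"
    and "m < N \<or> n < N"
  shows "act2 c Y m n = 0"
proof -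
  have "c s t \<bullet>x Y (m - int s) (n - int t) = 0" for s t
    using N[of "m - int s" "n - int t"] assms(2) by auto
  then have "(\<lambda>(s, t). c s t \<bullet>x Y (m - int s) (n - int t)) = (\<lambda>_. 0)"
    by (simp only: case_prod_unfold)
  then show ?thesis unfolding act2_def by simp
qed

lemma act2_region:
  assumes N: "\<And>i j. i \<le> m \<Longrightarrow> j \<le> n \<Longrightarrow> i < N \<or> j < N \<Longrightarrow> Y i j = 0"
    and "i \<le> m" "j \<le> n" "i < N \<or> j < N"
  shows "act2 c Y i j = 0"
  by (rule act2_zero_region[where N = N]) (use assms in auto)

lemma quadrant_finite_act2:
  assumes "quadrant_finite Y"
  shows "quadrant_finite (act2 c Y)"
  unfolding quadrant_finite_def
proof (intro allI)
  fix m n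
  obtain N where N: "\<And>i j. i \<le> m \<Longrightarrow> j \<le> n \<Longrightarrow> i < N \<or> j < N \<Longrightarrow> Y i j = 0"
    using assms by (rule quadrant_finiteE[where m = m and n = n]) blast
  have "act2 c Y i j = 0" if "i \<le> m" "j \<le> n" "i < N \<or> j < N" for i j
    by (rule act2_region[where N = N and m = m and n = n]) (use N that in auto)
  then have "\<forall>i j. i \<le> m \<and> j \<le> n \<and> (i < N \<or> j < N) \<longrightarrow> act2 c Y i j = 0" by blast
  then show "\<exists>N. \<forall>i j. i \<le> m \<and> j \<le> n \<and> (i < N \<or> j < N) \<longrightarrow> act2 c Y i j = 0" ..
qed

lemma quadrant_finite_act2_funpow: "quadrant_finite Y \<Longrightarrow> quadrant_finite ((act2 c ^^ k) Y)"
  by (induction k) (simp_all add: quadrant_finite_act2)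

lemma quadrant_finite_diff:
  assumes "quadrant_finite Y" "quadrant_finite Z"
  shows "quadrant_finite (Y - Z)"
  unfolding quadrant_finite_def
proof (intro allI)
  fix m n
  obtain N where N: "\<And>i j. i \<le> m \<Longrightarrow> j \<le> n \<Longrightarrow> i < N \<or> j < N \<Longrightarrow> Y i j = 0"
    using assms(1) by (rule quadrant_finiteE[where m = m and n = n]) blast
  obtain M where M: "\<And>i j. i \<le> m \<Longrightarrow> j \<le> n \<Longrightarrow> i < M \<or> j < M \<Longrightarrow> Z i j = 0"
    using assms(2) by (rule quadrant_finiteE[where m = m and n = n]) blast
  have "(Y - Z) i j = 0" if "i \<le> m" "j \<le> n" "i < min M N \<or> j < min M N" for i j
    using M[OF that(1,2)] N[OF that(1,2)] that(3) by auto
  then have "\<forall>i j. i \<le> m \<and> j \<le> n \<and> (i < min M N \<or> j < min M N) \<longrightarrow> (Y - Z) i j = 0" by blast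
  then show "\<exists>N. \<forall>i j. i \<le> m \<and> j \<le> n \<and> (i < N \<or> j < N) \<longrightarrow> (Y - Z) i j = 0" ..
qed

lemma act2_commute:
  assumes "quadrant_finite Y"
  shows "act2 c (act2 d Y) = act2 d (act2 c Y)"
proof (intro ext)
  fix m n
  obtain N where N: "\<And>i j. i \<le> m \<Longrightarrow> j \<le> n \<Longrightarrow> i < N \<or> j < N \<Longrightarrow> Y i j = 0"
    using assms by (rule quadrant_finiteE[where m = m and n = n]) blast
  define R where "R = max (nat (m - N)) (nat (n - N))"
  let ?S = "{..R} \<times> {..R}"
  have eq: "act2 c (act2 d Y) m n =
      (\<Sum>(s, t)\<in>?S. \<Sum>(s', t')\<in>?S. (c s t * d s' t') \<bullet>x Y (m - int s - int s') (n - int t - int t'))" for c d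
  proof -
    have "act2 c (act2 d Y) m n = (\<Sum>(s, t)\<in>?S. c s t \<bullet>x act2 d Y (m - int s) (n - int t))"
      by (rule act2_eq[OF act2_region[OF N]]) (auto simp: R_def)
    also have "\<dots> = (\<Sum>(s, t)\<in>?S. \<Sum>(s', t')\<in>?S. (c s t * d s' t') \<bullet>x Y (m - int s - int s') (n - int t - int t'))"
    proof (rule sum.cong, rule refl, clarify)
      fix s t
      have "act2 d Y (m - int s) (n - int t) =
          (\<Sum>(s', t')\<in>?S. d s' t' \<bullet>x Y (m - int s - int s') (n - int t - int t'))"
        by (rule act2_eq[where N = N]) (use N in \<open>auto simp: R_def\<close>)
      then show "c s t \<bullet>x act2 d Y (m - int s) (n - int t) =
          (\<Sum>(s', t')\<in>?S. (c s t * d s' t') \<bullet>x Y (m - int s - int s') (n - int t - int t'))"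
        by (simp add: X.scale_sum_right case_prod_unfold)
    qed
    finally show ?thesis .
  qed
  have "act2 c (act2 d Y) m n =
      (\<Sum>z\<in>?S. \<Sum>z'\<in>?S. (c (fst z) (snd z) * d (fst z') (snd z')) \<bullet>x
        Y (m - int (fst z) - int (fst z')) (n - int (snd z) - int (snd z')))"
    by (simp only: eq case_prod_unfold)
  also have "\<dots> = (\<Sum>z'\<in>?S. \<Sum>z\<in>?S. (d (fst z') (snd z') * c (fst z) (snd z)) \<bullet>x
        Y (m - int (fst z') - int (fst z)) (n - int (snd z') - int (snd z)))"
    by (subst sum.swap, rule sum.cong, rule refl, rule sum.cong, rule refl)
       (simp only: mult.commute diff_diff_eq add.commute)
  also have "\<dots> = act2 d (act2 c Y) m n"
    by (simp only: eq case_prod_unfold)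
  finally show "act2 c (act2 d Y) m n = act2 d (act2 c Y) m n" .
qed

lemma act2_funpow_commute:
  "quadrant_finite Y \<Longrightarrow> (act2 c ^^ k) (act2 d Y) = act2 d ((act2 c ^^ k) Y)"
  by (induction k) (simp_all add: act2_commute quadrant_finite_act2_funpow)

lemma act2_funpow_funpow_commute:
  "quadrant_finite Y \<Longrightarrow> (act2 c ^^ k) ((act2 d ^^ l) Y) = (act2 d ^^ l) ((act2 c ^^ k) Y)"
  by (induction l) (simp_all add: act2_funpow_commute quadrant_finite_act2_funpow)

lemma act2_diff:
  assumes "quadrant_finite Y" "quadrant_finite Z"
  shows "act2 c (Y - Z) = act2 c Y - act2 c Z"
proof (intro ext)
  fix m n
  obtain N where N: "\<And>i j. i \<le> m \<Longrightarrow> j \<le> n \<Longrightarrow> i < N \<or> j < N \<Longrightarrow> Y i j = 0"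
    using assms(1) by (rule quadrant_finiteE[where m = m and n = n]) blast
  obtain M where M: "\<And>i j. i \<le> m \<Longrightarrow> j \<le> n \<Longrightarrow> i < M \<or> j < M \<Longrightarrow> Z i j = 0"
    using assms(2) by (rule quadrant_finiteE[where m = m and n = n]) blast
  define L where "L = min M N"
  define R where "R = max (nat (m - L)) (nat (n - L))"
  have Y: "act2 c Y m n = (\<Sum>(s, t)\<in>{..R} \<times> {..R}. c s t \<bullet>x Y (m - int s) (n - int t))"
    by (rule act2_eq[where N = L]) (use N in \<open>auto simp: L_def R_def\<close>)
  have Z: "act2 c Z m n = (\<Sum>(s, t)\<in>{..R} \<times> {..R}. c s t \<bullet>x Z (m - int s) (n - int t))"
    by (rule act2_eq[where N = L]) (use M in \<open>auto simp: L_def R_def\<close>)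
  have "act2 c (Y - Z) m n = (\<Sum>(s, t)\<in>{..R} \<times> {..R}. c s t \<bullet>x (Y - Z) (m - int s) (n - int t))"
    by (rule act2_eq[where N = L]) (use M N in \<open>auto simp: L_def R_def\<close>)
  then show "act2 c (Y - Z) m n = (act2 c Y - act2 c Z) m n"
    by (simp add: Y Z sum_subtractf[symmetric] case_prod_unfold X.scale_right_diff_distrib)
qed

lemma act2_funpow_diff:
  "quadrant_finite Y \<Longrightarrow> quadrant_finite Z \<Longrightarrow> (act2 c ^^ k) (Y - Z) = (act2 c ^^ k) Y - (act2 c ^^ k) Z"
  by (induction k) (simp_all only: funpow.simps id_apply comp_apply act2_diff quadrant_finite_act2_funpow)

lemma act2_uminus_coeff:
  "act2 (\<lambda>s t. - c s t) Y = - act2 c Y"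
proof (intro ext)
  fix m n
  have "{a. (case a of (s, t) \<Rightarrow> - c s t \<bullet>x Y (m - int s) (n - int t)) \<noteq> 0} =
    {a. (case a of (s, t) \<Rightarrow> c s t \<bullet>x Y (m - int s) (n - int t)) \<noteq> 0}" by auto
  then show "act2 (\<lambda>s t. - c s t) Y m n = (- act2 c Y) m n"
    unfolding act2_def Sum_any.expand_set fun_Compl_def
    by (simp add: sum_negf[symmetric] case_prod_unfold)
qed

text \<open>At a minimal point of the support only the coefficient \<open>c 0 0\<close> contributes.\<close>

lemma act2_eq_0_imp:
  assumes "quadrant_finite Y" "c 0 0 \<noteq> 0" "act2 c Y = 0"
  shows "Y = 0"
proof (intro ext)
  fix m n
  obtain N where N: "\<And>i j. i \<le> m \<Longrightarrow> j \<le> n \<Longrightarrow> i < N \<or> j < N \<Longrightarrow> Y i j = 0"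
    using assms(1) by (rule quadrant_finiteE[where m = m and n = n]) blast
  have "i \<le> m \<Longrightarrow> j \<le> n \<Longrightarrow> Y i j = 0" for i j
  proof (induction "nat (i - N) + nat (j - N)" arbitrary: i j rule: less_induct)
    case less
    show ?case
    proof (cases "i < N \<or> j < N")
      case True
      then show ?thesis using N less.prems by blast
    next
      case False
      define R where "R = max (nat (i - N)) (nat (j - N))"
      have "0 = act2 c Y i j" using assms(3) by simp
      also have "\<dots> = (\<Sum>(s, t)\<in>{..R} \<times> {..R}. c s t \<bullet>x Y (i - int s) (j - int t))"
        by (rule act2_eq[where N = N]) (use N less.prems in \<open>auto simp: R_def\<close>)
      also have "\<dots> = (\<Sum>z\<in>{..R} \<times> {..R}. if z = (0, 0) then c 0 0 \<bullet>x Y i j else 0)"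
      proof (rule sum.cong, rule refl, clarify)
        fix s t
        show "c s t \<bullet>x Y (i - int s) (j - int t) = (if (s, t) = (0, 0) then c 0 0 \<bullet>x Y i j else 0)"
        proof (cases "s = 0 \<and> t = 0")
          case False
          have "Y (i - int s) (j - int t) = 0"
          proof (cases "i - int s < N \<or> j - int t < N")
            case True
            then show ?thesis using N[of "i - int s" "j - int t"] less.prems by auto
          next
            case False
            then have "nat (i - int s - N) + nat (j - int t - N) < nat (i - N) + nat (j - N)"
              using \<open>\<not> (s = 0 \<and> t = 0)\<close> by auto
            then show ?thesis using less.prems by (intro less.hyps) auto
          qed
          then show ?thesis using False by auto
        qed auto
      qed
      also have "\<dots> = c 0 0 \<bullet>x Y i j" by (simp add: sum.delta)
      finally show ?thesis using assms(2) by auto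
    qed
  qed
  then show "Y m n = 0 m n" by simp
qed

definition swap_vars :: "(int \<Rightarrow> int \<Rightarrow> 'b) \<Rightarrow> int \<Rightarrow> int \<Rightarrow> 'b"
  where "swap_vars Y = (\<lambda>m n. Y n m)"

lemma quadrant_finite_swap_vars: "quadrant_finite Y \<Longrightarrow> quadrant_finite (swap_vars Y)"
  unfolding quadrant_finite_def swap_vars_def by metis

lemma act2_swap_vars: "act2 c (swap_vars Y) = swap_vars (act2 (\<lambda>s t. c t s) Y)"
proof (intro ext)
  fix m n
  have "act2 c (swap_vars Y) m n = Sum_any ((\<lambda>(s, t). c t s \<bullet>x Y (n - int s) (m - int t)) \<circ> prod.swap)"
    by (simp add: act2_def swap_vars_def comp_def case_prod_unfold)
  also have "\<dots> = swap_vars (act2 (\<lambda>s t. c t s) Y) m n"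
    unfolding act2_def swap_vars_def
    by (rule Sum_any.reindex_cong[symmetric, where l = prod.swap]) (auto simp: bij_swap)
  finally show "act2 c (swap_vars Y) m n = swap_vars (act2 (\<lambda>s t. c t s) Y) m n" .
qed

lemma act2_funpow_swap_vars: "(act2 c ^^ k) (swap_vars Y) = swap_vars ((act2 (\<lambda>s t. c t s) ^^ k) Y)"
  by (induction k) (simp_all add: act2_swap_vars)

abbreviation phi_coeff :: "nat \<Rightarrow> complex fls"
  where "phi_coeff i \<equiv> fls_monom (flow_coeff \<epsilon> 1 i) (1 + int i * (\<epsilon> - 1))"

definition "coeff_phi1_phi2 s t = (if t = 0 then phi_coeff s else 0) - (if s = 0 then phi_coeff t else 0)"
text \<open>\<open>phi_coeff 0\<close> is x.\<close>

definition "coeff_phi1_x s t = (if t = 0 then phi_coeff s else 0) - (if s = 0 \<and> t = 0 then phi_coeff 0 else 0)"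
definition "coeff_phi2_x s t = (if s = 0 then phi_coeff t else 0) - (if s = 0 \<and> t = 0 then phi_coeff 0 else 0)"
definition coeff_z1_z2 :: "nat \<Rightarrow> nat \<Rightarrow> complex fls"
  where "coeff_z1_z2 s t = (if s = 1 \<and> t = 0 then 1 else 0) - (if s = 0 \<and> t = 1 then 1 else 0)"

lemma act2_mult_diff:
  assumes "quadrant_finite Y"
  shows "act2 coeff_z1_z2 Y = mult_diff Y"
proof (intro ext)
  fix m n
  obtain N where N: "\<And>i j. i \<le> m \<Longrightarrow> j \<le> n \<Longrightarrow> i < N \<or> j < N \<Longrightarrow> Y i j = 0"
    using assms by (rule quadrant_finiteE[where m = m and n = n]) blast
  define R where "R = max 1 (max (nat (m - N)) (nat (n - N)))"
  have "act2 coeff_z1_z2 Y m n = (\<Sum>(s, t)\<in>{..R} \<times> {..R}. coeff_z1_z2 s t \<bullet>x Y (m - int s) (n - int t))"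
    by (rule act2_eq[OF N]) (auto simp: R_def)
  also have "\<dots> = (\<Sum>z\<in>{..R} \<times> {..R}. (if z = (1, 0) then Y (m - 1) n else 0) - (if z = (0, 1) then Y m (n - 1) else 0))"
    by (rule sum.cong) (auto simp: coeff_z1_z2_def X.scale_left_diff_distrib split: if_splits)
  also have "\<dots> = mult_diff Y m n"
    by (simp add: sum_subtractf mult_diff_def R_def)
  finally show "act2 coeff_z1_z2 Y m n = mult_diff Y m n" .
qed

lemma quadrant_finite_mult_diff: "quadrant_finite Y \<Longrightarrow> quadrant_finite (mult_diff Y)"
  by (metis act2_mult_diff quadrant_finite_act2)

lemma phi_coeff_1_neq_0: "phi_coeff 1 \<noteq> 0"
proof -
  have "phi_coeff 1 $$ (1 + int 1 * (\<epsilon> - 1)) \<noteq> 0" unfolding fls_monom_nth by (simp add: flow_coeff_def)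
  then show ?thesis by auto
qed

lemma act2_eq_nested:
  assumes N: "\<And>i j. i \<le> m \<Longrightarrow> j \<le> n \<Longrightarrow> i < N \<or> j < N \<Longrightarrow> Y i j = 0"
    and R: "nat (m - N) \<le> R" "nat (n - N) \<le> R"
  shows "act2 c Y m n = (\<Sum>s\<le>R. \<Sum>t\<le>R. c s t \<bullet>x Y (m - int s) (n - int t))"
proof -
  have "act2 c Y m n = (\<Sum>(s, t)\<in>{..R} \<times> {..R}. c s t \<bullet>x Y (m - int s) (n - int t))"
    by (rule act2_eq[where N = N]) (use assms in auto)
  then show ?thesis by (simp only: sum.cartesian_product)
qed

lemma act2_phi_coeff:
  assumes N: "\<And>i j. i \<le> m \<Longrightarrow> j \<le> n \<Longrightarrow> i < N \<or> j < N \<Longrightarrow> Y i j = 0"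
    and R: "nat (m - N) \<le> R" "nat (n - N) \<le> R"
  defines "f \<equiv> \<lambda>s t. phi_coeff (s + t) \<bullet>x Y (m - int s) (n - int t)"
  shows "act2 coeff_phi1_phi2 Y m n = (\<Sum>s\<le>R. f s 0) - (\<Sum>t\<le>R. f 0 t)"
    and "act2 coeff_phi1_x Y m n = (\<Sum>s\<le>R. f s 0) - f 0 0"
    and "act2 coeff_phi2_x Y m n = (\<Sum>t\<le>R. f 0 t) - f 0 0"
proof -
  have eq: "act2 c Y m n = (\<Sum>s\<le>R. \<Sum>t\<le>R. c s t \<bullet>x Y (m - int s) (n - int t))" for c
    by (rule act2_eq_nested[where N = N]) (use N R in auto)
  have "coeff_phi1_phi2 s t \<bullet>x Y (m - int s) (n - int t) =
      (if t = 0 then f s 0 else 0) - (if s = 0 then f 0 t else 0)" for s t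
    by (simp add: coeff_phi1_phi2_def f_def X.scale_left_diff_distrib)
  then have "act2 coeff_phi1_phi2 Y m n =
      (\<Sum>s\<le>R. \<Sum>t\<le>R. if t = 0 then f s 0 else 0) - (\<Sum>t\<le>R. \<Sum>s\<le>R. if s = 0 then f 0 t else 0)"
    unfolding eq by (simp only: sum_subtractf) (subst (2) sum.swap, rule refl)
  then show "act2 coeff_phi1_phi2 Y m n = (\<Sum>s\<le>R. f s 0) - (\<Sum>t\<le>R. f 0 t)" by simp
  have "coeff_phi1_x s t \<bullet>x Y (m - int s) (n - int t) =
      (if t = 0 then f s 0 - (if s = 0 then f 0 0 else 0) else 0)" for s t
    by (simp add: coeff_phi1_x_def f_def X.scale_left_diff_distrib)
  then show "act2 coeff_phi1_x Y m n = (\<Sum>s\<le>R. f s 0) - f 0 0"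
    unfolding eq by (simp add: sum_subtractf)
  have "coeff_phi2_x s t \<bullet>x Y (m - int s) (n - int t) =
      (if s = 0 then f 0 t - (if t = 0 then f 0 0 else 0) else 0)" for s t
    by (simp add: coeff_phi2_x_def f_def X.scale_left_diff_distrib)
  then have "act2 coeff_phi2_x Y m n =
      (\<Sum>t\<le>R. \<Sum>s\<le>R. if s = 0 then f 0 t - (if t = 0 then f 0 0 else 0) else 0)"
    unfolding eq by (simp only:) (rule sum.swap)
  then show "act2 coeff_phi2_x Y m n = (\<Sum>t\<le>R. f 0 t) - f 0 0"
    by (simp add: sum_subtractf)
qed

text \<open>\<open>\<phi>(x, z\<^sub>1) - \<phi>(x, z\<^sub>2)\<close> is \<open>z\<^sub>1 - z\<^sub>2\<close> times a unit.\<close>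

lemma act2_phi1_phi2:
  assumes "quadrant_finite Y"
  shows "act2 coeff_phi1_phi2 Y = act2 (\<lambda>s t. phi_coeff (s + t + 1)) (mult_diff Y)"
proof (intro ext)
  fix m n
  obtain N where N: "\<And>i j. i \<le> m \<Longrightarrow> j \<le> n \<Longrightarrow> i < N \<or> j < N \<Longrightarrow> Y i j = 0"
    using assms by (rule quadrant_finiteE[where m = m and n = n]) blast
  define R where "R = max (nat (m - N)) (nat (n - N))"
  have R: "nat (m - N) \<le> R" "nat (n - N) \<le> R" by (simp_all add: R_def)
  define f where "f s t = phi_coeff (s + t) \<bullet>x Y (m - int s) (n - int t)" for s t
  have "Y (m - int (Suc R)) (n - int t) = 0" "Y (m - int s) (n - int (Suc R)) = 0" for s t
    using R by (auto intro!: N)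
  then have f0: "f (Suc R) t = 0" "f s (Suc R) = 0" for s t
    unfolding f_def by (simp_all only: X.scale_zero_right)
  have sh: "(\<Sum>s\<le>R. h (Suc s)) = (\<Sum>s\<le>R. h s) - h 0" if "h (Suc R) = 0" for h :: "nat \<Rightarrow> 'w fls"
    using that sum.atMost_Suc_shift[of h R] by simp
  \<comment> \<open>The unit comes from z_1^r - z_2^r = (z_1 - z_2) times the sum of z_1^s z_2^t
    over s + t = r - 1; its constant term \<open>phi_coeff 1\<close> is x^\<epsilon>.\<close>
  have "act2 (\<lambda>s t. phi_coeff (s + t + 1)) (mult_diff Y) m n =
      (\<Sum>s\<le>R. \<Sum>t\<le>R. phi_coeff (s + t + 1) \<bullet>x mult_diff Y (m - int s) (n - int t))"
    by (rule act2_eq_nested[where N = N]) (use N R in \<open>auto simp: mult_diff_def\<close>)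
  also have "\<dots> = (\<Sum>s\<le>R. \<Sum>t\<le>R. f (Suc s) t - f s (Suc t))"
    by (intro sum.cong refl)
       (simp add: f_def mult_diff_def X.scale_right_diff_distrib diff_diff_eq add.commute)
  also have "\<dots> = (\<Sum>t\<le>R. \<Sum>s\<le>R. f (Suc s) t) - (\<Sum>s\<le>R. \<Sum>t\<le>R. f s (Suc t))"
    unfolding sum_subtractf by (subst sum.swap) (rule refl)
  also have "\<dots> = (\<Sum>t\<le>R. (\<Sum>s\<le>R. f s t) - f 0 t) - (\<Sum>s\<le>R. (\<Sum>t\<le>R. f s t) - f s 0)"
  proof -
    have "(\<Sum>s\<le>R. f (Suc s) t) = (\<Sum>s\<le>R. f s t) - f 0 t" for t by (rule sh) (rule f0)
    moreover have "(\<Sum>t\<le>R. f s (Suc t)) = (\<Sum>t\<le>R. f s t) - f s 0" for s by (rule sh) (rule f0)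
    ultimately show ?thesis by simp
  qed
  also have "\<dots> = (\<Sum>s\<le>R. f s 0) - (\<Sum>t\<le>R. f 0 t)"
    unfolding sum_subtractf by (subst sum.swap) simp
  also have "\<dots> = act2 coeff_phi1_phi2 Y m n"
    unfolding f_def by (rule act2_phi_coeff(1)[symmetric]) (use N R in auto)
  finally show "act2 coeff_phi1_phi2 Y m n = act2 (\<lambda>s t. phi_coeff (s + t + 1)) (mult_diff Y) m n"
    by simp
qed

text \<open>Only the unit is removed. The factor z_1 - z_2 cannot be, since the formal delta series
  is \<open>quadrant_finite\<close> and is annihilated by it.\<close>

lemma act2_phi1_phi2_funpow_eq_0:
  "quadrant_finite Y \<Longrightarrow> (act2 coeff_phi1_phi2 ^^ k) Y = 0 \<Longrightarrow> (mult_diff ^^ k) Y = 0"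
proof (induction k arbitrary: Y)
  case (Suc k)
  let ?Z = "(act2 coeff_phi1_phi2 ^^ k) Y"
  have Z: "quadrant_finite ?Z" by (rule quadrant_finite_act2_funpow) fact
  have "act2 (\<lambda>s t. phi_coeff (s + t + 1)) (mult_diff ?Z) = 0"
    using Suc.prems(2) by (simp only: act2_phi1_phi2[OF Z, symmetric] funpow.simps comp_apply)
  then have "mult_diff ?Z = 0"
    by (rule act2_eq_0_imp[rotated 2])
       (use quadrant_finite_mult_diff[OF Z] phi_coeff_1_neq_0 in simp_all)
  then have "(act2 coeff_phi1_phi2 ^^ k) (mult_diff Y) = 0"
    by (simp only: act2_mult_diff[symmetric] Z Suc.prems(1) act2_funpow_commute)
  then have "(mult_diff ^^ k) (mult_diff Y) = 0"
    by (rule Suc.IH[OF quadrant_finite_mult_diff[OF Suc.prems(1)]])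
  then show ?case by (simp only: funpow_Suc_right comp_apply)
qed simp

text \<open>\<phi>(x, z_1) - x is z_1 times a unit, and multiplication by z_1 only shifts the
  exponent. So here, unlike for z_1 - z_2, the whole factor cancels.\<close>

lemma act2_phi1_x_eq_0:
  assumes "quadrant_finite Y" "act2 coeff_phi1_x Y = 0"
  shows "Y = 0"
proof -
  define Z where "Z = (\<lambda>m n. Y (m - 1) n)"
  have Z: "quadrant_finite Z"
    unfolding quadrant_finite_def
  proof (intro allI)
    fix m n
    obtain N where N: "\<And>i j. i \<le> m \<Longrightarrow> j \<le> n \<Longrightarrow> i < N \<or> j < N \<Longrightarrow> Y i j = 0"
      using assms(1) by (rule quadrant_finiteE[where m = m and n = n]) blast
    then have "\<forall>i j. i \<le> m \<and> j \<le> n \<and> (i < N \<or> j < N) \<longrightarrow> Z i j = 0" by (auto simp: Z_def)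
    then show "\<exists>N. \<forall>i j. i \<le> m \<and> j \<le> n \<and> (i < N \<or> j < N) \<longrightarrow> Z i j = 0" ..
  qed
  have "act2 (\<lambda>s t. if t = 0 then phi_coeff (s + 1) else 0) Z = act2 coeff_phi1_x Y"
  proof (intro ext)
    fix m n
    obtain N where N: "\<And>i j. i \<le> m \<Longrightarrow> j \<le> n \<Longrightarrow> i < N \<or> j < N \<Longrightarrow> Y i j = 0"
      using assms(1) by (rule quadrant_finiteE[where m = m and n = n]) blast
    define R where "R = max (nat (m - N)) (nat (n - N))"
    define f where "f s = phi_coeff s \<bullet>x Y (m - int s) n" for s
    have "m - N \<le> int R" by (auto simp: R_def)
    then have "Y (m - int (Suc R)) n = 0" by (auto intro!: N)
    then have f0: "f (Suc R) = 0" by (simp only: f_def X.scale_zero_right)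
    have "act2 (\<lambda>s t. if t = 0 then phi_coeff (s + 1) else 0) Z m n =
        (\<Sum>s\<le>R. \<Sum>t\<le>R. (if t = 0 then phi_coeff (s + 1) else 0) \<bullet>x Z (m - int s) (n - int t))"
      by (rule act2_eq_nested[where N = N]) (use N in \<open>auto simp: R_def Z_def\<close>)
    also have "\<dots> = (\<Sum>s\<le>R. \<Sum>t\<le>R. if t = 0 then f (Suc s) else 0)"
      by (intro sum.cong refl) (auto simp: f_def Z_def diff_diff_eq add.commute)
    also have "\<dots> = (\<Sum>s\<le>R. f (Suc s))" by simp
    also have "\<dots> = (\<Sum>s\<le>R. f s) - f 0"
      using sum.atMost_Suc_shift[of f R] f0 by simp
    also have "\<dots> = act2 coeff_phi1_x Y m n"
    proof -
      have "act2 coeff_phi1_x Y m n = (\<Sum>s\<le>R. phi_coeff (s + 0) \<bullet>x Y (m - int s) (n - int 0)) -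
          phi_coeff (0 + 0) \<bullet>x Y (m - int 0) (n - int 0)"
        by (rule act2_phi_coeff(2)[where N = N]) (use N in \<open>auto simp: R_def\<close>)
      then show ?thesis by (simp add: f_def)
    qed
    finally show "act2 (\<lambda>s t. if t = 0 then phi_coeff (s + 1) else 0) Z m n = act2 coeff_phi1_x Y m n" .
  qed
  then have "act2 (\<lambda>s t. if t = 0 then phi_coeff (s + 1) else 0) Z = 0"
    using assms(2) by (simp only:)
  then have "Z = 0"
    by (rule act2_eq_0_imp[rotated 2]) (use Z phi_coeff_1_neq_0 in simp_all)
  then have "Z (m + 1) n = 0" for m n by (simp only: zero_fun_apply)
  then show "Y = 0" by (simp add: Z_def fun_eq_iff)
qed

lemma act2_phi2_x_eq_0:
  assumes "quadrant_finite Y" "act2 coeff_phi2_x Y = 0"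
  shows "Y = 0"
proof -
  have c: "coeff_phi1_x = (\<lambda>s t. coeff_phi2_x t s)"
    by (auto simp: coeff_phi1_x_def coeff_phi2_x_def fun_eq_iff)
  have "act2 coeff_phi1_x (swap_vars Y) = swap_vars (act2 coeff_phi2_x Y)"
    unfolding act2_swap_vars c ..
  also have "\<dots> = 0" unfolding assms(2) by (simp add: swap_vars_def fun_eq_iff)
  finally have "swap_vars Y = 0"
    by (rule act2_phi1_x_eq_0[OF quadrant_finite_swap_vars[OF assms(1)]])
  then show ?thesis unfolding swap_vars_def fun_eq_iff by auto
qed

lemma act2_phi1_x_funpow_eq_0: "quadrant_finite Y \<Longrightarrow> (act2 coeff_phi1_x ^^ l) Y = 0 \<Longrightarrow> Y = 0"
  by (induction l) (simp, metis act2_phi1_x_eq_0 comp_apply funpow.simps(2) quadrant_finite_act2_funpow)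

lemma act2_phi2_x_funpow_eq_0: "quadrant_finite Y \<Longrightarrow> (act2 coeff_phi2_x ^^ l) Y = 0 \<Longrightarrow> Y = 0"
  by (induction l) (simp, metis act2_phi2_x_eq_0 comp_apply funpow.simps(2) quadrant_finite_act2_funpow)

end

text \<open>Only the finitely many rows between N and n need a bound of their own, and the minimum
  serves for all.\<close>

lemma uniform_lower_bound:
  fixes P :: "int \<Rightarrow> int \<Rightarrow> bool"
  assumes "\<And>n. \<exists>M. \<forall>j<M. P n j" and N: "\<And>n j. n < N \<Longrightarrow> P n j"
  shows "\<exists>M. \<forall>n'\<le>n. \<forall>j<M. P n' j"
proof -
  obtain f where f: "\<And>n j. j < f n \<Longrightarrow> P n j" using assms(1) by metis
  define M where "M = Min (insert 0 (f ` {N..n}))"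
  have "P n' j" if "n' \<le> n" "j < M" for n' j
  proof (cases "n' < N")
    case False
    then have "M \<le> f n'" unfolding M_def using that by (intro Min_le) auto
    then show ?thesis using f that by auto
  qed (rule N)
  then show ?thesis by blast
qed

lemma sum_fun_apply: "(\<Sum>i\<in>I. F i) x = (\<Sum>i\<in>I. F i x)"
  by (induction I rule: infinite_finite_induct) auto

context flow_space
begin

section \<open>Iterated substitution in products of three fields\<close>

lemma bounded_from_Sub:
  assumes H: "\<And>p. bounded_from L (H p)" and H0: "\<And>p. p < L \<Longrightarrow> H p = 0"
  shows "bounded_from (min L (2 * L + n * (\<epsilon> - 1))) (\<lambda>p. Sub (H p) $$ n)"
  unfolding bounded_from_def
proof (intro conjI allI impI)
  fix p assume "p < min L (2 * L + n * (\<epsilon> - 1))"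
  then show "Sub (H p) $$ n = 0" by (simp add: H0 Sub_zero)
next
  fix p j assume "j < min L (2 * L + n * (\<epsilon> - 1))"
  then show "Sub (H p) $$ n $$ j = 0" by (subst Sub_nth[OF H order_refl]) auto
qed

text \<open>Boundedness in all three variables makes every coefficient one finite double sum, in
  which the order of summation can be exchanged.\<close>

lemma Sub_Sub_swap:
  assumes H: "\<And>p q. p < L \<or> q < L \<Longrightarrow> H p q = 0" and Hj: "\<And>p q j. j < L \<Longrightarrow> H p q $$ j = 0"
  shows "Sub (\<lambda>p. Sub (H p) $$ n) $$ m = Sub (\<lambda>q. Sub (\<lambda>p. H p q) $$ m) $$ n"
proof -
  \<comment> \<open>A lower bound valid both before and after either of the two single
    substitutions.\<close>
  define K where "K = min L (min (2 * L + n * (\<epsilon> - 1)) (2 * L + m * (\<epsilon> - 1)))"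
  have KL: "K \<le> L" by (simp add: K_def)
  have H': "p < K \<or> q < K \<Longrightarrow> H p q = 0" for p q using H KL by auto
  have Hj': "j < K \<Longrightarrow> H p q $$ j = 0" for p q j using Hj KL by auto
  have b: "bounded_from K (H p)" "bounded_from K (\<lambda>p. H p q)" for p q
    using H' Hj' by (auto simp: bounded_from_def)
  have B1: "bounded_from K (\<lambda>p. Sub (H p) $$ n)" and B2: "bounded_from K (\<lambda>q. Sub (\<lambda>p. H p q) $$ m)"
    by (rule bounded_from_mono[OF bounded_from_Sub[where L = L]];
        use H Hj in \<open>auto simp: K_def bounded_from_def fun_eq_iff\<close>)+
  have bd: "bounded (H p)" "bounded (\<lambda>p. H p q)" "bounded (\<lambda>p. Sub (H p) $$ n)" "bounded (\<lambda>q. Sub (\<lambda>p. H p q) $$ m)"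
    for p q using b B1 B2 unfolding bounded_def by blast+
  have z: "Sub (\<lambda>p. 0) = 0" using Sub_zero by (simp only: zero_fun_def)
  show ?thesis
  proof (cases "n < 0 \<or> m < 0")
    case True
    have "Sub (\<lambda>p. Sub (H p) $$ n) $$ m = 0"
      using True by (cases "n < 0") (simp_all add: Sub_nth_neg bd z)
    moreover have "Sub (\<lambda>q. Sub (\<lambda>p. H p q) $$ m) $$ n = 0"
      using True by (cases "m < 0") (simp_all add: Sub_nth_neg bd z)
    ultimately show ?thesis by simp
  next
  case False
  show ?thesis
  proof (rule fls_eqI)
    fix j
    let ?e = "\<epsilon> - 1"
    obtain B where B: "j - m * ?e - K \<le> B" "j - n * ?e - K \<le> B" "j - m * ?e - n * ?e - K - K \<le> B"
      by (rule that[of "max (j - m * ?e - K) (max (j - n * ?e - K) (j - m * ?e - n * ?e - K - K))"]) auto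
    let ?h = "\<lambda>p q. H p q $$ (j - p - q - m * ?e - n * ?e)"
    have "Sub (\<lambda>p. Sub (H p) $$ n) $$ m $$ j =
        (\<Sum>p=K..B. scale (flow_coeff \<epsilon> p (nat m)) (Sub (H p) $$ n $$ (j - p - m * ?e)))"
      using False by (subst Sub_nth[OF B1 B(1)]) simp
    also have "\<dots> = (\<Sum>p=K..B. \<Sum>q=K..B. scale (flow_coeff \<epsilon> p (nat m) * flow_coeff \<epsilon> q (nat n)) (?h p q))"
    proof (intro sum.cong refl)
      fix p assume "p \<in> {K..B}"
      then have le: "j - p - m * ?e - n * ?e - K \<le> B" using B(3) by auto
      have e: "j - p - m * ?e - q - n * ?e = j - p - q - m * ?e - n * ?e" for q by simp
      show "scale (flow_coeff \<epsilon> p (nat m)) (Sub (H p) $$ n $$ (j - p - m * ?e)) =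
          (\<Sum>q=K..B. scale (flow_coeff \<epsilon> p (nat m) * flow_coeff \<epsilon> q (nat n)) (?h p q))"
        using False by (subst Sub_nth[OF b(1) le]) (simp add: W.scale_sum_right e)
    qed
    also have "\<dots> = (\<Sum>q=K..B. \<Sum>p=K..B. scale (flow_coeff \<epsilon> q (nat n) * flow_coeff \<epsilon> p (nat m)) (?h p q))"
      by (subst sum.swap) (simp only: mult.commute)
    also have "\<dots> = (\<Sum>q=K..B. scale (flow_coeff \<epsilon> q (nat n)) (Sub (\<lambda>p. H p q) $$ m $$ (j - q - n * ?e)))"
    proof (intro sum.cong refl)
      fix q assume "q \<in> {K..B}"
      then have le: "j - q - n * ?e - m * ?e - K \<le> B" using B(3) by auto
      have e: "j - q - n * ?e - p - m * ?e = j - p - q - m * ?e - n * ?e" for p by simp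
      show "(\<Sum>p=K..B. scale (flow_coeff \<epsilon> q (nat n) * flow_coeff \<epsilon> p (nat m)) (?h p q)) =
          scale (flow_coeff \<epsilon> q (nat n)) (Sub (\<lambda>p. H p q) $$ m $$ (j - q - n * ?e))"
        using False by (subst Sub_nth[OF b(2) le]) (simp add: W.scale_sum_right e)
    qed
    also have "\<dots> = Sub (\<lambda>q. Sub (\<lambda>p. H p q) $$ m) $$ n $$ j"
      using False by (subst Sub_nth[OF B2 B(2)]) simp
    finally show "Sub (\<lambda>p. Sub (H p) $$ n) $$ m $$ j = Sub (\<lambda>q. Sub (\<lambda>p. H p q) $$ m) $$ n $$ j" .
  qed
  qed
qed

text \<open>The family index p is the exponent of x_1. Uniformity in p is what lets a fixed power of
  z, read as a series in x_1 and x, satisfy \<open>bounded_from\<close>.\<close>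

definition unif :: "int \<Rightarrow> (int \<Rightarrow> 'w fls fls) \<Rightarrow> bool"
  where "unif N E \<longleftrightarrow> (\<forall>p. \<forall>n<N. E p $$ n = 0) \<and>
    (\<forall>n. \<exists>M. \<forall>n'\<le>n. \<forall>j<M. \<forall>p. E p $$ n' $$ j = 0)"

lemma unifD: "unif N E \<Longrightarrow> n < N \<Longrightarrow> E p $$ n = 0"
  by (simp add: unif_def)

lemma unif_phi:
  assumes "unif N E"
  shows "unif N (\<lambda>p. phi \<epsilon> \<bullet>z E p)"
  unfolding unif_def
proof (intro conjI allI impI)
  note nth = phi_act_nth[OF unifD[OF assms], OF _ order_refl]
  fix p n assume "n < N"
  then show "(phi \<epsilon> \<bullet>z E p) $$ n = 0"
    using unifD[OF assms] by (subst nth) auto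
next
  note nth = phi_act_nth[OF unifD[OF assms], OF _ order_refl]
  fix n
  obtain M where M: "\<And>n' j p. n' \<le> n \<Longrightarrow> j < M \<Longrightarrow> E p $$ n' $$ j = 0"
    using assms unfolding unif_def by blast
  define R where "R = nat (n - N)"
  have "(phi \<epsilon> \<bullet>z E p) $$ n' $$ j = 0" if n': "n' \<le> n" and j: "j < M - int R * \<bar>\<epsilon> - 1\<bar>" for n' j p
  proof -
    have "E p $$ (n' - int i) $$ (j - (1 + int i * (\<epsilon> - 1))) = 0" if i: "i \<le> nat (n' - N)" for i
    proof (rule M)
      have "int i \<le> int R" using i n' by (auto simp: R_def)
      then have "int i * \<bar>\<epsilon> - 1\<bar> \<le> int R * \<bar>\<epsilon> - 1\<bar>" by (rule mult_right_mono) simp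
      moreover have "- (int i * \<bar>\<epsilon> - 1\<bar>) \<le> int i * (\<epsilon> - 1)"
        by (metis abs_ge_minus_self abs_mult abs_of_nat minus_le_iff)
      ultimately show "j - (1 + int i * (\<epsilon> - 1)) < M" using j by linarith
    qed (use n' in auto)
    then show ?thesis by (subst nth) (auto simp: fls_nth_sum)
  qed
  then show "\<exists>M. \<forall>n'\<le>n. \<forall>j<M. \<forall>p. (phi \<epsilon> \<bullet>z E p) $$ n' $$ j = 0" by blast
qed

lemma unif_x:
  assumes "unif N E"
  shows "unif N (\<lambda>p. fls_const (fls_monom 1 1) \<bullet>z E p)"
  unfolding unif_def
proof (intro conjI allI impI)
  fix n
  obtain M where M: "\<And>n' j p. n' \<le> n \<Longrightarrow> j < M \<Longrightarrow> E p $$ n' $$ j = 0"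
    using assms unfolding unif_def by blast
  then have "\<forall>n'\<le>n. \<forall>j<M. \<forall>p. (fls_const (fls_monom 1 1) \<bullet>z E p) $$ n' $$ j = 0" by simp
  then show "\<exists>M. \<forall>n'\<le>n. \<forall>j<M. \<forall>p. (fls_const (fls_monom 1 1) \<bullet>z E p) $$ n' $$ j = 0" ..
qed (simp add: unifD[OF assms])

lemma unif_shift: "unif N E \<Longrightarrow> unif N (\<lambda>p. E (p - 1))"
  unfolding unif_def by blast

lemma unif_diff:
  assumes "unif N E" "unif N E'"
  shows "unif N (\<lambda>p. E p - E' p)"
  unfolding unif_def
proof (intro conjI allI impI)
  fix n
  obtain M where M: "\<And>n' j p. n' \<le> n \<Longrightarrow> j < M \<Longrightarrow> E p $$ n' $$ j = 0"
    using assms(1) unfolding unif_def by blast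
  obtain M' where M': "\<And>n' j p. n' \<le> n \<Longrightarrow> j < M' \<Longrightarrow> E' p $$ n' $$ j = 0"
    using assms(2) unfolding unif_def by blast
  have "\<forall>n'\<le>n. \<forall>j<min M M'. \<forall>p. (E p - E' p) $$ n' $$ j = 0" by (simp add: M M')
  then show "\<exists>M. \<forall>n'\<le>n. \<forall>j<M. \<forall>p. (E p - E' p) $$ n' $$ j = 0" ..
qed (simp add: unifD[OF assms(1)] unifD[OF assms(2)])

lemma unif_fam_phi: "unif N E \<Longrightarrow> unif N ((fam_phi ^^ k) E)"
  by (induction k) (auto simp: fam_phi_def intro!: unif_diff unif_shift unif_phi)

lemma unif_fam_x: "unif N E \<Longrightarrow> unif N ((fam_x ^^ k) E)"
  by (induction k) (auto simp: fam_x_def intro!: unif_diff unif_shift unif_x)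

lemma unif_pm: "unif N E \<Longrightarrow> unif N (\<lambda>p. pm \<bullet>z E p)"
  unfolding pm_act by (intro unif_diff unif_phi unif_x)

lemma unif_pm_power: "unif N E \<Longrightarrow> unif N (\<lambda>p. pm ^ l \<bullet>z E p)"
  by (induction l) (simp_all add: unif_pm[where E = "\<lambda>p. pm ^ _ \<bullet>z E p", simplified])

text \<open>Change of view: the coefficient of z_2^n becomes a series in x_1 and x, ready for the
  second substitution.\<close>

definition slice :: "(int \<Rightarrow> 'w fls fls) \<Rightarrow> int \<Rightarrow> int \<Rightarrow> 'w fls"
  where "slice B n = (\<lambda>p. B p $$ n)"

text \<open>Multiplication by \<phi>(x, z_2). The exponent of z_2 is the index of a bare family, so
  the sum is cut off at N, below which the family vanishes; \<open>sum_phi_arg\<close> is its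
  counterpart before the substitution for x_1.\<close>

definition sum_phi :: "int \<Rightarrow> (int \<Rightarrow> 'w fls fls) \<Rightarrow> int \<Rightarrow> 'w fls fls"
  where "sum_phi N X = (\<lambda>n. \<Sum>i\<le>nat (n - N). fls_const (phi_coeff i) \<bullet>z X (n - int i))"

definition sum_phi_arg :: "int \<Rightarrow> (int \<Rightarrow> int \<Rightarrow> 'w fls) \<Rightarrow> int \<Rightarrow> int \<Rightarrow> 'w fls"
  where "sum_phi_arg N A = (\<lambda>n. \<Sum>i\<le>nat (n - N). monom_act (flow_coeff \<epsilon> 1 i) (1 + int i * (\<epsilon> - 1)) (A (n - int i)))"

text \<open>
  Multiplication by \<open>\<phi>(x, z\<^sub>1) - \<phi>(x, z\<^sub>2)\<close>, \<open>\<phi>(x, z\<^sub>1) - x\<close> and \<open>\<phi>(x, z\<^sub>2) - x\<close> on families indexed by the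
  exponent of \<open>z\<^sub>2\<close>, which vanish below \<open>N\<close>.
\<close>

definition "mul_phi1_phi2 N X = (\<lambda>n. phi \<epsilon> \<bullet>z X n - sum_phi N X n)"
definition "mul_phi1_phi2_arg N A = (\<lambda>n. shift (A n) - sum_phi_arg N A n)"
definition mul_phi2_x :: "int \<Rightarrow> (int \<Rightarrow> 'w fls fls) \<Rightarrow> int \<Rightarrow> 'w fls fls"
  where "mul_phi2_x N X = (\<lambda>n. sum_phi N X n - fls_const (fls_monom 1 1) \<bullet>z X n)"
definition mul_phi1_x :: "(int \<Rightarrow> 'w fls fls) \<Rightarrow> int \<Rightarrow> 'w fls fls"
  where "mul_phi1_x X = (\<lambda>n. pm \<bullet>z X n)"

lemma phi_subst_mul_phi1_phi2:
  "(\<And>n. phi_subst (A n) (X n)) \<Longrightarrow> phi_subst ((mul_phi1_phi2_arg N ^^ k) A n) ((mul_phi1_phi2 N ^^ k) X n)"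
  by (induction k arbitrary: n)
     (auto simp: mul_phi1_phi2_def mul_phi1_phi2_arg_def sum_phi_def sum_phi_arg_def
       intro!: phi_subst_diff phi_subst_shift phi_subst_sum phi_subst_monom)

lemma slice_sum_phi:
  assumes "unif N B"
  shows "slice (\<lambda>p. phi \<epsilon> \<bullet>z B p) = sum_phi_arg N (slice B)"
  by (intro ext)
     (simp add: slice_def sum_phi_arg_def sum_fun_apply monom_act_def phi_act_nth[OF unifD[OF assms], OF _ order_refl])

lemma slice_fam_phi:
  assumes "unif N B"
  shows "slice (fam_phi B) = mul_phi1_phi2_arg N (slice B)"
  using slice_sum_phi[OF assms]
  by (auto simp: slice_def mul_phi1_phi2_arg_def fam_phi_def shift_def fun_eq_iff)

lemma slice_fam_phi_funpow:
  "unif N B \<Longrightarrow> slice ((fam_phi ^^ k) B) = (mul_phi1_phi2_arg N ^^ k) (slice B)"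
  by (induction k) (simp_all add: slice_fam_phi[OF unif_fam_phi])

lemma slice_fam_x: "slice (fam_x B) n = mul_diff (slice B n)"
  by (simp add: slice_def fam_x_def mul_diff_def)

lemma slice_fam_x_funpow: "slice ((fam_x ^^ l) B) n = (mul_diff ^^ l) (slice B n)"
  by (induction l) (simp_all add: slice_fam_x)

lemma bounded_slice:
  assumes "unif N E" and L: "\<And>p. p < L \<Longrightarrow> E p = 0"
  shows "bounded (slice E n)"
proof -
  obtain M where M: "\<And>n' j p. n' \<le> n \<Longrightarrow> j < M \<Longrightarrow> E p $$ n' $$ j = 0"
    using assms unfolding unif_def by blast
  have "bounded_from (min L M) (slice E n)"
    using L M by (auto simp: bounded_from_def slice_def)
  then show ?thesis by (auto simp: bounded_def)
qed

lemma bounded_sum: "(\<And>i. i \<in> I \<Longrightarrow> bounded (F i)) \<Longrightarrow> bounded (\<Sum>i\<in>I. F i)"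
  by (induction I rule: infinite_finite_induct) (auto intro: bounded_zero bounded_add)

lemma Sub_sum: "(\<And>i. i \<in> I \<Longrightarrow> bounded (F i)) \<Longrightarrow> Sub (\<Sum>i\<in>I. F i) = (\<Sum>i\<in>I. Sub (F i))"
  by (induction I rule: infinite_finite_induct) (simp_all add: Sub_zero Sub_add bounded_sum)

lemma Sub_diff: "bounded F \<Longrightarrow> bounded G \<Longrightarrow> Sub (F - G) = Sub F - Sub G"
  using Sub_add[of F "monom_act (-1) 0 G"] Sub_monom[of G "-1" 0] bounded_monom[of G "-1" 0]
  by (simp add: monom_act_neg zact_const_neg)

text \<open>Multiplication by \<phi>(x, z_2) - x involves only x and z_2, so it commutes with the
  substitution for x_1.\<close>

lemma mul_phi2_x_Sub:
  assumes "unif N E" "\<And>p. p < L \<Longrightarrow> E p = 0"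
  shows "mul_phi2_x N (\<lambda>n. Sub (slice E n)) n = Sub (slice (\<lambda>p. pm \<bullet>z E p) n)"
proof -
  have b: "bounded (slice E n)" for n
    by (rule bounded_slice[OF assms(1)]) (rule assms(2))
  define F where "F i = monom_act (flow_coeff \<epsilon> 1 i) (1 + int i * (\<epsilon> - 1)) (slice E (n - int i))" for i
  have F: "bounded (F i)" "Sub (F i) = fls_const (phi_coeff i) \<bullet>z Sub (slice E (n - int i))" for i
    unfolding F_def by (rule bounded_monom, rule b, rule Sub_monom, rule b)
  have "slice (\<lambda>p. pm \<bullet>z E p) n = slice (\<lambda>p. phi \<epsilon> \<bullet>z E p) n - monom_act 1 1 (slice E n)"
    by (rule ext) (simp add: slice_def pm_act monom_act_def)
  also have "slice (\<lambda>p. phi \<epsilon> \<bullet>z E p) n = (\<Sum>i\<le>nat (n - N). F i)"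
    unfolding slice_sum_phi[OF assms(1)] sum_phi_arg_def F_def ..
  finally have "Sub (slice (\<lambda>p. pm \<bullet>z E p) n) = Sub (\<Sum>i\<le>nat (n - N). F i) - Sub (monom_act 1 1 (slice E n))"
    by (simp only: Sub_diff bounded_sum F(1) bounded_monom b)
  also have "\<dots> = mul_phi2_x N (\<lambda>n. Sub (slice E n)) n"
    unfolding mul_phi2_x_def sum_phi_def by (simp only: Sub_sum F Sub_monom b)
  finally show ?thesis by (rule sym)
qed

lemma mul_phi2_x_funpow_Sub:
  assumes "unif N E" "\<And>p. p < L \<Longrightarrow> E p = 0"
  shows "(mul_phi2_x N ^^ l) (\<lambda>n. Sub (slice E n)) n = Sub (slice (\<lambda>p. pm ^ l \<bullet>z E p) n)"
proof -
  have "(mul_phi2_x N ^^ l) (\<lambda>n. Sub (slice E n)) = (\<lambda>n. Sub (slice (\<lambda>p. pm ^ l \<bullet>z E p) n))"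
  proof (induction l)
    case (Suc l)
    have "(mul_phi2_x N ^^ Suc l) (\<lambda>n. Sub (slice E n)) =
        mul_phi2_x N (\<lambda>n. Sub (slice (\<lambda>p. pm ^ l \<bullet>z E p) n))"
      by (simp only: funpow.simps comp_apply Suc)
    also have "\<dots> = (\<lambda>n. Sub (slice (\<lambda>p. pm \<bullet>z pm ^ l \<bullet>z E p) n))"
    proof
      fix n
      show "mul_phi2_x N (\<lambda>n. Sub (slice (\<lambda>p. pm ^ l \<bullet>z E p) n)) n =
          Sub (slice (\<lambda>p. pm \<bullet>z pm ^ l \<bullet>z E p) n)"
        by (rule mul_phi2_x_Sub[where L = L]) (simp_all add: unif_pm_power assms)
    qed
    finally show ?case by simp
  qed simp
  then show ?thesis by (rule fun_cong)
qed

lemma mul_phi1_x_funpow: "(mul_phi1_x ^^ l) X = (\<lambda>n. pm ^ l \<bullet>z X n)"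
  by (induction l) (simp_all add: mul_phi1_x_def)

text \<open>G stands for a(x_1)b(x_2)c(x)w, B for its value at x_2 = \<phi>(x, z_2), and X for the
  value of B at x_1 = \<phi>(x, z_1). Multiplication by (x_1 - x_2)^k (x_1 - x)^l (x_2 - x)^l turns
  G into H, which is bounded in all variables; each factor is followed through both
  substitutions.\<close>

lemma correlation:
  assumes rel_X: "\<And>n. phi_subst (slice B n) (X n)" and B: "unif N B" and rel_B: "\<And>p. phi_subst (G p) (B p)"
    and H: "\<And>p. H p = (mul_diff ^^ l) ((fam_monom ^^ l) ((fam_shift ^^ k) G) p)"
    and H0: "\<And>p q. p < L \<or> q < L \<Longrightarrow> H p q = 0" and Hj: "\<And>p q j. j < L \<Longrightarrow> H p q $$ j = 0"
  shows "(mul_phi2_x N ^^ l) ((mul_phi1_x ^^ l) ((mul_phi1_phi2 N ^^ k) X)) n = Sub (\<lambda>p. Sub (H p) $$ n)"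
proof -
  define C where "C = (fam_x ^^ l) ((fam_phi ^^ k) B)"
  have C: "unif N C" unfolding C_def by (intro unif_fam_x unif_fam_phi B)
  have "bounded_from L (H p)" for p using H0 Hj by (auto simp: bounded_from_def)
  then have "bounded (H p)" for p unfolding bounded_def by blast
  moreover have "phi_subst ((fam_monom ^^ l) ((fam_shift ^^ k) G) p) (C p)" for p
    unfolding C_def by (intro phi_subst_fam_x phi_subst_fam_phi rel_B)
  ultimately have pmC: "pm ^ l \<bullet>z C p = Sub (H p)" for p
    unfolding H by (intro phi_substD)
  have C0: "C p = 0" if "p < L" for p
  proof -
    have "H p = 0" using H0 that by (auto simp: fun_eq_iff)
    then have "pm ^ l \<bullet>z C p = pm ^ l \<bullet>z 0" by (simp add: pmC Sub_zero)
    then show ?thesis by (rule pm_power_cancel)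
  qed
  have sC: "slice C n = (mul_diff ^^ l) ((mul_phi1_phi2_arg N ^^ k) (slice B) n)" for n
    by (simp add: C_def slice_fam_x_funpow slice_fam_phi_funpow[OF B])
  \<comment> \<open>The second substitution. \<open>slice C n\<close> is bounded, so its value is
    taken without a further pole.\<close>
  have "pm ^ l \<bullet>z (mul_phi1_phi2 N ^^ k) X n = Sub (slice C n)" for n
    unfolding sC
    by (rule phi_substD[OF phi_subst_mul_phi1_phi2]) (use rel_X bounded_slice[OF C C0] in \<open>auto simp: sC\<close>)
  then have "(mul_phi1_x ^^ l) ((mul_phi1_phi2 N ^^ k) X) = (\<lambda>n. Sub (slice C n))"
    by (simp add: mul_phi1_x_funpow)
  then have "(mul_phi2_x N ^^ l) ((mul_phi1_x ^^ l) ((mul_phi1_phi2 N ^^ k) X)) n = Sub (slice (\<lambda>p. pm ^ l \<bullet>z C p) n)"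
    using mul_phi2_x_funpow_Sub[OF C C0] by simp
  then show ?thesis by (simp add: pmC slice_def)
qed

end

section \<open>Comparison of the two orders of a triple product\<close>

definition mul_diff23 :: "('b \<Rightarrow> int \<Rightarrow> int \<Rightarrow> 'a::ab_group_add) \<Rightarrow> 'b \<Rightarrow> int \<Rightarrow> int \<Rightarrow> 'a"
  where "mul_diff23 G = (\<lambda>p q j. G p (q - 1) j - G p q (j - 1))"

lemma mul_diff23_funpow: "(mul_diff23 ^^ k) G p q j = (mult_diff ^^ k) (G p) q j"
  by (induction k arbitrary: q j) (simp_all add: mul_diff23_def mult_diff_def)

definition swap12 :: "('b \<Rightarrow> 'c \<Rightarrow> 'd \<Rightarrow> 'a) \<Rightarrow> 'c \<Rightarrow> 'b \<Rightarrow> 'd \<Rightarrow> 'a"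
  where "swap12 G = (\<lambda>q p j. G p q j)"

text \<open>Exchanging the first two variables changes the sign of x_1 - x_2, which an even power
  does not see.\<close>

lemma mul_diff12_swap12:
  assumes "even k"
  shows "(mul_diff12 ^^ k) (swap12 G) = swap12 ((mul_diff12 ^^ k) G)"
proof (intro ext)
  fix q p j
  show "(mul_diff12 ^^ k) (swap12 G) q p j = swap12 ((mul_diff12 ^^ k) G) q p j"
    using mult_diff_funpow_swap[of k "\<lambda>p q. G p q j" q p] assms by (simp add: mul_diff12_funpow swap12_def)
qed

lemma mul_diff13_swap12: "(mul_diff13 ^^ k) (swap12 G) = swap12 ((mul_diff23 ^^ k) G)"
  by (intro ext) (simp add: mul_diff13_funpow mul_diff23_funpow swap12_def)

lemma mul_diff23_swap12: "(mul_diff23 ^^ k) (swap12 G) = swap12 ((mul_diff13 ^^ k) G)"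
  by (intro ext) (simp add: mul_diff13_funpow mul_diff23_funpow swap12_def)

lemma mul_diff23_mul_diff13: "mul_diff23 (mul_diff13 G) = mul_diff13 (mul_diff23 G)"
  by (simp add: mul_diff23_def mul_diff13_def fun_eq_iff)

lemma mul_diff12_mul_diff23: "mul_diff12 (mul_diff23 G) = mul_diff23 (mul_diff12 G)"
  by (simp add: mul_diff23_def mul_diff12_def fun_eq_iff)

lemma mul_diff23_mul_diff13_funpow_commute: "(mul_diff23 ^^ k) ((mul_diff13 ^^ l) G) = (mul_diff13 ^^ l) ((mul_diff23 ^^ k) G)"
  by (induction k) (simp_all only: funpow.simps id_apply comp_apply funpow_commute_app[of mul_diff13 mul_diff23, OF mul_diff23_mul_diff13[symmetric]])

lemma mul_diff12_mul_diff23_funpow_commute: "(mul_diff12 ^^ k) ((mul_diff23 ^^ l) G) = (mul_diff23 ^^ l) ((mul_diff12 ^^ k) G)"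
  by (induction k) (simp_all only: funpow.simps id_apply comp_apply funpow_commute_app[of mul_diff23 mul_diff12, OF mul_diff12_mul_diff23[symmetric]])

text \<open>The multiplications only read coefficients with one exponent lowered, so vanishing on a
  region closed under lowering is preserved.\<close>

lemma mul_diff_funpow_region:
  fixes G :: "int \<Rightarrow> int \<Rightarrow> int \<Rightarrow> 'a::ab_group_add"
  assumes G: "\<And>p q j. S p q j \<Longrightarrow> G p q j = 0"
    and S: "\<And>p q j. S p q j \<Longrightarrow> S (p - 1) q j \<and> S p (q - 1) j \<and> S p q (j - 1)"
  shows "S p q j \<Longrightarrow> (mul_diff12 ^^ k) G p q j = 0" "S p q j \<Longrightarrow> (mul_diff13 ^^ k) G p q j = 0"
    "S p q j \<Longrightarrow> (mul_diff23 ^^ k) G p q j = 0"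
proof -
  show "S p q j \<Longrightarrow> (mul_diff12 ^^ k) G p q j = 0"
    by (induction k arbitrary: p q j) (simp_all add: G mul_diff12_def S)
  show "S p q j \<Longrightarrow> (mul_diff13 ^^ k) G p q j = 0"
    by (induction k arbitrary: p q j) (simp_all add: G mul_diff13_def S)
  show "S p q j \<Longrightarrow> (mul_diff23 ^^ k) G p q j = 0"
    by (induction k arbitrary: p q j) (simp_all add: G mul_diff23_def S)
qed

context flow_space
begin

text \<open>Here n is the exponent of z_2 and X n a series in z_1. The array forgets this nesting,
  so that both orders of a product fit into one type.\<close>

definition series2 :: "(int \<Rightarrow> 'w fls fls) \<Rightarrow> int \<Rightarrow> int \<Rightarrow> 'w fls"
  where "series2 X = (\<lambda>m n. X n $$ m)"

lemma quadrant_finite_series2: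
  assumes X: "\<And>n. n < N \<Longrightarrow> X n = 0"
  shows "quadrant_finite (series2 X)"
  unfolding quadrant_finite_def
proof (intro allI)
  fix m n
  have "\<exists>M. \<forall>n'\<le>n. \<forall>j<M. X n' $$ j = 0"
    by (rule uniform_lower_bound[of _ N]) (use X fls_bounded in auto)
  then obtain M where M: "\<And>n' j. n' \<le> n \<Longrightarrow> j < M \<Longrightarrow> X n' $$ j = 0" by blast
  have "series2 X i j = 0" if "i \<le> m" "j \<le> n" "i < min M N \<or> j < min M N" for i j
    using that M[of j i] X[of j] by (auto simp: series2_def)
  then show "\<exists>N. \<forall>i j. i \<le> m \<and> j \<le> n \<and> (i < N \<or> j < N) \<longrightarrow> series2 X i j = 0" by blast
qed

lemma sum_phi_nth:
  assumes X: "\<And>n. n < N \<Longrightarrow> X n = 0" and "nat (n - N) \<le> R"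
  shows "sum_phi N X n $$ m = (\<Sum>t\<le>R. phi_coeff t \<bullet>x X (n - int t) $$ m)"
proof -
  have "sum_phi N X n $$ m = (\<Sum>t\<le>nat (n - N). phi_coeff t \<bullet>x X (n - int t) $$ m)"
    by (simp add: sum_phi_def fls_nth_sum)
  also have "\<dots> = (\<Sum>t\<le>R. phi_coeff t \<bullet>x X (n - int t) $$ m)"
    by (rule sum.mono_neutral_left) (use assms in auto)
  finally show ?thesis .
qed

lemma act2_series2:
  assumes X: "\<And>n. n < N \<Longrightarrow> X n = 0"
  shows "series2 (mul_phi1_phi2 N X) = act2 coeff_phi1_phi2 (series2 X)"
    and "series2 (mul_phi1_x X) = act2 coeff_phi1_x (series2 X)"
    and "series2 (mul_phi2_x N X) = act2 coeff_phi2_x (series2 X)"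
proof -
  let ?Y = "series2 X"
  have "series2 (mul_phi1_phi2 N X) m n = act2 coeff_phi1_phi2 ?Y m n \<and>
      series2 (mul_phi1_x X) m n = act2 coeff_phi1_x ?Y m n \<and>
      series2 (mul_phi2_x N X) m n = act2 coeff_phi2_x ?Y m n" for m n
  proof -
    have "quadrant_finite ?Y" by (rule quadrant_finite_series2) (rule X)
    then have "\<exists>L0. \<forall>i j. i \<le> m \<and> j \<le> n \<and> (i < L0 \<or> j < L0) \<longrightarrow> ?Y i j = 0"
      unfolding quadrant_finite_def by blast
    then obtain L0 where "\<forall>i j. i \<le> m \<and> j \<le> n \<and> (i < L0 \<or> j < L0) \<longrightarrow> ?Y i j = 0" ..
    then have L0: "\<And>i j. i \<le> m \<Longrightarrow> j \<le> n \<Longrightarrow> i < L0 \<or> j < L0 \<Longrightarrow> ?Y i j = 0" by blast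
    define L where "L = min (min L0 N) m"
    have L: "\<And>i j. i \<le> m \<Longrightarrow> j \<le> n \<Longrightarrow> i < L \<or> j < L \<Longrightarrow> ?Y i j = 0"
      using L0 by (auto simp: L_def)
    define R where "R = max (nat (m - L)) (nat (n - L))"
    have "nat (n - N) \<le> nat (n - L)" by (rule nat_mono) (simp add: L_def)
    then have R: "nat (m - L) \<le> R" "nat (n - L) \<le> R" "nat (n - N) \<le> R" unfolding R_def by linarith+
    define f where "f s t = phi_coeff (s + t) \<bullet>x ?Y (m - int s) (n - int t)" for s t
    have "X n $$ i = 0" if "i < L" for i
      using L[of i n] that by (auto simp: series2_def L_def)
    then have 1: "(phi \<epsilon> \<bullet>z X n) $$ m = (\<Sum>s\<le>R. f s 0)"
      by (subst phi_act_nth[where N = L and R = R]) (use R in \<open>auto simp: f_def series2_def\<close>)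
    have 2: "sum_phi N X n $$ m = (\<Sum>t\<le>R. f 0 t)"
      by (simp add: sum_phi_nth[OF X R(3)] f_def series2_def)
    have 3: "(fls_const (fls_monom 1 1) \<bullet>z X n) $$ m = f 0 0"
      by (simp add: f_def series2_def)
    have coeff: "act2 coeff_phi1_phi2 ?Y m n = (\<Sum>s\<le>R. f s 0) - (\<Sum>t\<le>R. f 0 t)"
      "act2 coeff_phi1_x ?Y m n = (\<Sum>s\<le>R. f s 0) - f 0 0"
      "act2 coeff_phi2_x ?Y m n = (\<Sum>t\<le>R. f 0 t) - f 0 0"
      unfolding f_def by (rule act2_phi_coeff[where N = L]; use L R in auto)+
    show ?thesis
      unfolding coeff using 1 2 3
      by (simp add: series2_def mul_phi1_phi2_def mul_phi1_x_def mul_phi2_x_def pm_act)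
  qed
  then show "series2 (mul_phi1_phi2 N X) = act2 coeff_phi1_phi2 (series2 X)"
    "series2 (mul_phi1_x X) = act2 coeff_phi1_x (series2 X)"
    "series2 (mul_phi2_x N X) = act2 coeff_phi2_x (series2 X)"
    by blast+
qed

lemma mul_low:
  assumes X: "\<And>n. n < N \<Longrightarrow> X n = 0" and "n < N"
  shows "mul_phi1_phi2 N X n = 0" "mul_phi1_x X n = 0" "mul_phi2_x N X n = 0"
  using assms by (simp_all add: mul_phi1_phi2_def mul_phi1_x_def mul_phi2_x_def sum_phi_def)

lemma act2_series2_funpow:
  assumes X: "\<And>n. n < N \<Longrightarrow> X n = 0"
  shows "series2 ((mul_phi2_x N ^^ l) ((mul_phi1_x ^^ l) ((mul_phi1_phi2 N ^^ k) X))) =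
    (act2 coeff_phi2_x ^^ l) ((act2 coeff_phi1_x ^^ l) ((act2 coeff_phi1_phi2 ^^ k) (series2 X)))"
proof -
  have 1: "(\<forall>n<N. (mul_phi1_phi2 N ^^ k) X n = 0) \<and>
      series2 ((mul_phi1_phi2 N ^^ k) X) = (act2 coeff_phi1_phi2 ^^ k) (series2 X)"
    by (induction k) (use X in \<open>simp_all add: mul_low act2_series2(1)[where N = N]\<close>)
  have 2: "(\<forall>n<N. (mul_phi1_x ^^ l) Z n = 0) \<and>
      series2 ((mul_phi1_x ^^ l) Z) = (act2 coeff_phi1_x ^^ l) (series2 Z)"
    if "\<forall>n<N. Z n = 0" for Z
    by (induction l) (use that in \<open>simp_all add: mul_low[where N = N] act2_series2(2)[where N = N]\<close>)
  have 3: "(\<forall>n<N. (mul_phi2_x N ^^ l) Z n = 0) \<and>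
      series2 ((mul_phi2_x N ^^ l) Z) = (act2 coeff_phi2_x ^^ l) (series2 Z)"
    if "\<forall>n<N. Z n = 0" for Z
    by (induction l) (use that in \<open>simp_all add: mul_low act2_series2(3)[where N = N]\<close>)
  show ?thesis
    using 1 2[of "(mul_phi1_phi2 N ^^ k) X"] 3[of "(mul_phi1_x ^^ l) ((mul_phi1_phi2 N ^^ k) X)"] by simp
qed

lemma act2_phi2_phi1_funpow:
  assumes "even k" "quadrant_finite Y"
  shows "(act2 (\<lambda>s t. coeff_phi1_phi2 t s) ^^ k) Y = (act2 coeff_phi1_phi2 ^^ k) Y"
proof -
  have c: "(\<lambda>s t. coeff_phi1_phi2 t s) = (\<lambda>s t. - coeff_phi1_phi2 s t)"
    by (auto simp: coeff_phi1_phi2_def fun_eq_iff)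
  let ?D = "act2 coeff_phi1_phi2"
  have D: "act2 (\<lambda>s t. coeff_phi1_phi2 t s) Y = 0 - ?D Y" for Y
    unfolding c act2_uminus_coeff by simp
  have zero: "?D 0 = 0" by (simp add: act2_def fun_eq_iff case_prod_unfold)
  have q0: "quadrant_finite 0" by (simp add: quadrant_finite_def)
  have two: "act2 (\<lambda>s t. coeff_phi1_phi2 t s) (act2 (\<lambda>s t. coeff_phi1_phi2 t s) Z) = ?D (?D Z)"
    if "quadrant_finite Z" for Z
    unfolding D using act2_diff[OF q0 quadrant_finite_act2[OF that], of coeff_phi1_phi2]
    by (simp only: zero diff_0 minus_minus)
  obtain j where k: "k = j + j" using assms(1) by (metis evenE mult_2)
  have "(act2 (\<lambda>s t. coeff_phi1_phi2 t s) ^^ (j + j)) Y = (?D ^^ (j + j)) Y"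
  proof (induction j)
    case (Suc j)
    then show ?case
      using two[OF quadrant_finite_act2_funpow[OF assms(2), where c = coeff_phi1_phi2 and k = "j + j"]]
      by (simp only: add_Suc add_Suc_right funpow.simps comp_apply)
  qed simp
  then show ?thesis by (simp only: k)
qed

lemma YE_fls_low:
  assumes a: "a \<in> fields\<^sub>W" and Y: "YE b c n = 0" and "compatible a (YE b c n)"
    and YF: "YE b c n \<in> fields\<^sub>W"
  shows "YE_fls a (YE b c n) w = 0"
proof -
  have "prod_fls a (YE b c n) w = 0"
    by (intro ext fls_eqI) (simp add: prod_fls_nth a YF fields_zero, simp add: Y fields_zero a)
  then show ?thesis
    using rel_YE_fls[OF a YF assms(3), of w] phi_subst_zero by (metis phi_subst_unique)
qed

text \<open>\<open>correlation\<close> for three fields, with the result expressed through h alone: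
  up to exchanging variables, h is the same for both orders of a and b.\<close>

lemma Y_E_triple:
  fixes w
  assumes F: "a \<in> fields\<^sub>W" "b \<in> fields\<^sub>W" "c \<in> fields\<^sub>W"
    and bc: "compatible b c" and abc: "\<And>n. compatible a (YE b c n)"
    and h: "\<And>p q j. h p q j = (mul_diff23 ^^ l) ((mul_diff13 ^^ l) ((mul_diff12 ^^ k) (\<lambda>p q j. a (b (c w j) q) p))) p q j"
    and h0: "\<And>p q j. p < L \<or> q < L \<or> j < L \<Longrightarrow> h p q j = 0"
  defines "Y \<equiv> series2 (\<lambda>n. YE_fls a (YE b c n) w)"
  shows "quadrant_finite Y"
    and "(act2 coeff_phi2_x ^^ l) ((act2 coeff_phi1_x ^^ l) ((act2 coeff_phi1_phi2 ^^ k) Y)) =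
      (\<lambda>m n. Sub (\<lambda>p. Sub (\<lambda>q. Abs_fls (h p q)) $$ n) $$ m)"
proof -
  have a0: "a 0 m = 0" for m using fields_zero F(1) .
  have YF: "YE b c n \<in> fields\<^sub>W" for n
    using Y_E_field F bc by blast
  obtain N where N: "\<forall>n<N. YE b c n = 0" using Y_E_low F bc by blast
  define X where "X n = YE_fls a (YE b c n) w" for n
  define B where "B p = fls_map (fls_map (\<lambda>v. a v p)) (YE_fls b c w)" for p
  define G where "G p = (\<lambda>q. fls_map (\<lambda>v. a v p) (prod_fls b c w q))" for p
  have map0: "fls_map (\<lambda>v. a v m) 0 = 0" for m
    by (rule fls_eqI) (simp add: a0)
  have B_nth: "B p $$ n $$ j = a (YE b c n w j) p" for p n j
    by (simp add: B_def map0 a0 YE_fls_nth F bc)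
  have G_nth: "G p q $$ j = a (b (c w j) q) p" for p q j
    by (simp add: G_def a0 prod_fls_nth F)
  have X0: "X n = 0" if "n < N" for n
    unfolding X_def by (rule YE_fls_low[OF F(1) _ abc YF]) (use N that in blast)
  have "slice B n = prod_fls a (YE b c n) w" for n
    by (intro ext fls_eqI) (simp add: slice_def B_nth prod_fls_nth F YF)
  then have rel_X: "phi_subst (slice B n) (X n)" for n
    unfolding X_def using rel_YE_fls[OF F(1) YF abc] by simp
  have rel_B: "phi_subst (G p) (B p)" for p
    unfolding G_def B_def by (intro phi_subst_map rel_YE_fls F bc) (simp_all add: fields_add fields_scale F)
  have unif: "unif N B"
    unfolding unif_def
  proof (intro conjI allI impI)
    fix p n assume "n < N"
    then show "B p $$ n = 0" using N by (intro fls_eqI) (simp add: B_nth a0)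
  next
    fix n
    have "\<exists>M. \<forall>n'\<le>n. \<forall>j<M. YE b c n' w j = 0"
    proof (rule uniform_lower_bound[of _ N])
      fix n
      obtain M where "\<And>j. j < M \<Longrightarrow> YE b c n w j = 0"
        using YF by (rule fieldsE[where w = w]) blast
      then show "\<exists>M. \<forall>j<M. YE b c n w j = 0" by blast
    qed (simp add: N)
    then obtain M where "\<forall>n'\<le>n. \<forall>j<M. YE b c n' w j = 0" ..
    then have "\<forall>n'\<le>n. \<forall>j<M. \<forall>p. B p $$ n' $$ j = 0" by (simp add: B_nth a0)
    then show "\<exists>M. \<forall>n'\<le>n. \<forall>j<M. \<forall>p. B p $$ n' $$ j = 0" ..
  qed
  define H where "H p = (mul_diff ^^ l) ((fam_monom ^^ l) ((fam_shift ^^ k) G) p)" for p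
  have H_nth: "H p q $$ j = h p q j" for p q j
    unfolding H_def h mul_diff23_funpow by (rule mul_diff_funpow_nth) (rule fam_monom_nth, rule fam_shift_nth, rule G_nth)
  have H0: "H p q = 0" if "p < L \<or> q < L" for p q
    using h0 that by (intro fls_eqI) (auto simp: H_nth)
  have Hj: "H p q $$ j = 0" if "j < L" for p q j
    using h0 that by (simp add: H_nth)
  have H: "H p = (\<lambda>q. Abs_fls (h p q))" for p
    by (intro ext) (simp add: H_nth[abs_def, symmetric] fls_nth_inverse)
  have Y: "Y = series2 X" by (simp add: Y_def X_def[abs_def])
  show "quadrant_finite Y" unfolding Y by (rule quadrant_finite_series2) (rule X0)
  have "(act2 coeff_phi2_x ^^ l) ((act2 coeff_phi1_x ^^ l) ((act2 coeff_phi1_phi2 ^^ k) Y)) =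
      series2 ((mul_phi2_x N ^^ l) ((mul_phi1_x ^^ l) ((mul_phi1_phi2 N ^^ k) X)))"
    unfolding Y by (rule act2_series2_funpow[symmetric]) (rule X0)
  also have "\<dots> = (\<lambda>m n. Sub (\<lambda>p. Sub (H p) $$ n) $$ m)"
    by (intro ext) (simp only: series2_def correlation[OF rel_X unif rel_B H_def H0 Hj])
  finally show "(act2 coeff_phi2_x ^^ l) ((act2 coeff_phi1_x ^^ l) ((act2 coeff_phi1_phi2 ^^ k) Y)) =
      (\<lambda>m n. Sub (\<lambda>p. Sub (\<lambda>q. Abs_fls (h p q)) $$ n) $$ m)"
    by (simp only: H)
qed

lemma mul_diff12_funpow_cong: "(\<And>w. (mult_diff ^^ k) (commutator a b w) = 0) \<Longrightarrow>
  (mul_diff12 ^^ k) (\<lambda>p q j. a (b (f j) q) p) = (mul_diff12 ^^ k) (\<lambda>p q j. b (a (f j) p) q)"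
proof (intro ext)
  fix p q j
  assume "\<And>w. (mult_diff ^^ k) (commutator a b w) = 0"
  moreover have "commutator a b (f j) = (\<lambda>p q. a (b (f j) q) p) - (\<lambda>p q. b (a (f j) p) q)"
    by (simp add: commutator_def fun_eq_iff)
  ultimately have "(mult_diff ^^ k) (\<lambda>p q. a (b (f j) q) p) = (mult_diff ^^ k) (\<lambda>p q. b (a (f j) p) q)"
    by (metis mult_diff_funpow_diff right_minus_eq)
  then show "(mul_diff12 ^^ k) (\<lambda>p q j. a (b (f j) q) p) p q j = (mul_diff12 ^^ k) (\<lambda>p q j. b (a (f j) p) q) p q j"
    unfolding mul_diff12_funpow by simp
qed

lemma mult_diff_funpow_apply_field:
  assumes b: "b \<in> fields\<^sub>W" and "\<And>w. (mult_diff ^^ l) (commutator a c w) = 0"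
  shows "(mult_diff ^^ l) (\<lambda>p j. b (a (c w j) p) q) p j = (mult_diff ^^ l) (\<lambda>p j. b (c (a w p) j) q) p j"
proof -
  have "commutator a c w = (\<lambda>p j. a (c w j) p) - (\<lambda>p j. c (a w p) j)"
    by (simp add: commutator_def fun_eq_iff)
  then have "(mult_diff ^^ l) (\<lambda>p j. a (c w j) p) = (mult_diff ^^ l) (\<lambda>p j. c (a w p) j)"
    by (metis assms(2) mult_diff_funpow_diff right_minus_eq)
  then show ?thesis
    using mult_diff_funpow_additive[of "\<lambda>v. b v q" l "\<lambda>p j. a (c w j) p" p j]
      mult_diff_funpow_additive[of "\<lambda>v. b v q" l "\<lambda>p j. c (a w p) j" p j]
    by (simp add: fields_minus[OF b])
qed

text \<open>Locality allows any of the three fields to act first on w: c in the given order gives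
  the bound on j, a after passing b and c the bound on p, and b after passing c the bound on
  q.\<close>

lemma triple_bounded:
  assumes F: "a \<in> fields\<^sub>W" "b \<in> fields\<^sub>W" "c \<in> fields\<^sub>W"
    and ab: "\<And>w. (mult_diff ^^ k) (commutator a b w) = 0"
    and ac: "\<And>w. (mult_diff ^^ l) (commutator a c w) = 0"
    and bc: "\<And>w. (mult_diff ^^ l) (commutator b c w) = 0"
  shows "\<exists>L. \<forall>p q j. p < L \<or> q < L \<or> j < L \<longrightarrow>
    (mul_diff23 ^^ l) ((mul_diff13 ^^ l) ((mul_diff12 ^^ k) (\<lambda>p q j. a (b (c w j) q) p))) p q j = 0"
proof -
  let ?G = "\<lambda>p q j. a (b (c w j) q) p"
  let ?h = "(mul_diff23 ^^ l) ((mul_diff13 ^^ l) ((mul_diff12 ^^ k) ?G))"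
  obtain La where La: "\<And>n. n < La \<Longrightarrow> a w n = 0" using F(1) by (rule fieldsE[where w = w]) blast
  obtain Lb where Lb: "\<And>n. n < Lb \<Longrightarrow> b w n = 0" using F(2) by (rule fieldsE[where w = w]) blast
  obtain Lc where Lc: "\<And>n. n < Lc \<Longrightarrow> c w n = 0" using F(3) by (rule fieldsE[where w = w]) blast
  have j: "?h p q j = 0" if "j < Lc" for p q j
    using that
    by (intro mul_diff_funpow_region[where S = "\<lambda>p q j. j < Lc"]) (auto simp: Lc fields_zero F)
  have "?h = (mul_diff23 ^^ l) ((mul_diff13 ^^ l) ((mul_diff12 ^^ k) (\<lambda>p q j. b (a (c w j) p) q)))"
    using mul_diff12_funpow_cong[OF ab, of "c w"] by simp
  also have "\<dots> = (mul_diff23 ^^ l) ((mul_diff12 ^^ k) ((mul_diff13 ^^ l) (\<lambda>p q j. b (a (c w j) p) q)))"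
    by (simp only: mul_diff12_mul_diff13_funpow_commute)
  also have "(mul_diff13 ^^ l) (\<lambda>p q j. b (a (c w j) p) q) = (mul_diff13 ^^ l) (\<lambda>p q j. b (c (a w p) j) q)"
    by (intro ext) (simp only: mul_diff13_funpow mult_diff_funpow_apply_field[OF F(2) ac])
  finally have p: "?h p q j = 0" if "p < La" for p q j
    using that
    by (simp only:, intro mul_diff_funpow_region[where S = "\<lambda>p q j. p < La"]) (auto simp: La fields_zero F)
  have "?h = (mul_diff13 ^^ l) ((mul_diff12 ^^ k) ((mul_diff23 ^^ l) ?G))"
    by (simp only: mul_diff23_mul_diff13_funpow_commute mul_diff12_mul_diff23_funpow_commute)
  also have "(mul_diff23 ^^ l) ?G = (mul_diff23 ^^ l) (\<lambda>p q j. a (c (b w q) j) p)"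
    by (intro ext) (simp only: mul_diff23_funpow mult_diff_funpow_apply_field[OF F(1) bc])
  finally have q: "?h p q j = 0" if "q < Lb" for p q j
    using that
    by (simp only:, intro mul_diff_funpow_region[where S = "\<lambda>p q j. q < Lb"]) (auto simp: Lb fields_zero F)
  have "?h p q j = 0" if "p < min La (min Lb Lc) \<or> q < min La (min Lb Lc) \<or> j < min La (min Lb Lc)" for p q j
    using that p[of p q j] q[of q p j] j[of j p q] by auto
  then show ?thesis by blast
qed

text \<open>Up to the factors \<open>\<phi>(x, z\<^sub>i) - x\<close> and \<open>\<phi>(x, z\<^sub>1) - \<phi>(x, z\<^sub>2)\<close>, both orders of the product are the
  substitution \<open>x\<^sub>1 = \<phi>(x, z\<^sub>1)\<close>, \<open>x\<^sub>2 = \<phi>(x, z\<^sub>2)\<close> in one and the same element of \<open>W((x\<^sub>1, x\<^sub>2, x))\<close>.\<close>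

lemma Y_E_weak_commutativity:
  assumes F: "a \<in> fields\<^sub>W" "b \<in> fields\<^sub>W" "c \<in> fields\<^sub>W"
    and ab: "\<And>w. (mult_diff ^^ k) (commutator a b w) = 0" and k: "even k"
    and ac: "mutually_local UNIV a c" and bc: "mutually_local UNIV b c"
    and abc: "\<And>n. compatible a (YE b c n)" and bac: "\<And>n. compatible b (YE a c n)"
  shows "(mult_diff ^^ k) (commutator (YE a) (YE b) c) = 0"
proof (intro ext)
  fix m0 n0 w j0
  have cbc: "compatible b c" and cac: "compatible a c"
    using compatible_if_mutually_local F ac bc by blast+
  obtain la lb where "\<And>w. (mult_diff ^^ la) (commutator a c w) = 0" "\<And>w. (mult_diff ^^ lb) (commutator b c w) = 0"
    using ac bc unfolding mutually_local_iff by blast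
  then have l: "\<And>w. (mult_diff ^^ max la lb) (commutator a c w) = 0" "\<And>w. (mult_diff ^^ max la lb) (commutator b c w) = 0"
    using mult_diff_funpow_zero_mono by (meson max.cobounded1 max.cobounded2)+
  define l where "l = max la lb"
  note l = l[folded l_def]
  define h where "h = (mul_diff23 ^^ l) ((mul_diff13 ^^ l) ((mul_diff12 ^^ k) (\<lambda>p q j. a (b (c w j) q) p)))"
  obtain L where h0: "\<And>p q j. p < L \<or> q < L \<or> j < L \<Longrightarrow> h p q j = 0"
    unfolding h_def using triple_bounded[OF F ab l] by blast
  define h' where "h' = swap12 h"
  have h': "h' = (mul_diff23 ^^ l) ((mul_diff13 ^^ l) ((mul_diff12 ^^ k) (\<lambda>q p j. b (a (c w j) p) q)))"
  proof -
    have "(\<lambda>q p j. b (a (c w j) p) q) = swap12 (\<lambda>p q j. b (a (c w j) p) q)" by (simp add: swap12_def)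
    then have "(mul_diff23 ^^ l) ((mul_diff13 ^^ l) ((mul_diff12 ^^ k) (\<lambda>q p j. b (a (c w j) p) q))) =
        swap12 ((mul_diff13 ^^ l) ((mul_diff23 ^^ l) ((mul_diff12 ^^ k) (\<lambda>p q j. b (a (c w j) p) q))))"
      by (simp only: mul_diff12_swap12[OF k] mul_diff13_swap12 mul_diff23_swap12)
    then show ?thesis
      by (simp only: h'_def h_def mul_diff12_funpow_cong[OF ab] mul_diff23_mul_diff13_funpow_commute)
  qed
  have h'0: "h' p q j = 0" if "p < L \<or> q < L \<or> j < L" for p q j
    using h0[of q p j] that by (auto simp: h'_def swap12_def)
  define Y where "Y = series2 (\<lambda>n. YE_fls a (YE b c n) w)"
  define Y' where "Y' = series2 (\<lambda>n. YE_fls b (YE a c n) w)"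
  let ?P1 = "act2 coeff_phi1_x" and ?P2 = "act2 coeff_phi2_x" and ?D = "act2 coeff_phi1_phi2"
  have Y: "quadrant_finite Y"
    "(?P2 ^^ l) ((?P1 ^^ l) ((?D ^^ k) Y)) = (\<lambda>m n. Sub (\<lambda>p. Sub (\<lambda>q. Abs_fls (h p q)) $$ n) $$ m)"
    unfolding Y_def by (rule Y_E_triple[OF F cbc abc _ h0]; simp add: h_def)+
  have Y': "quadrant_finite Y'"
    "(?P2 ^^ l) ((?P1 ^^ l) ((?D ^^ k) Y')) = (\<lambda>m n. Sub (\<lambda>p. Sub (\<lambda>q. Abs_fls (h' p q)) $$ n) $$ m)"
    unfolding Y'_def by (rule Y_E_triple[OF F(2,1,3) cac bac _ h'0]; simp add: h')+
  have tY': "quadrant_finite (swap_vars Y')" using Y'(1) by (rule quadrant_finite_swap_vars)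
  have c12: "(\<lambda>s t. coeff_phi1_x t s) = coeff_phi2_x" "(\<lambda>s t. coeff_phi2_x t s) = coeff_phi1_x"
    by (auto simp: coeff_phi1_x_def coeff_phi2_x_def fun_eq_iff)
  have tt: "swap_vars (swap_vars Z) = Z" for Z :: "int \<Rightarrow> int \<Rightarrow> 'w fls" by (simp add: swap_vars_def)
  \<comment> \<open>The array of the order b, a is transported to the variables of Y; evenness of k
    absorbs the sign of \<phi>(x, z_1) - \<phi>(x, z_2).\<close>
  have "(?D ^^ k) Y' = swap_vars ((?D ^^ k) (swap_vars Y'))"
    using act2_funpow_swap_vars[where c = coeff_phi1_phi2 and k = k and Y = "swap_vars Y'"]
    by (simp only: tt act2_phi2_phi1_funpow[OF k tY'])
  moreover have "(?P2 ^^ l) ((?P1 ^^ l) (swap_vars Z)) = swap_vars ((?P1 ^^ l) ((?P2 ^^ l) Z))" for Z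
    by (simp only: act2_funpow_swap_vars c12)
  ultimately have "(?P2 ^^ l) ((?P1 ^^ l) ((?D ^^ k) Y')) =
      swap_vars ((?P1 ^^ l) ((?P2 ^^ l) ((?D ^^ k) (swap_vars Y'))))"
    by metis
  also have "\<dots> = swap_vars ((?P2 ^^ l) ((?P1 ^^ l) ((?D ^^ k) (swap_vars Y'))))"
    by (simp only: act2_funpow_funpow_commute quadrant_finite_act2_funpow tY')
  finally have "(?P2 ^^ l) ((?P1 ^^ l) ((?D ^^ k) (swap_vars Y'))) =
      (\<lambda>m n. Sub (\<lambda>q. Sub (\<lambda>p. Abs_fls (h p q)) $$ m) $$ n)"
    unfolding Y'(2) by (simp add: swap_vars_def fun_eq_iff h'_def swap12_def)
  also have "\<dots> = (\<lambda>m n. Sub (\<lambda>p. Sub (\<lambda>q. Abs_fls (h p q)) $$ n) $$ m)"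
  proof (intro ext)
    fix m n
    have nth: "Abs_fls (h p q) $$ j = h p q j" for p q j
      by (rule nth_Abs_fls_lower_bound[of L]) (simp add: h0)
    show "Sub (\<lambda>q. Sub (\<lambda>p. Abs_fls (h p q)) $$ m) $$ n = Sub (\<lambda>p. Sub (\<lambda>q. Abs_fls (h p q)) $$ n) $$ m"
      by (rule Sub_Sub_swap[symmetric, where L = L]) (auto simp: nth h0 intro!: fls_eqI)
  qed
  finally have eq: "(?P2 ^^ l) ((?P1 ^^ l) ((?D ^^ k) (swap_vars Y'))) = (?P2 ^^ l) ((?P1 ^^ l) ((?D ^^ k) Y))"
    unfolding Y(2) .
  define \<Delta> where "\<Delta> = Y - swap_vars Y'"
  have \<Delta>: "quadrant_finite \<Delta>" unfolding \<Delta>_def using Y(1) tY' by (rule quadrant_finite_diff)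
  have "(?P2 ^^ l) ((?P1 ^^ l) ((?D ^^ k) \<Delta>)) = 0"
    unfolding \<Delta>_def using eq
    by (simp only: act2_funpow_diff Y(1) tY' quadrant_finite_act2_funpow diff_self)
  \<comment> \<open>The factors \<phi>(x, z_i) - x cancel outright; the remaining one leaves (z_1 -
    z_2)^k.\<close>
  then have "(?P1 ^^ l) ((?D ^^ k) \<Delta>) = 0"
    by (rule act2_phi2_x_funpow_eq_0[rotated]) (intro quadrant_finite_act2_funpow \<Delta>)
  then have "(?D ^^ k) \<Delta> = 0"
    by (rule act2_phi1_x_funpow_eq_0[rotated]) (intro quadrant_finite_act2_funpow \<Delta>)
  then have zero: "(mult_diff ^^ k) \<Delta> = 0"
    by (rule act2_phi1_phi2_funpow_eq_0[OF \<Delta>])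
  have "YE_fls a (YE b c n) w $$ m $$ j = YE a (YE b c n) m w j"
    "YE_fls b (YE a c n) w $$ m $$ j = YE b (YE a c n) m w j" for m n j
    using YE_fls_nth Y_E_field F abc bac cac cbc by simp_all
  then have "(\<lambda>m n. commutator (YE a) (YE b) c m n w j0) = (\<lambda>m n. \<Delta> m n $$ j0)"
    by (simp add: commutator_def \<Delta>_def Y_def Y'_def series2_def swap_vars_def fun_eq_iff)
  then have "(mult_diff ^^ k) (commutator (YE a) (YE b) c) m0 n0 w j0 =
      (mult_diff ^^ k) (\<lambda>m n. \<Delta> m n $$ j0) m0 n0"
    using mult_diff_funpow_additive[of "\<lambda>v. v w j0" k "commutator (YE a) (YE b) c" m0 n0]
    by simp
  also have "\<dots> = 0"
    using mult_diff_funpow_additive[of "\<lambda>v. v $$ j0" k \<Delta> m0 n0] zero by simp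
  finally show "(mult_diff ^^ k) (commutator (YE a) (YE b) c) m0 n0 w j0 = 0 m0 n0 w j0"
    by simp
qed


section \<open>The space generated by a local set\<close>

lemma vector_space_scale_field: "vector_space (scale_field scale)"
  by unfold_locales
     (simp_all add: fun_eq_iff scale_field_nth W.scale_right_distrib W.scale_left_distrib)

sublocale E: vector_space "scale_field scale"
  by (rule vector_space_scale_field)

lemma fields_0: "0 \<in> fields\<^sub>W"
  by (simp add: fields_iff)

lemma mutually_local_zero: "c \<in> fields\<^sub>W \<Longrightarrow> mutually_local UNIV c 0"
  unfolding mutually_local_iff by (intro exI[of _ 0]) (simp add: commutator_def fields_zero fun_eq_iff)

lemma mutually_local_id: "c \<in> fields\<^sub>W \<Longrightarrow> mutually_local UNIV c id_field"
  unfolding mutually_local_iff by (intro exI[of _ 0]) (simp add: commutator_def id_field_nth fields_zero fun_eq_iff)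

lemma mutually_local_add:
  assumes c: "c \<in> fields\<^sub>W" and "mutually_local UNIV c a" "mutually_local UNIV c b"
  shows "mutually_local UNIV c (a + b)"
proof -
  obtain k l where "\<And>w. (mult_diff ^^ k) (commutator c a w) = 0" "\<And>w. (mult_diff ^^ l) (commutator c b w) = 0"
    using assms unfolding mutually_local_iff by blast
  then have "(mult_diff ^^ max k l) (commutator c a w) = 0" "(mult_diff ^^ max k l) (commutator c b w) = 0" for w
    using mult_diff_funpow_zero_mono by (meson max.cobounded1 max.cobounded2)+
  moreover have "commutator c (a + b) w = commutator c a w + commutator c b w" for w
    by (simp add: commutator_def fun_eq_iff fields_add[OF c])
  ultimately have "(mult_diff ^^ max k l) (commutator c (a + b) w) = 0" for w
    by (simp only: mult_diff_funpow_add add_0_left)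
  then show ?thesis unfolding mutually_local_iff by blast
qed

lemma mutually_local_scale:
  assumes c: "c \<in> fields\<^sub>W" and "mutually_local UNIV c a"
  shows "mutually_local UNIV c (scale_field scale t a)"
proof -
  obtain k where k: "\<And>w. (mult_diff ^^ k) (commutator c a w) = 0"
    using assms unfolding mutually_local_iff by blast
  have "(mult_diff ^^ k) (commutator c (scale_field scale t a) w) = 0" for w
  proof -
    have "commutator c (scale_field scale t a) w = scale_series (scale_series scale) t (commutator c a w)"
      by (simp add: commutator_def fun_eq_iff scale_field_nth fields_scale[OF c] scale_series_def
        W.scale_right_diff_distrib)
    then show ?thesis
      by (simp only: W.mult_diff_funpow_scale k) (simp add: scale_series_def fun_eq_iff)
  qed
  then show ?thesis unfolding mutually_local_iff by blast
qed

lemma local_subset_insert: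
  assumes "local_subset scale S" "d \<in> fields\<^sub>W" "\<And>c. c \<in> S \<Longrightarrow> mutually_local UNIV c d" "mutually_local UNIV d d"
  shows "local_subset scale (insert d S)"
  using assms mutually_local_sym unfolding local_subset_def by blast

text \<open>A maximal local set contains every field that is local with whatever is local with the
  whole set; zero, sums, multiples and products all have this property.\<close>

lemma ex_closed_local_subspace:
  assumes U: "local_subset scale U"
  shows "\<exists>V. closed_local_subspace scale \<epsilon> V \<and> U \<subseteq> V \<and> id_field \<in> V"
proof -
  define \<A> where "\<A> = {S. local_subset scale S \<and> insert id_field U \<subseteq> S}"
  have "local_subset scale (insert id_field U)"
    by (rule local_subset_insert[OF U])
       (use U id_field_fields mutually_local_id in \<open>auto simp: local_subset_def\<close>)
  then have "\<A> \<noteq> {}" by (auto simp: \<A>_def)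
  moreover have "\<Union>C \<in> \<A>" if "C \<noteq> {}" "subset.chain \<A> C" for C
  proof -
    have C: "S \<in> C \<Longrightarrow> local_subset scale S \<and> insert id_field U \<subseteq> S" for S
      using that(2) unfolding subset.chain_def \<A>_def by blast
    have "mutually_local UNIV a b" if "a \<in> \<Union>C" "b \<in> \<Union>C" for a b
    proof -
      from that obtain S T where ST: "a \<in> S" "S \<in> C" "b \<in> T" "T \<in> C" by blast
      then have "S \<subseteq> T \<or> T \<subseteq> S" using \<open>subset.chain \<A> C\<close> unfolding subset.chain_def by blast
      then show ?thesis using ST C unfolding local_subset_def by blast
    qed
    moreover have "\<Union>C \<subseteq> fields\<^sub>W" using C unfolding local_subset_def by blast
    moreover have "insert id_field U \<subseteq> \<Union>C" using C \<open>C \<noteq> {}\<close> by blast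
    ultimately show ?thesis unfolding \<A>_def local_subset_def by blast
  qed
  ultimately obtain M where M: "M \<in> \<A>" and max: "\<And>S. S \<in> \<A> \<Longrightarrow> M \<subseteq> S \<Longrightarrow> S = M"
    using subset_Zorn_nonempty[of \<A>] by blast
  have loc: "local_subset scale M" and UM: "insert id_field U \<subseteq> M" using M by (auto simp: \<A>_def)
  have F: "a \<in> fields\<^sub>W" if "a \<in> M" for a using loc that by (auto simp: local_subset_def)
  have L: "mutually_local UNIV a b" if "a \<in> M" "b \<in> M" for a b
    using loc that by (auto simp: local_subset_def)
  have in_M: "d \<in> M" if "d \<in> fields\<^sub>W" "\<And>c. c \<in> fields\<^sub>W \<Longrightarrow> (\<And>a. a \<in> M \<Longrightarrow> mutually_local UNIV c a) \<Longrightarrow> mutually_local UNIV c d" for d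
  proof -
    have d: "mutually_local UNIV c d" if "c \<in> M" for c
      using \<open>\<And>c. c \<in> fields\<^sub>W \<Longrightarrow> (\<And>a. a \<in> M \<Longrightarrow> mutually_local UNIV c a) \<Longrightarrow> mutually_local UNIV c d\<close> F[OF that] L[OF that] .
    \<comment> \<open>Since d is already local with M, the inheritance hypothesis applies to d
      itself.\<close>
    have "mutually_local UNIV d d"
      by (rule that(2)[OF that(1)]) (rule mutually_local_sym[OF d])
    then have "insert d M \<in> \<A>"
      using local_subset_insert[OF loc that(1) d] UM by (auto simp: \<A>_def)
    then show ?thesis using max[of "insert d M"] by blast
  qed
  have "E.subspace M"
    unfolding E.subspace_def
  proof (intro conjI ballI allI)
    show "0 \<in> M" by (rule in_M[OF fields_0]) (rule mutually_local_zero)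
    fix a t assume a: "a \<in> M"
    show "scale_field scale t a \<in> M"
      by (rule in_M[OF fields_scale_field[OF F[OF a]]]) (simp add: mutually_local_scale a)
    fix b assume b: "b \<in> M"
    show "a + b \<in> M"
      by (rule in_M[OF fields_plus[OF F[OF a] F[OF b]]]) (simp add: mutually_local_add a b)
  qed
  moreover have "nth_product scale \<epsilon> u n v \<in> M" if "u \<in> M" "v \<in> M" for u v n
  proof -
    have Fuv: "u \<in> fields\<^sub>W" "v \<in> fields\<^sub>W" using that by (simp_all add: F)
    have uv: "compatible u v" using that by (intro compatible_if_mutually_local Fuv L)
    show ?thesis
      unfolding nth_product_def
      by (rule in_M[OF Y_E_field[OF Fuv uv]]) (simp add: mutually_local_Y_E Fuv uv that)
  qed
  ultimately have "closed_local_subspace scale \<epsilon> M"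
    unfolding closed_local_subspace_def using loc by blast
  then show ?thesis using UM by blast
qed

text \<open>The products do not refer to the surrounding space, so the intersection of all
  admissible spaces is admissible; the existence of one such space ensures that it consists of
  fields.\<close>

lemma closed_generated:
  assumes U: "local_subset scale U"
  shows "closed_local_subspace scale \<epsilon> (generated scale \<epsilon> U)" and "id_field \<in> generated scale \<epsilon> U"
proof -
  define P where "P V \<longleftrightarrow> closed_local_subspace scale \<epsilon> V \<and> U \<subseteq> V \<and> id_field \<in> V" for V
  obtain M where M: "P M" using ex_closed_local_subspace[OF U] unfolding P_def by blast
  have "local_subset scale (\<Inter>{V. P V})"
    using M unfolding P_def closed_local_subspace_def local_subset_def by blast
  moreover have "E.subspace (\<Inter>{V. P V})"
    by (rule E.subspace_Inter) (simp add: P_def closed_local_subspace_def)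
  moreover have "\<forall>u\<in>\<Inter>{V. P V}. \<forall>v\<in>\<Inter>{V. P V}. \<forall>n. nth_product scale \<epsilon> u n v \<in> \<Inter>{V. P V}"
    unfolding P_def closed_local_subspace_def by blast
  ultimately have "closed_local_subspace scale \<epsilon> (\<Inter>{V. P V})"
    unfolding closed_local_subspace_def by blast
  moreover have "U \<subseteq> \<Inter>{V. P V}" "id_field \<in> \<Inter>{V. P V}"
    unfolding P_def by blast+
  ultimately have "P (\<Inter>{V. P V})"
    unfolding P_def[of "\<Inter>{V. P V}"] by blast
  moreover have "generated scale \<epsilon> U = \<Inter>{V. P V}"
    unfolding generated_def P_def[symmetric] using \<open>P (\<Inter>{V. P V})\<close> by (intro Least_equality) auto
  ultimately show "closed_local_subspace scale \<epsilon> (generated scale \<epsilon> U)" "id_field \<in> generated scale \<epsilon> U"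
    by (simp_all add: P_def)
qed

end

section \<open>Weak associativity\<close>

definition parity_sign :: "int \<Rightarrow> complex"
  where "parity_sign n = (if even n then 1 else - 1)"

lemma parity_sign_diff_1 [simp]: "parity_sign (n - 1) = - parity_sign n"
  by (simp add: parity_sign_def)

text \<open>Isolates what skew symmetry and associativity rest on: commutativity, creation, and a D
  that annihilates the vacuum and satisfies [D, Y(a, z)] = d/dz Y(a, z).\<close>

locale translation_covariant_field_algebra = vector_space scale
  for scale :: "complex \<Rightarrow> 'v::ab_group_add \<Rightarrow> 'v" +
  fixes V :: "'v set" and Y :: "'v \<Rightarrow> 'v \<Rightarrow> int \<Rightarrow> 'v" and vac :: 'v and D :: "'v \<Rightarrow> 'v"
  assumes subspace: "subspace V"
    and Y_in: "a \<in> V \<Longrightarrow> b \<in> V \<Longrightarrow> Y a b n \<in> V"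
    and Y_low: "a \<in> V \<Longrightarrow> b \<in> V \<Longrightarrow> \<exists>N. \<forall>n<N. Y a b n = 0"
    and Y_add: "a \<in> V \<Longrightarrow> b \<in> V \<Longrightarrow> c \<in> V \<Longrightarrow> Y a (b + c) n = Y a b n + Y a c n"
    and Y_scale: "a \<in> V \<Longrightarrow> b \<in> V \<Longrightarrow> Y a (scale t b) n = scale t (Y a b n)"
    and vac_in: "vac \<in> V"
    and creation: "a \<in> V \<Longrightarrow> n < 0 \<Longrightarrow> Y a vac n = 0" "a \<in> V \<Longrightarrow> Y a vac 0 = a"
    and D_in: "a \<in> V \<Longrightarrow> D a \<in> V"
    and D_add: "a \<in> V \<Longrightarrow> b \<in> V \<Longrightarrow> D (a + b) = D a + D b"
    and D_scale: "a \<in> V \<Longrightarrow> D (scale t a) = scale t (D a)"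
    and D_vac: "D vac = 0"
    and D_bracket: "a \<in> V \<Longrightarrow> b \<in> V \<Longrightarrow> D (Y a b n) = Y a (D b) n + scale (of_int (n + 1)) (Y a b (n + 1))"
    and commutativity: "a \<in> V \<Longrightarrow> b \<in> V \<Longrightarrow> \<exists>k. \<forall>c\<in>V. (mult_diff ^^ k) (commutator (Y a) (Y b) c) = 0"
begin

lemmas V_closed = subspace_0[OF subspace] subspace_add[OF subspace] subspace_scale[OF subspace]
  subspace_neg[OF subspace] subspace_diff[OF subspace] subspace_sum[OF subspace]

lemma Y_zero: "a \<in> V \<Longrightarrow> Y a 0 n = 0"
  using Y_scale[of a 0 0 n] V_closed(1) by simp

lemma Y_sum: "a \<in> V \<Longrightarrow> (\<And>i. i \<in> I \<Longrightarrow> f i \<in> V) \<Longrightarrow> Y a (\<Sum>i\<in>I. f i) n = (\<Sum>i\<in>I. Y a (f i) n)"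
  by (induction I rule: infinite_finite_induct) (simp_all add: Y_zero Y_add V_closed)

lemma D_zero: "D 0 = 0"
  using D_scale[of 0 0] V_closed(1) by simp

lemma D_sum: "(\<And>i. i \<in> I \<Longrightarrow> f i \<in> V) \<Longrightarrow> D (\<Sum>i\<in>I. f i) = (\<Sum>i\<in>I. D (f i))"
  by (induction I rule: infinite_finite_induct) (simp_all add: D_zero D_add V_closed)

text \<open>The coefficient of z^i in e^(zD).\<close>

definition Dpow :: "nat \<Rightarrow> 'v \<Rightarrow> 'v"
  where "Dpow i a = scale (1 / fact i) ((D ^^ i) a)"

lemma D_funpow_in: "a \<in> V \<Longrightarrow> (D ^^ i) a \<in> V"
  by (induction i) (simp_all add: D_in)

lemma D_funpow_add: "a \<in> V \<Longrightarrow> b \<in> V \<Longrightarrow> (D ^^ i) (a + b) = (D ^^ i) a + (D ^^ i) b"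
  by (induction i) (simp_all add: D_add D_funpow_in)

lemma D_funpow_scale: "a \<in> V \<Longrightarrow> (D ^^ i) (scale t a) = scale t ((D ^^ i) a)"
  by (induction i) (simp_all add: D_scale D_funpow_in)

lemma Dpow_in: "a \<in> V \<Longrightarrow> Dpow i a \<in> V"
  by (simp add: Dpow_def V_closed D_funpow_in)

lemma Dpow_0 [simp]: "Dpow 0 a = a"
  by (simp add: Dpow_def)

lemma Dpow_Suc: "a \<in> V \<Longrightarrow> D (Dpow i a) = scale (of_nat (Suc i)) (Dpow (Suc i) a)"
  by (simp add: Dpow_def D_scale D_funpow_in del: of_nat_Suc)

lemma Dpow_add: "a \<in> V \<Longrightarrow> b \<in> V \<Longrightarrow> Dpow i (a + b) = Dpow i a + Dpow i b"
  by (simp add: Dpow_def D_funpow_add scale_right_distrib)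

lemma Dpow_scale: "a \<in> V \<Longrightarrow> Dpow i (scale t a) = scale t (Dpow i a)"
  by (simp add: Dpow_def D_funpow_scale)

lemma Dpow_zero: "Dpow i 0 = 0"
  using Dpow_scale[of 0 i 0] V_closed(1) by simp

lemma scale_of_nat_cancel: "scale (of_nat (Suc i)) u = scale (of_nat (Suc i)) v \<Longrightarrow> u = v"
  by (simp del: of_nat_Suc)

text \<open>This is Y(a, z)1 = e^(zD) a: as D annihilates the vacuum, the bracket yields the
  recurrence of an exponential, started by the creation property.\<close>

lemma Y_vac: "a \<in> V \<Longrightarrow> Y a vac (int n) = Dpow n a"
proof (induction n)
  case 0
  then show ?case by (simp add: creation)
next
  case (Suc n)
  have "scale (of_nat (Suc n)) (Y a vac (int (Suc n))) = D (Y a vac (int n))"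
    using D_bracket[of a vac "int n"] Suc.prems vac_in by (simp add: D_vac Y_zero add.commute)
  also have "\<dots> = scale (of_nat (Suc n)) (Dpow (Suc n) a)"
    using Suc by (simp only: Dpow_Suc)
  finally show ?case by (rule scale_of_nat_cancel)
qed

text \<open>The coefficient of x^n z^l in (x + z)^(n+l), expanded in powers of z.\<close>

abbreviation binom :: "int \<Rightarrow> nat \<Rightarrow> complex"
  where "binom n l \<equiv> of_int (n + int l) gchoose l"

lemma binom_Suc: "of_nat (Suc l) * binom n (Suc l) = of_int (n + int l + 1) * binom n l"
  using gbinomial_absorption[of l "of_int (n + int l + 1) :: complex"] by (simp add: algebra_simps)

lemma binom_Suc': "of_nat (Suc l) * binom n (Suc l) = of_int (n + 1) * binom (n + 1) l"
  using gbinomial_absorb_comp[of "of_int (n + int l + 1) :: complex" l]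
    gbinomial_absorption[of l "of_int (n + int l + 1) :: complex"]
  by (simp add: algebra_simps)

lemma binom_pascal: "binom n (Suc l) = binom n l + binom (n - 1) (Suc l)"
  using gbinomial_Suc_Suc[of "of_int (n + int l) :: complex" l] by (simp add: algebra_simps)

lemma binom_0: "of_nat l gchoose l = (1 :: complex)"
  using binomial_gbinomial[of l l, where 'a = complex] by simp

text \<open>The product rule behind both inductions below: m + 1 = (m + 1 - l) + l.\<close>

lemma sum_Suc_split:
  fixes f g :: "nat \<Rightarrow> 'v"
  shows "(\<Sum>l\<le>m. scale (of_nat (Suc m - l)) (f l)) + (\<Sum>l\<le>m. scale (of_nat (Suc l)) (f (Suc l))) =
    scale (of_nat (Suc m)) (\<Sum>l\<le>Suc m. f l)"
proof -
  have "(\<Sum>l\<le>m. scale (of_nat (Suc l)) (f (Suc l))) = (\<Sum>l\<le>Suc m. scale (of_nat l) (f l))"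
    by (subst sum.atMost_Suc_shift) simp
  moreover have "(\<Sum>l\<le>m. scale (of_nat (Suc m - l)) (f l)) = (\<Sum>l\<le>Suc m. scale (of_nat (Suc m - l)) (f l))"
    by simp
  moreover have "(\<Sum>l\<le>Suc m. scale (of_nat (Suc m - l)) (f l)) + (\<Sum>l\<le>Suc m. scale (of_nat l) (f l)) =
      (\<Sum>l\<le>Suc m. scale (of_nat (Suc m)) (f l))"
    unfolding sum.distrib[symmetric] scale_left_distrib[symmetric]
    by (intro sum.cong refl) (simp add: of_nat_diff del: of_nat_Suc)
  ultimately show ?thesis by (simp only: scale_sum_right)
qed

text \<open>\<open>e\<^sup>z\<^sup>D Y(a, x) b = Y(a, x + z) e\<^sup>z\<^sup>D b\<close>\<close>

lemma Dpow_Y: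
  assumes a: "a \<in> V" and b: "b \<in> V"
  shows "Dpow m (Y a b n) = (\<Sum>l\<le>m. scale (binom n l) (Y a (Dpow (m - l) b) (n + int l)))"
proof (induction m)
  case 0
  show ?case by simp
next
  case (Suc m)
  let ?f = "\<lambda>l. scale (binom n l) (Y a (Dpow (Suc m - l) b) (n + int l))"
  have in_V: "scale (binom n l) (Y a (Dpow i b) k) \<in> V" for i k l
    by (simp add: V_closed Y_in a b Dpow_in)
  have "scale (of_nat (Suc m)) (Dpow (Suc m) (Y a b n)) = D (Dpow m (Y a b n))"
    using a b by (simp only: Dpow_Suc Y_in)
  also have "\<dots> = (\<Sum>l\<le>m. scale (binom n l) (D (Y a (Dpow (m - l) b) (n + int l))))"
    unfolding Suc.IH using in_V by (simp add: D_sum D_scale Y_in a b Dpow_in)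
  also have "\<dots> = (\<Sum>l\<le>m. scale (of_nat (Suc m - l)) (?f l) + scale (of_nat (Suc l)) (?f (Suc l)))"
  proof (intro sum.cong refl)
    fix l assume l: "l \<in> {..m}"
    have "D (Y a (Dpow (m - l) b) (n + int l)) =
        scale (of_nat (Suc (m - l))) (Y a (Dpow (Suc (m - l)) b) (n + int l)) +
        scale (of_int (n + int l + 1)) (Y a (Dpow (m - l) b) (n + int l + 1))"
      using a b by (simp only: D_bracket Dpow_in Dpow_Suc Y_scale)
    then have "scale (binom n l) (D (Y a (Dpow (m - l) b) (n + int l))) =
        scale (of_nat (Suc (m - l)) * binom n l) (Y a (Dpow (Suc (m - l)) b) (n + int l)) +
        scale (of_nat (Suc l) * binom n (Suc l)) (Y a (Dpow (m - l) b) (n + int l + 1))"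
      unfolding binom_Suc by (simp only: scale_right_distrib scale_scale mult.commute)
    moreover have "n + int l + 1 = n + int (Suc l)" by simp
    ultimately show "scale (binom n l) (D (Y a (Dpow (m - l) b) (n + int l))) =
        scale (of_nat (Suc m - l)) (?f l) + scale (of_nat (Suc l)) (?f (Suc l))"
      using l by (simp only: scale_scale diff_Suc_Suc) (simp add: Suc_diff_le del: of_nat_Suc of_int_add)
  qed
  also have "\<dots> = scale (of_nat (Suc m)) (\<Sum>l\<le>Suc m. ?f l)"
    unfolding sum.distrib by (rule sum_Suc_split)
  finally show ?case by (rule scale_of_nat_cancel)
qed

text \<open>\<open>Y(b, x) e\<^sup>z\<^sup>D a = e\<^sup>z\<^sup>D Y(b, x - z) a\<close>\<close>

lemma Y_Dpow:
  assumes a: "a \<in> V" and b: "b \<in> V"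
  shows "Y b (Dpow m a) n = (\<Sum>l\<le>m. scale ((-1) ^ l * binom n l) (Dpow (m - l) (Y b a (n + int l))))"
proof (induction m arbitrary: n)
  case 0
  show ?case by simp
next
  case (Suc m)
  let ?f = "\<lambda>l. scale ((-1) ^ l * binom n l) (Dpow (Suc m - l) (Y b a (n + int l)))"
  have "scale (of_nat (Suc m)) (Y b (Dpow (Suc m) a) n) = Y b (D (Dpow m a)) n"
    using a b by (simp only: Dpow_Suc Y_scale Dpow_in)
  also have "\<dots> = D (Y b (Dpow m a) n) - scale (of_int (n + 1)) (Y b (Dpow m a) (n + 1))"
    using D_bracket[of b "Dpow m a" n] a b by (simp add: Dpow_in del: of_int_add)
  also have "D (Y b (Dpow m a) n) = (\<Sum>l\<le>m. scale (of_nat (Suc m - l)) (?f l))"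
  proof -
    have "D (Y b (Dpow m a) n) = (\<Sum>l\<le>m. scale ((-1) ^ l * binom n l) (D (Dpow (m - l) (Y b a (n + int l)))))"
      unfolding Suc.IH using a b by (simp add: D_sum D_scale Y_in Dpow_in V_closed)
    also have "\<dots> = (\<Sum>l\<le>m. scale (of_nat (Suc m - l)) (?f l))"
    proof (intro sum.cong refl)
      fix l assume "l \<in> {..m}"
      then show "scale ((-1) ^ l * binom n l) (D (Dpow (m - l) (Y b a (n + int l)))) = scale (of_nat (Suc m - l)) (?f l)"
        using a b by (simp add: Dpow_Suc Y_in Suc_diff_le mult.commute del: of_nat_Suc of_int_add)
    qed
    finally show ?thesis .
  qed
  also have "scale (of_int (n + 1)) (Y b (Dpow m a) (n + 1)) = - (\<Sum>l\<le>m. scale (of_nat (Suc l)) (?f (Suc l)))"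
    unfolding Suc.IH scale_sum_right sum_negf[symmetric]
  proof (intro sum.cong refl)
    fix l assume "l \<in> {..m}"
    have "scale (of_int (n + 1)) (scale ((-1) ^ l * binom (n + 1) l) (Dpow (m - l) (Y b a (n + 1 + int l)))) =
        scale ((-1) ^ l * (of_int (n + 1) * binom (n + 1) l)) (Dpow (m - l) (Y b a (n + 1 + int l)))"
      by (simp only: scale_scale mult_ac)
    also have "\<dots> = - scale (of_nat (Suc l)) (?f (Suc l))"
    proof -
      have e: "n + 1 + int l = n + int (Suc l)" by simp
      show ?thesis
        using binom_Suc'[of l n] unfolding e by (simp add: mult_ac del: of_nat_Suc of_int_add)
    qed
    finally show "scale (of_int (n + 1)) (scale ((-1) ^ l * binom (n + 1) l) (Dpow (m - l) (Y b a (n + 1 + int l)))) =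
        - scale (of_nat (Suc l)) (?f (Suc l))" .
  qed
  finally have "scale (of_nat (Suc m)) (Y b (Dpow (Suc m) a) n) = scale (of_nat (Suc m)) (\<Sum>l\<le>Suc m. ?f l)"
    by (simp only: sum_Suc_split[of m ?f] minus_minus diff_minus_eq_add)
  then show ?case by (rule scale_of_nat_cancel)
qed

text \<open>\<open>e\<close> to the power \<open>z\<^sub>1 D\<close>, applied to \<open>f(z\<^sub>2 - z\<^sub>1)\<close>\<close>

definition exp_shift :: "(int \<Rightarrow> 'v) \<Rightarrow> int \<Rightarrow> int \<Rightarrow> 'v"
  where "exp_shift f m n = (if m < 0 then 0 else
    \<Sum>l\<le>nat m. scale ((-1) ^ l * binom n l) (Dpow (nat m - l) (f (n + int l))))"

text \<open>In terms of u = z_2 - z_1, multiplication by z_1 - z_2 is multiplication by -u, a shift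
  of f with a sign; in coefficients this is Pascal's rule.\<close>

lemma mult_diff_exp_shift:
  assumes f: "\<And>n. f n \<in> V"
  shows "mult_diff (exp_shift f) = exp_shift (\<lambda>n. - f (n - 1))"
proof (intro ext)
  fix m n :: int
  have neg: "Dpow i (- x) = - Dpow i x" if "x \<in> V" for i x
    using Dpow_scale[OF that, of i "-1"] by simp
  consider "m < 0" | "m = 0" | "m > 0"
    using linorder_less_linear[of m 0] by blast
  then show "mult_diff (exp_shift f) m n = exp_shift (\<lambda>n. - f (n - 1)) m n"
  proof cases
    case 1
    then show ?thesis by (simp add: mult_diff_def exp_shift_def)
  next
    case 2
    then show ?thesis by (simp add: mult_diff_def exp_shift_def)
  next
    case 3
    define k where "k = nat (m - 1)"
    have m: "m = int (Suc k)" using 3 by (simp add: k_def)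
    define g where "g l = scale ((-1) ^ l) (Dpow (k - l) (f (n + int l)))" for l
    have 1: "exp_shift f (m - 1) n = (\<Sum>l\<le>k. scale (binom n l) (g l))"
      by (simp add: m exp_shift_def g_def mult.commute)
    have e: "n - 1 + int (Suc l) = n + int l" "n + int (Suc l) - 1 = n + int l" for l by simp_all
    have 2: "exp_shift f m (n - 1) = Dpow (Suc k) (f (n - 1)) - (\<Sum>l\<le>k. scale (binom (n - 1) (Suc l)) (g l))"
    proof -
      have "exp_shift f m (n - 1) =
          (\<Sum>l\<le>Suc k. scale ((-1) ^ l * binom (n - 1) l) (Dpow (Suc k - l) (f (n - 1 + int l))))"
        unfolding m exp_shift_def by (simp del: of_nat_Suc sum.atMost_Suc of_int_add of_int_diff)
      also have "\<dots> = Dpow (Suc k) (f (n - 1)) +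
          (\<Sum>l\<le>k. scale ((-1) ^ Suc l * binom (n - 1) (Suc l)) (Dpow (k - l) (f (n + int l))))"
        by (subst sum.atMost_Suc_shift) (simp only: e diff_Suc_Suc, simp)
      finally show ?thesis by (simp add: g_def sum_negf mult.commute del: of_nat_Suc of_int_add of_int_diff)
    qed
    have 3: "exp_shift (\<lambda>n. - f (n - 1)) m n = - Dpow (Suc k) (f (n - 1)) + (\<Sum>l\<le>k. scale (binom n (Suc l)) (g l))"
    proof -
      have "exp_shift (\<lambda>n. - f (n - 1)) m n =
          (\<Sum>l\<le>Suc k. scale ((-1) ^ l * binom n l) (- Dpow (Suc k - l) (f (n + int l - 1))))"
        unfolding m exp_shift_def by (simp add: neg f del: of_nat_Suc sum.atMost_Suc of_int_add of_int_diff)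
      also have "\<dots> = - Dpow (Suc k) (f (n - 1)) +
          (\<Sum>l\<le>k. scale ((-1) ^ Suc l * binom n (Suc l)) (- Dpow (k - l) (f (n + int l))))"
        by (subst sum.atMost_Suc_shift) (simp only: e diff_Suc_Suc, simp)
      finally show ?thesis by (simp add: g_def mult.commute del: of_nat_Suc of_int_add of_int_diff)
    qed
    show ?thesis
      unfolding mult_diff_def 1 2 3 binom_pascal[of n] scale_left_distrib sum.distrib by simp
  qed
qed

lemma mult_diff_funpow_exp_shift:
  assumes f: "\<And>n. f n \<in> V"
  shows "(mult_diff ^^ k) (exp_shift f) = exp_shift (\<lambda>n. scale ((-1) ^ k) (f (n - int k)))"
proof (induction k)
  case (Suc k)
  have "(mult_diff ^^ Suc k) (exp_shift f) = exp_shift (\<lambda>n. - scale ((-1) ^ k) (f (n - 1 - int k)))"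
    by (simp add: Suc mult_diff_exp_shift V_closed f)
  also have "(\<lambda>n. - scale ((-1) ^ k) (f (n - 1 - int k))) = (\<lambda>n. scale ((-1) ^ Suc k) (f (n - int (Suc k))))"
    by (simp add: fun_eq_iff algebra_simps)
  finally show ?case .
qed simp

text \<open>Setting z_2 = 0: without negative powers of z_2, only the term z_1^k of (z_1 - z_2)^k
  reaches z_2^0.\<close>

lemma mult_diff_funpow_at_0:
  fixes F :: "int \<Rightarrow> int \<Rightarrow> 'v"
  assumes "\<And>m n. n < 0 \<Longrightarrow> F m n = 0"
  shows "(mult_diff ^^ k) F m 0 = F (m - int k) 0"
proof (induction k arbitrary: m)
  case (Suc k)
  have "(mult_diff ^^ k) F m (-1) = 0"
    by (rule mult_diff_funpow_right0[of 0]) (simp_all add: assms)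
  then have "(mult_diff ^^ Suc k) F m 0 = (mult_diff ^^ k) F (m - 1) 0"
    by (simp add: mult_diff_def[of "(mult_diff ^^ k) F"])
  then show ?case by (simp add: Suc.IH diff_diff_eq)
qed simp

lemma Sum_any_atMost:
  fixes f :: "nat \<Rightarrow> 'v"
  assumes "\<And>s. s > R \<Longrightarrow> f s = 0"
  shows "Sum_any f = (\<Sum>s\<le>R. f s)"
  by (rule Sum_any.expand_superset) (use assms not_le in auto)

text \<open>Y(b, z_2)Y(a, z_1)1 = Y(b, z_2)e^(z_1 D)a = e^(z_1 D)Y(b, z_2 - z_1)a. Commutativity on
  the vacuum compares this with Y(a, z_1)Y(b, z_2)1, and once (z_1 - z_2)^k removes the poles, z_2
  can be set to 0.\<close>

lemma skew_symmetry:
  assumes a: "a \<in> V" and b: "b \<in> V"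
  shows "Y a b n = Sum_any (\<lambda>s. Dpow s (scale (parity_sign (n - int s)) (Y b a (n - int s))))"
proof -
  obtain k0 where k0: "(mult_diff ^^ k0) (commutator (Y a) (Y b) vac) = 0"
    using commutativity[OF a b] vac_in by blast
  obtain N1 where N1: "\<forall>n<N1. Y a b n = 0" using Y_low a b by blast
  obtain N2 where N2: "\<forall>n<N2. Y b a n = 0" using Y_low a b by blast
  \<comment> \<open>Large enough for commutativity on the vacuum and for the poles of both products,
    so that z^k times either product is a power series.\<close>
  define k where "k = max k0 (max (nat (- N1)) (nat (- N2)))"
  have k: "Y a b n = 0" "Y b a n = 0" if "n < - int k" for n
    using that N1 N2 by (auto simp: k_def)
  have "(mult_diff ^^ k) (commutator (Y a) (Y b) vac) = 0"
    using k0 by (rule mult_diff_funpow_zero_mono) (simp add: k_def)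
  moreover define F where "F = (\<lambda>m n. Y a (Y b vac n) m)"
  moreover have "(\<lambda>m n. Y b (Y a vac m) n) = exp_shift (Y b a)"
  proof (intro ext)
    fix m n
    show "Y b (Y a vac m) n = exp_shift (Y b a) m n"
    proof (cases "m < 0")
      case True
      then show ?thesis by (simp add: exp_shift_def creation a Y_zero b)
    next
      case False
      then have "Y a vac m = Dpow (nat m) a" using Y_vac[OF a, of "nat m"] by simp
      then show ?thesis using False by (simp add: exp_shift_def Y_Dpow a b)
    qed
  qed
  moreover have "commutator (Y a) (Y b) vac = (\<lambda>m n. Y a (Y b vac n) m) - (\<lambda>m n. Y b (Y a vac m) n)"
    by (simp add: commutator_def fun_eq_iff)
  ultimately have eq: "(mult_diff ^^ k) F = (mult_diff ^^ k) (exp_shift (Y b a))"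
    by (metis mult_diff_funpow_diff right_minus_eq)
  show ?thesis
  proof (cases "n < - int k")
    case True
    then show ?thesis by (simp add: k Dpow_zero)
  next
    case False
    define m where "m = nat (n + int k)"
    have n: "n = int m - int k" using False by (simp add: m_def)
    have "Y a b n = (mult_diff ^^ k) F (int m) 0"
      by (subst mult_diff_funpow_at_0) (simp_all add: F_def creation a b Y_zero n)
    \<comment> \<open>At z_2^0 every binomial coefficient is 1.\<close>
    also have "\<dots> = (\<Sum>l\<le>m. scale ((-1) ^ l) (Dpow (m - l) (scale ((-1) ^ k) (Y b a (int l - int k)))))"
      unfolding eq mult_diff_funpow_exp_shift[OF Y_in[OF b a]] exp_shift_def
      by (simp add: binom_0)
    also have "\<dots> = (\<Sum>s\<le>m. Dpow s (scale (parity_sign (n - int s)) (Y b a (n - int s))))"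
    proof (rule sum.reindex_bij_witness[of _ "\<lambda>s. m - s" "\<lambda>l. m - l"])
      fix l assume "l \<in> {..m}"
      then have "n - int (m - l) = int l - int k" by (simp add: n of_nat_diff)
      moreover have "parity_sign (int l - int k) = (-1) ^ l * (-1) ^ k"
        by (simp add: parity_sign_def flip: power_add)
      ultimately show "Dpow (m - l) (scale (parity_sign (n - int (m - l))) (Y b a (n - int (m - l)))) =
          scale ((-1) ^ l) (Dpow (m - l) (scale ((-1) ^ k) (Y b a (int l - int k))))"
        using a b by (simp add: Dpow_scale Y_in)
    qed auto
    also have "\<dots> = Sum_any (\<lambda>s. Dpow s (scale (parity_sign (n - int s)) (Y b a (n - int s))))"
      by (rule Sum_any_atMost[symmetric]) (simp add: n k Dpow_zero)
    finally show ?thesis .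
  qed
qed

text \<open>\<open>e\<close> to the power \<open>x\<^sub>2 D\<close>, applied to \<open>G(x\<^sub>0, x\<^sub>2)\<close>\<close>

definition exp_sum :: "(int \<Rightarrow> int \<Rightarrow> 'v) \<Rightarrow> int \<Rightarrow> int \<Rightarrow> 'v"
  where "exp_sum G p q = Sum_any (\<lambda>s. Dpow s (G p (q - int s)))"

definition row_bounded :: "(int \<Rightarrow> int \<Rightarrow> 'v) \<Rightarrow> bool"
  where "row_bounded G \<longleftrightarrow> (\<forall>p n. G p n \<in> V) \<and> (\<forall>p. \<exists>N. \<forall>n<N. G p n = 0)"

lemma exp_sum_eq:
  assumes "\<And>n. n < N \<Longrightarrow> G p n = 0" "nat (q - N) \<le> R"
  shows "exp_sum G p q = (\<Sum>s\<le>R. Dpow s (G p (q - int s)))"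
  unfolding exp_sum_def by (rule Sum_any_atMost) (use assms in \<open>simp add: Dpow_zero\<close>)

lemma row_bounded_mult_sum:
  assumes "row_bounded G"
  shows "row_bounded (mult_sum G)"
  unfolding row_bounded_def
proof (intro conjI allI)
  fix p n
  show "mult_sum G p n \<in> V" using assms by (simp add: mult_sum_def row_bounded_def V_closed)
  obtain N where N: "\<forall>n<N. G p n = 0" using assms unfolding row_bounded_def by blast
  obtain M where M: "\<forall>n<M. G (p - 1) n = 0" using assms unfolding row_bounded_def by blast
  have "\<forall>n<min M N. mult_sum G p n = 0" using N M by (simp add: mult_sum_def)
  then show "\<exists>N. \<forall>n<N. mult_sum G p n = 0" ..
qed

lemma mult_sum_exp_sum:
  assumes G: "row_bounded G"
  shows "mult_sum (exp_sum G) = exp_sum (mult_sum G)"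
proof (intro ext)
  fix p q
  obtain N0 where N0: "\<forall>n<N0. G p n = 0" using G unfolding row_bounded_def by blast
  obtain M0 where M0: "\<forall>n<M0. G (p - 1) n = 0" using G unfolding row_bounded_def by blast
  define N where "N = min M0 N0"
  have N: "n < N \<Longrightarrow> G p n = 0" "n < N \<Longrightarrow> G (p - 1) n = 0" "n < N \<Longrightarrow> mult_sum G p n = 0" for n
    using N0 M0 by (auto simp: N_def mult_sum_def)
  define R where "R = nat (q - N)"
  have "mult_sum (exp_sum G) p q = (\<Sum>s\<le>R. Dpow s (G (p - 1) (q - int s))) + (\<Sum>s\<le>R. Dpow s (G p (q - 1 - int s)))"
  proof -
    have "exp_sum G (p - 1) q = (\<Sum>s\<le>R. Dpow s (G (p - 1) (q - int s)))"
      by (rule exp_sum_eq[where N = N]) (simp_all add: N R_def)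
    moreover have "exp_sum G p (q - 1) = (\<Sum>s\<le>R. Dpow s (G p (q - 1 - int s)))"
      by (rule exp_sum_eq[where N = N]) (simp_all add: N R_def)
    ultimately show ?thesis by (simp add: mult_sum_def)
  qed
  also have "\<dots> = (\<Sum>s\<le>R. Dpow s (mult_sum G p (q - int s)))"
    using G unfolding sum.distrib[symmetric]
    by (intro sum.cong refl) (simp add: mult_sum_def row_bounded_def Dpow_add algebra_simps)
  also have "\<dots> = exp_sum (mult_sum G) p q"
    by (rule exp_sum_eq[symmetric, where N = N]) (simp_all add: N R_def)
  finally show "mult_sum (exp_sum G) p q = exp_sum (mult_sum G) p q" .
qed

lemma mult_sum_funpow_exp_sum:
  "row_bounded G \<Longrightarrow> (mult_sum ^^ k) (exp_sum G) = exp_sum ((mult_sum ^^ k) G)"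
  by (induction k arbitrary: G)
     (simp_all add: funpow_Suc_right mult_sum_exp_sum row_bounded_mult_sum del: funpow.simps(2))

text \<open>G(x_0, -x_2): this turns the factor x_0 - x_2 of commutativity into the factor x_0 + x_2
  of associativity.\<close>

definition alternate :: "(int \<Rightarrow> int \<Rightarrow> 'v) \<Rightarrow> int \<Rightarrow> int \<Rightarrow> 'v"
  where "alternate G p n = scale (parity_sign n) (G p n)"

lemma mult_sum_funpow_alternate: "(mult_sum ^^ k) (alternate G) = alternate ((mult_diff ^^ k) G)"
  by (induction k) (simp_all add: mult_sum_def mult_diff_def alternate_def fun_eq_iff scale_right_diff_distrib)

lemma row_bounded_alternate: "row_bounded G \<Longrightarrow> row_bounded (alternate G)"
  unfolding row_bounded_def alternate_def by (metis V_closed(3) scale_zero_right)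

lemma Y_Y_exp_sum:
  assumes a: "a \<in> V" and b: "b \<in> V" and c: "c \<in> V"
  shows "(\<lambda>p q. Y (Y a b p) c q) = exp_sum (alternate (\<lambda>p n. Y c (Y a b p) n))"
proof (intro ext)
  fix p q
  show "Y (Y a b p) c q = exp_sum (alternate (\<lambda>p n. Y c (Y a b p) n)) p q"
    unfolding exp_sum_def alternate_def by (rule skew_symmetry) (simp_all add: Y_in a b c)
qed

text \<open>Skew symmetry for b and c gives Y(a, x_0 + x_2)e^(x_2 D)Y(c, -x_2)b; pulling the
  exponential to the left by \<open>Dpow_Y\<close> turns x_0 + x_2 into x_0.\<close>

lemma subst_sum_exp_sum:
  assumes a: "a \<in> V" and b: "b \<in> V" and c: "c \<in> V"
  shows "subst_sum scale (field_prod (Y a) (Y b) c) = exp_sum (alternate (\<lambda>p n. Y a (Y c b n) p))"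
proof (intro ext)
  fix p q
  obtain N1 where N1: "\<forall>n<N1. Y b c n = 0" using Y_low b c by blast
  obtain N2 where N2: "\<forall>n<N2. Y c b n = 0" using Y_low b c by blast
  define N where "N = min N1 N2"
  have N: "Y b c n = 0" "Y c b n = 0" if "n < N" for n using that N1 N2 by (auto simp: N_def)
  define v where "v n = scale (parity_sign n) (Y c b n)" for n
  have v: "v n \<in> V" for n by (simp add: v_def V_closed Y_in b c)
  have v0: "v n = 0" if "n < N" for n using that by (simp add: v_def N)
  define S where "S = nat (q - N)"
  let ?t = "\<lambda>i s. scale (binom p i) (Y a (Dpow (s - i) (v (q - int s))) (p + int i))"
  have Ybc: "Y b c n = (\<Sum>t\<le>R. Dpow t (v (n - int t)))" if "nat (n - N) \<le> R" for n R
  proof -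
    have "Y b c n = Sum_any (\<lambda>t. Dpow t (v (n - int t)))"
      using skew_symmetry[OF b c, of n] by (simp add: v_def)
    also have "\<dots> = (\<Sum>t\<le>R. Dpow t (v (n - int t)))"
      by (rule Sum_any_atMost) (use that v0 in \<open>simp add: Dpow_zero\<close>)
    finally show ?thesis .
  qed
  have "subst_sum scale (field_prod (Y a) (Y b) c) p q =
      Sum_any (\<lambda>i. scale (binom p i) (Y a (Y b c (q - int i)) (p + int i)))"
    by (simp add: subst_sum_def field_prod_def)
  also have "\<dots> = (\<Sum>i\<le>S. scale (binom p i) (Y a (Y b c (q - int i)) (p + int i)))"
    by (rule Sum_any_atMost) (simp add: S_def N Y_zero a)
  also have "\<dots> = (\<Sum>i\<le>S. \<Sum>s\<in>{i..S}. ?t i s)"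
  proof (intro sum.cong refl)
    fix i assume "i \<in> {..S}"
    then have i: "i \<le> S" by simp
    have "Y b c (q - int i) = (\<Sum>t\<le>S - i. Dpow t (v (q - int i - int t)))"
      by (rule Ybc) (use i in \<open>simp add: S_def\<close>)
    also have "\<dots> = (\<Sum>s\<in>{i..S}. Dpow (s - i) (v (q - int s)))"
      by (rule sum.reindex_bij_witness[of _ "\<lambda>s. s - i" "\<lambda>t. t + i"])
         (use i in \<open>auto simp: algebra_simps of_nat_diff\<close>)
    finally have "Y a (Y b c (q - int i)) (p + int i) = (\<Sum>s\<in>{i..S}. Y a (Dpow (s - i) (v (q - int s))) (p + int i))"
      by (simp only: Y_sum[OF a] Dpow_in[OF v])
    then show "scale (binom p i) (Y a (Y b c (q - int i)) (p + int i)) = (\<Sum>s\<in>{i..S}. ?t i s)"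
      by (simp only: scale_sum_right)
  qed
  \<comment> \<open>For fixed s the inner sum is the right-hand side of
    \<open>Dpow_Y\<close>.\<close>
  also have "\<dots> = (\<Sum>s\<le>S. \<Sum>i\<le>s. ?t i s)"
    unfolding sum.Sigma[OF finite_atMost ballI[OF finite_atLeastAtMost]] sum.Sigma[OF finite_atMost ballI[OF finite_atMost]]
    by (rule sum.reindex_bij_witness[of _ "\<lambda>(s, i). (i, s)" "\<lambda>(i, s). (s, i)"]) auto
  also have "\<dots> = (\<Sum>s\<le>S. Dpow s (Y a (v (q - int s)) p))"
    by (simp only: Dpow_Y[OF a v])
  also have "\<dots> = exp_sum (alternate (\<lambda>p n. Y a (Y c b n) p)) p q"
    by (subst exp_sum_eq[where N = N and R = S])
       (auto simp: alternate_def N Y_zero a S_def v_def Y_scale Y_in b c)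
  finally show "subst_sum scale (field_prod (Y a) (Y b) c) p q = exp_sum (alternate (\<lambda>p n. Y a (Y c b n) p)) p q" .
qed

text \<open>Both sides are e^(x_2 D) applied, at -x_2, to the two orders of Y(a, x_0) and Y(c, x_2)
  on b. So the exponent of commutativity for a and c serves for associativity.\<close>

lemma weak_associativity:
  assumes a: "a \<in> V" and b: "b \<in> V" and c: "c \<in> V"
  shows "\<exists>l. (mult_sum ^^ l) (subst_sum scale (field_prod (Y a) (Y b) c)) =
    (mult_sum ^^ l) (\<lambda>p q. Y (Y a b p) c q)"
proof -
  define G where "G = (\<lambda>p n. Y a (Y c b n) p)"
  define G' where "G' = (\<lambda>p n. Y c (Y a b p) n)"
  obtain k where "(mult_diff ^^ k) (commutator (Y a) (Y c) b) = 0"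
    using commutativity[OF a c] b by blast
  moreover have "commutator (Y a) (Y c) b = G - G'"
    by (simp add: commutator_def G_def G'_def fun_eq_iff)
  ultimately have eq: "(mult_diff ^^ k) G = (mult_diff ^^ k) G'"
    by (metis mult_diff_funpow_diff right_minus_eq)
  have G: "row_bounded G"
    unfolding row_bounded_def G_def
  proof (intro conjI allI)
    fix p
    obtain N where "\<forall>n<N. Y c b n = 0" using Y_low c b by blast
    then have "\<forall>n<N. Y a (Y c b n) p = 0" by (simp add: Y_zero a)
    then show "\<exists>N. \<forall>n<N. Y a (Y c b n) p = 0" ..
  qed (simp add: Y_in a b c)
  have G': "row_bounded G'"
    unfolding row_bounded_def G'_def
  proof (intro conjI allI)
    fix p
    show "\<exists>N. \<forall>n<N. Y c (Y a b p) n = 0" by (rule Y_low) (simp_all add: Y_in a b c)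
  qed (simp add: Y_in a b c)
  show ?thesis
    unfolding Y_Y_exp_sum[OF assms] subst_sum_exp_sum[OF assms] G_def[symmetric] G'_def[symmetric]
    by (rule exI[of _ k])
       (simp only: mult_sum_funpow_exp_sum row_bounded_alternate G G' mult_sum_funpow_alternate eq)
qed

end

section \<open>The vertex algebra of a closed space of fields\<close>

locale closed_field_space = flow_space scale \<epsilon>
  for scale :: "complex \<Rightarrow> 'w::ab_group_add \<Rightarrow> 'w" and \<epsilon> :: int +
  fixes V :: "('w \<Rightarrow> int \<Rightarrow> 'w) set"
  assumes closed: "closed_local_subspace scale \<epsilon> V" and id_in: "id_field \<in> V"
begin

lemma subspace_V: "E.subspace V"
  using closed by (simp add: closed_local_subspace_def)

lemma V_fields: "a \<in> V \<Longrightarrow> a \<in> fields\<^sub>W"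
  using closed unfolding closed_local_subspace_def local_subset_def by blast

lemma V_local: "a \<in> V \<Longrightarrow> b \<in> V \<Longrightarrow> mutually_local UNIV a b"
  using closed by (simp add: closed_local_subspace_def local_subset_def)

lemma V_compatible: "a \<in> V \<Longrightarrow> b \<in> V \<Longrightarrow> compatible a b"
  by (intro compatible_if_mutually_local V_fields V_local)

lemma Y_E_in: "a \<in> V \<Longrightarrow> b \<in> V \<Longrightarrow> YE a b n \<in> V"
proof -
  assume "a \<in> V" "b \<in> V"
  then have "nth_product scale \<epsilon> a (- n - 1) b \<in> V"
    using closed by (simp add: closed_local_subspace_def)
  then show ?thesis by (simp add: nth_product_def)
qed

text \<open>The right-hand side is the mode a_(-2)1. It arises from the bracket at n = 0 on the
  vacuum, and it shows that V is closed under D.\<close>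

lemma field_deriv_eq: "a \<in> V \<Longrightarrow> field_deriv a = YE a id_field 1"
proof -
  assume a: "a \<in> V"
  have 0: "0 \<in> V" using subspace_V by (rule E.subspace_0)
  have "YE a 0 0 = 0"
    using Y_E_scale_right[of a id_field 0 0] a id_in 0 by (simp add: V_fields V_compatible)
  then show ?thesis
    using Y_E_field_deriv_right[of a id_field 0] a id_in 0
    by (simp add: V_fields V_compatible field_deriv_id Y_E_id_right)
qed

sublocale translation_covariant_field_algebra "scale_field scale" V "YE" id_field field_deriv
proof
  show "E.subspace V" by (rule subspace_V)
  show "id_field \<in> V" by (rule id_in)
  show "field_deriv id_field = 0" by (rule field_deriv_id)
next
  fix a b c :: "'w \<Rightarrow> int \<Rightarrow> 'w" and n t
  assume a: "a \<in> V"
  show dV: "field_deriv a \<in> V" unfolding field_deriv_eq[OF a] by (intro Y_E_in a id_in)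
  show "n < 0 \<Longrightarrow> YE a id_field n = 0" "YE a id_field 0 = a"
    using a id_in by (simp_all add: Y_E_id_right V_fields V_compatible)
  show "field_deriv (scale_field scale t a) = scale_field scale t (field_deriv a)"
    by (simp add: fun_eq_iff field_deriv_nth scale_field_nth mult.commute)
  assume b: "b \<in> V"
  show "YE a b n \<in> V" by (rule Y_E_in[OF a b])
  show "\<exists>N. \<forall>n<N. YE a b n = 0" by (intro Y_E_low V_fields V_compatible a b)
  show "YE a (scale_field scale t b) n = scale_field scale t (YE a b n)"
    by (intro Y_E_scale_right V_fields V_compatible a b E.subspace_scale[OF subspace_V])
  show "field_deriv (a + b) = field_deriv a + field_deriv b"
    by (simp add: fun_eq_iff field_deriv_nth W.scale_right_distrib)
  show "\<exists>k. \<forall>c\<in>V. (mult_diff ^^ k) (commutator (YE a) (YE b) c) = 0"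
  proof -
    obtain k where "\<And>w. (mult_diff ^^ k) (commutator a b w) = 0"
      using V_local[OF a b] unfolding mutually_local_iff by blast
    \<comment> \<open>Doubling makes the exponent even, as \<open>Y_E_weak_commutativity\<close>
      requires.\<close>
    then have k: "(mult_diff ^^ (2 * k)) (commutator a b w) = 0" for w
      by (rule mult_diff_funpow_zero_mono) simp
    have "(mult_diff ^^ (2 * k)) (commutator (YE a) (YE b) c) = 0" if "c \<in> V" for c
      using a b that
      by (intro Y_E_weak_commutativity k V_fields V_local V_compatible Y_E_in) simp_all
    then show ?thesis by blast
  qed
  assume c: "c \<in> V"
  show "YE a (b + c) n = YE a b n + YE a c n"
    by (intro Y_E_add_right V_fields V_compatible a b c E.subspace_add[OF subspace_V])
next
  fix a b :: "'w \<Rightarrow> int \<Rightarrow> 'w" and n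
  assume a: "a \<in> V" and b: "b \<in> V"
  have "field_deriv b \<in> V" unfolding field_deriv_eq[OF b] by (intro Y_E_in b id_in)
  then show "field_deriv (YE a b n) =
      YE a (field_deriv b) n + scale_field scale (of_int (n + 1)) (YE a b (n + 1))"
    by (intro Y_E_field_deriv_right V_fields V_compatible a b)
qed

lemma vertex_algebra_Y_E: "vertex_algebra (scale_field scale) V (YE) id_field"
proof
  show "E.subspace V" by (rule subspace_V)
  show "id_field \<in> V" by (rule id_in)
next
  fix u assume u: "u \<in> V"
  have "YE u b \<in> laurent V" if "b \<in> V" for b
    using Y_low[OF u that] Y_in[OF u that] by (simp add: laurent_def)
  then show "YE u \<in> Hom_laurent (scale_field scale) V"
    unfolding Hom_laurent_def linear_on_def
    using u by (simp add: Y_add Y_scale scale_series_def fun_eq_iff)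
  show "YE id_field u = monomial0 u"
    using u id_in by (intro Y_E_id_left V_fields V_compatible)
  show "n < 0 \<Longrightarrow> YE u id_field n = 0" for n using u by (rule creation)
  show "YE u id_field 0 = u" using u by (rule creation)
  show "linear_on V (scale_field scale) (scale_series (scale_field scale)) (\<lambda>a. YE a u)"
    unfolding linear_on_def
  proof (intro conjI ballI allI)
    fix a b c assume a: "a \<in> V" 
    show "YE (scale_field scale c a) u = scale_series (scale_field scale) c (YE a u)"
      unfolding scale_series_def
      by (rule ext) (intro Y_E_scale_left V_fields V_compatible a u E.subspace_scale[OF subspace_V])
    assume b: "b \<in> V"
    show "YE (a + b) u = YE a u + YE b u"
      unfolding plus_fun_def[of "YE a u"]
      by (rule ext) (intro Y_E_add_left V_fields V_compatible a b u E.subspace_add[OF subspace_V])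
  qed
  fix v assume v: "v \<in> V"
  show "mutually_local V (YE u) (YE v)"
    unfolding mutually_local_iff by (rule commutativity[OF u v])
  fix w assume w: "w \<in> V"
  show "\<exists>l. (mult_sum ^^ l) (subst_sum (scale_field scale) (field_prod (YE u) (YE v) w)) =
      (mult_sum ^^ l) (\<lambda>p q. YE (YE u v p) w q)"
    by (rule weak_associativity[OF u v w])
qed

text \<open>The module identity is the relation that characterises Y(u, z)v, read at an exponent k
  of compatibility.\<close>

lemma phi_coordinated_module_Y_E:
  "phi_coordinated_module \<epsilon> (scale_field scale) V (YE) id_field scale (\<lambda>\<alpha>. \<alpha>)"
proof (intro phi_coordinated_module.intro phi_coordinated_module_axioms.intro vertex_algebra_Y_E W.vector_space_axioms)
  show "(v :: 'w \<Rightarrow> int \<Rightarrow> 'w) \<in> fields\<^sub>W" if "v \<in> V" for v using that by (rule V_fields)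
  show "linear_on V (scale_field scale) (scale_series scale) (\<lambda>v. v w)" for w
    by (simp add: linear_on_def scale_field_def)
  show "id_field = monomial0" by (rule id_field_def)
  fix u v assume u: "u \<in> V" and v: "v \<in> V"
  obtain k where k: "compatible_order scale u v k" "\<And>w. phi_subst (prod_fls u v w) (YE_fls u v w)"
    "\<And>w n j. YE_fls u v w $$ n $$ j = YE u v n w j"
    using V_fields[OF u] V_fields[OF v] V_compatible[OF u v] by (rule Y_E_fls) blast
  have "smult_series scale (pm ^ k) (\<lambda>i j. YE u v i w j) =
      subst_phi scale \<epsilon> ((mult_diff ^^ k) (field_prod u v w))" for w
  proof (intro ext)
    fix i j
    have bd: "bounded ((mul_diff ^^ k) (prod_fls u v w))"
      using V_fields[OF u] V_fields[OF v] k(1) by (rule compatible_order_bounded)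
    have "smult_series scale (pm ^ k) (\<lambda>i j. YE u v i w j) i j = (pm ^ k \<bullet>z YE_fls u v w) $$ i $$ j"
      by (simp only: k(3)[symmetric] smult_series_eq)
    also have "\<dots> = Sub ((mul_diff ^^ k) (prod_fls u v w)) $$ i $$ j"
      by (simp only: phi_substD[OF k(2) bd])
    also have "\<dots> = subst_phi scale \<epsilon> ((mult_diff ^^ k) (field_prod u v w)) i j"
      by (simp add: Sub_nth_nth_subst_phi[OF bd] mul_diff_funpow_prod_nth V_fields u v)
    finally show "smult_series scale (pm ^ k) (\<lambda>i j. YE u v i w j) i j =
      subst_phi scale \<epsilon> ((mult_diff ^^ k) (field_prod u v w)) i j" .
  qed
  then show "\<exists>k. (\<lambda>w. (mult_diff ^^ k) (field_prod u v w)) \<in> Hom_laurent2 scale \<and>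
      (\<forall>w. smult_series scale (pm ^ k) (\<lambda>i j. YE u v i w j) =
        subst_phi scale \<epsilon> ((mult_diff ^^ k) (field_prod u v w)))"
    using k(1) unfolding compatible_order_def by blast
qed

end

theorem theorem3p12:
  fixes \<epsilon> :: int
    and scale :: "complex \<Rightarrow> 'w::ab_group_add \<Rightarrow> 'w"
    and U :: "('w \<Rightarrow> int \<Rightarrow> 'w) set"
  assumes "vector_space scale"
    and "local_subset scale U"
  shows "vertex_algebra (scale_field scale) (generated scale \<epsilon> U) (Y_E scale \<epsilon>) id_field
       \<and> phi_coordinated_module \<epsilon> (scale_field scale) (generated scale \<epsilon> U) (Y_E scale \<epsilon>) id_field
           scale (\<lambda>\<alpha>. \<alpha>)"
proof -
  interpret flow_space scale \<epsilon>
    by (rule flow_space.intro) (rule assms(1))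
  interpret closed_field_space scale \<epsilon> "generated scale \<epsilon> U"
    by unfold_locales (rule closed_generated[OF assms(2)])+
  show ?thesis using vertex_algebra_Y_E phi_coordinated_module_Y_E by blast
qed

end
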